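(* The theory $\mathrm{RCA}_0^{\Omega}+\mathrm{STP}$ proves $(S^2)^{\mathrm{st}}\leftrightarrow(\mathrm{RB})$, where $(\mathrm{RB})$ is the statement: there is a standard functional $\Phi^{1\to1}$ such that for all standard $f^1$ and all $M\in\Omega$, $$(\forall g^{0}\leq_{0^{*}}\overline{\Phi(f)}M)(\exists x^{0}\leq M)(f(\overline{g}x)=0)\leftrightarrow(\forall g^{1})(\exists x^{0})(f(\overline{g}x)=0).$$
   Context: BASE THEORY. Finite types: $0$ (natural numbers), $\sigma\to\tau$, and $\sigma^{*}$ (finite sequences of objects of type $\sigma$); $1=0\to 0$, $2=1\to 0$, $3=2\to 0$. Superscripts indicate types; tuples are coded as single objects where convenient. Equality $=_0$ is primitive; for $\tau=\tau_1\to\dots\to\tau_k\to 0$, $x=_\tau y$ means $(\forall z_1\dots z_k)(xz_1\dots z_k=_0 yz_1\dots z_k)$. $\mathrm{RCA}_0^{\omega}$ is Kohlenbach's higher-order base theory: classical arithmetic in all finite types with combinators, zero, successor, the recursor $R_0$ (primitive recursion with type $0$ values), quantifier-free induction, extensionality $x=_\rho y\to\varphi(x)=_\tau\varphi(y)$ for all $\varphi^{\rho\to\tau}$, and $\mathrm{QF\text{-}AC}^{1,0}$, where $\mathrm{QF\text{-}AC}^{\sigma,\tau}$ is $(\forall x^\sigma)(\exists y^\tau)A_0(x,y)\to(\exists F^{\sigma\to\tau})(\forall x)A_0(x,F(x))$ for quantifier-free $A_0$. $\mathrm{RCA}_0^{\Omega}$ extends $\mathrm{RCA}_0^{\omega}$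 (with the types $\sigma^*$) by a predicate $\mathrm{st}$ ("is standard") for each type. A formula is internal if it does not contain $\mathrm{st}$; $(\forall^{\mathrm{st}}x)A$ is $(\forall x)(\mathrm{st}(x)\to A)$, $(\exists^{\mathrm{st}}x)A$ is $(\exists x)(\mathrm{st}(x)\wedge A)$; $N\in\Omega$ means $\neg\mathrm{st}(N^0)$; $A^{\mathrm{st}}$ is $A$ with all quantifiers (except bounded number quantifiers) relativised to $\mathrm{st}$. Axioms: (i) standardness respects equality, closed terms are standard, a standard functional applied to a standard object is standard, and numbers below a standard number are standard; (ii) Idealization: $(\forall^{\mathrm{st}}x^{\sigma^*})(\exists y^\tau)(\forall z\in x)\varphi(z,y)\to(\exists y)(\forall^{\mathrm{st}}z^{\sigma})\varphi(z,y)$ for internal $\varphi$; (iii) $\mathrm{HAC}_{\mathrm{int}}$: $(\forall^{\mathrm{st}}x^{\rho})(\exists^{\mathrm{st}}y^{\tau})\varphi(x,y)\to(\exists^{\mathrm{st}}\Phi^{\rho\to\tau^*})(\forall^{\mathrm{st}}x)(\exists y\in\Phi(x))\varphi(x,y)$ for internal $\varphi$; (iv) $\mathrm{PF\text{-}TP}_\forall$: $(\forall^{\mathrm{st}}x^\tau)\varphi(x)\to(\forall x^\tau)\varphi(x)$ for internal $\varphi(x)$ with no parameters other than $x$; (v) for certain functionals uniquely specified by a parameter-free internal formula $D$ (e.g. the Suslin functional in $(S^2)$), a constant $\Xi_0$ with the axiom $\mathrm{st}(\Xi_0)\wedge(\forall^{\mathrm{st}}\Xi)[D^{\mathrm{st}}(\Xi)\to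 \Xi_0$ and $\Xi$ agree on all standard inputs$]$; these constants do not count as parameters in (iv). NOTATION. $\overline{g}x$ is the (code of the) initial segment of $g$ of length $x$; for (codes of) finite sequences $\tau,\sigma$, $\tau\leq_{0^*}\sigma$ means $|\tau|=|\sigma|\wedge(\forall i<|\sigma|)(\tau(i)\leq_0\sigma(i))$. Sets $X^1$ are given by characteristic functions. PRINCIPLES. $\mathrm{STP}$ (standard part principle): $(\forall X^1)(\exists^{\mathrm{st}}Y^1)(\forall^{\mathrm{st}}x^0)(x\in X\leftrightarrow x\in Y)$. $(S^2)$ (Suslin functional): $(\exists S^2)(\forall f^1)[S(f)=_00\leftrightarrow(\exists g^1)(\forall x^0)(f(\overline{g}x)\neq0)]$. *)

theory Defs
  imports Main
begin

section \<open>Finite types, terms and formulas\<close>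

datatype ty = Ty0 | Fun ty ty (infixr \<open>\<rightarrow>\<close> 60) | Seq ty

abbreviation "Ty1 \<equiv> Ty0 \<rightarrow> Ty0"
abbreviation "Ty2 \<equiv> Ty1 \<rightarrow> Ty0"

type_synonym var = "nat \<times> ty"

text \<open>
  \<open>Tab\<close> turns \<open>f\<close> of type \<open>0 \<rightarrow> \<sigma>\<close> and \<open>n\<close> into the sequence \<open>f 0, ..., f (n - 1)\<close>.  Together with
  length and projection this presents \<open>\<sigma>\<^sup>*\<close> as pairs of a function and a length; empty sequence,
  concatenation and so on are definable from it.
  \<open>Xi k \<tau>\<close> are the names available for the functionals whose standardness is an axiom.
\<close>

datatype const =
    Zero
  | Succ
  | Rec
  | KC ty ty
  | SC ty ty ty
  | Len ty
  | Idx ty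
  | Tab ty
  | Xi nat ty

primrec cty :: "const \<Rightarrow> ty" where
  "cty Zero = Ty0"
| "cty Succ = Ty1"
| "cty Rec = (Ty0 \<rightarrow> Ty0 \<rightarrow> (Ty0 \<rightarrow> Ty0 \<rightarrow> Ty0) \<rightarrow> Ty0)"
| "cty (KC \<rho> \<tau>) = (\<rho> \<rightarrow> \<tau> \<rightarrow> \<rho>)"
| "cty (SC \<sigma> \<rho> \<tau>) = ((\<sigma> \<rightarrow> \<rho> \<rightarrow> \<tau>) \<rightarrow> (\<sigma> \<rightarrow> \<rho>) \<rightarrow> \<sigma> \<rightarrow> \<tau>)"
| "cty (Len \<sigma>) = (Seq \<sigma> \<rightarrow> Ty0)"
| "cty (Idx \<sigma>) = (Seq \<sigma> \<rightarrow> Ty0 \<rightarrow> \<sigma>)"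
| "cty (Tab \<sigma>) = ((Ty0 \<rightarrow> \<sigma>) \<rightarrow> Ty0 \<rightarrow> Seq \<sigma>)"
| "cty (Xi k \<tau>) = \<tau>"

text \<open>Locally nameless syntax: free variables are named and carry their type, bound variables are
  de Bruijn indices.  The only primitive equality is that of type 0.\<close>

datatype tm = Var var | Bound nat | Const const | App tm tm (infixl \<open>\<cdot>\<close> 200)

datatype fm =
    Eq tm tm (infix \<open>\<approx>\<close> 90)
  | St ty tm
  | Bot
  | Imp fm fm (infixr \<open>\<^bold>\<longrightarrow>\<close> 60)
  | All ty fm

abbreviation Neg :: "fm \<Rightarrow> fm" (\<open>\<^bold>\<not> _\<close> [80] 80) where "\<^bold>\<not> A \<equiv> A \<^bold>\<longrightarrow> Bot"
abbreviation Conj :: "fm \<Rightarrow> fm \<Rightarrow> fm" (infixr \<open>\<^bold>\<and>\<close> 70) where "A \<^bold>\<and> B \<equiv> \<^bold>\<not> (A \<^bold>\<longrightarrow> \<^bold>\<not> B)"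
abbreviation Iff :: "fm \<Rightarrow> fm \<Rightarrow> fm" (infix \<open>\<^bold>\<longleftrightarrow>\<close> 55) where
  "A \<^bold>\<longleftrightarrow> B \<equiv> (A \<^bold>\<longrightarrow> B) \<^bold>\<and> (B \<^bold>\<longrightarrow> A)"
abbreviation Ex :: "ty \<Rightarrow> fm \<Rightarrow> fm" where "Ex \<sigma> A \<equiv> \<^bold>\<not> (All \<sigma> (\<^bold>\<not> A))"

primrec fv_tm :: "tm \<Rightarrow> var set" where
  "fv_tm (Var v) = {v}"
| "fv_tm (Bound i) = {}"
| "fv_tm (Const c) = {}"
| "fv_tm (s \<cdot> t) = fv_tm s \<union> fv_tm t"

primrec fv :: "fm \<Rightarrow> var set" where
  "fv (s \<approx> t) = fv_tm s \<union> fv_tm t"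
| "fv (St \<sigma> t) = fv_tm t"
| "fv Bot = {}"
| "fv (A \<^bold>\<longrightarrow> B) = fv A \<union> fv B"
| "fv (All \<sigma> A) = fv A"

primrec close_tm :: "nat \<Rightarrow> var \<Rightarrow> tm \<Rightarrow> tm" where
  "close_tm k v (Var w) = (if w = v then Bound k else Var w)"
| "close_tm k v (Bound i) = Bound i"
| "close_tm k v (Const c) = Const c"
| "close_tm k v (s \<cdot> t) = close_tm k v s \<cdot> close_tm k v t"

primrec close :: "nat \<Rightarrow> var \<Rightarrow> fm \<Rightarrow> fm" where
  "close k v (s \<approx> t) = (close_tm k v s \<approx> close_tm k v t)"
| "close k v (St \<sigma> t) = St \<sigma> (close_tm k v t)"
| "close k v Bot = Bot"
| "close k v (A \<^bold>\<longrightarrow> B) = (close k v A \<^bold>\<longrightarrow> close k v B)"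
| "close k v (All \<sigma> A) = All \<sigma> (close (Suc k) v A)"

text \<open>Only terms without dangling indices are ever instantiated, so no lifting is needed below
  quantifiers.\<close>

primrec inst_tm :: "nat \<Rightarrow> tm \<Rightarrow> tm \<Rightarrow> tm" where
  "inst_tm k u (Var w) = Var w"
| "inst_tm k u (Bound i) = (if i = k then u else Bound i)"
| "inst_tm k u (Const c) = Const c"
| "inst_tm k u (s \<cdot> t) = inst_tm k u s \<cdot> inst_tm k u t"

primrec inst :: "nat \<Rightarrow> tm \<Rightarrow> fm \<Rightarrow> fm" where
  "inst k u (s \<approx> t) = (inst_tm k u s \<approx> inst_tm k u t)"
| "inst k u (St \<sigma> t) = St \<sigma> (inst_tm k u t)"
| "inst k u Bot = Bot"
| "inst k u (A \<^bold>\<longrightarrow> B) = (inst k u A \<^bold>\<longrightarrow> inst k u B)"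
| "inst k u (All \<sigma> A) = All \<sigma> (inst (Suc k) u A)"

definition subst :: "var \<Rightarrow> tm \<Rightarrow> fm \<Rightarrow> fm" where
  "subst v t A = inst 0 t (close 0 v A)"

primrec lift :: "tm \<Rightarrow> tm" where
  "lift (Var w) = Var w"
| "lift (Bound i) = Bound (Suc i)"
| "lift (Const c) = Const c"
| "lift (s \<cdot> t) = lift s \<cdot> lift t"

definition all :: "var \<Rightarrow> fm \<Rightarrow> fm" where "all v A = All (snd v) (close 0 v A)"
definition ex :: "var \<Rightarrow> fm \<Rightarrow> fm" where "ex v A = \<^bold>\<not> (all v (\<^bold>\<not> A))"
definition all_st :: "var \<Rightarrow> fm \<Rightarrow> fm" where "all_st v A = all v (St (snd v) (Var v) \<^bold>\<longrightarrow> A)"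
definition ex_st :: "var \<Rightarrow> fm \<Rightarrow> fm" where "ex_st v A = ex v (St (snd v) (Var v) \<^bold>\<and> A)"

fun type_of :: "ty list \<Rightarrow> tm \<Rightarrow> ty option" where
  "type_of \<Gamma> (Var v) = Some (snd v)"
| "type_of \<Gamma> (Bound i) = (if i < length \<Gamma> then Some (\<Gamma> ! i) else None)"
| "type_of \<Gamma> (Const c) = Some (cty c)"
| "type_of \<Gamma> (s \<cdot> t) =
    (case type_of \<Gamma> s of Some (\<sigma> \<rightarrow> \<tau>) \<Rightarrow> if type_of \<Gamma> t = Some \<sigma> then Some \<tau> else None | _ \<Rightarrow> None)"

primrec wf_fm :: "ty list \<Rightarrow> fm \<Rightarrow> bool" where
  "wf_fm \<Gamma> (s \<approx> t) \<longleftrightarrow> type_of \<Gamma> s = Some Ty0 \<and> type_of \<Gamma> t = Some Ty0"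
| "wf_fm \<Gamma> (St \<sigma> t) \<longleftrightarrow> type_of \<Gamma> t = Some \<sigma>"
| "wf_fm \<Gamma> Bot \<longleftrightarrow> True"
| "wf_fm \<Gamma> (A \<^bold>\<longrightarrow> B) \<longleftrightarrow> wf_fm \<Gamma> A \<and> wf_fm \<Gamma> B"
| "wf_fm \<Gamma> (All \<sigma> A) \<longleftrightarrow> wf_fm (\<sigma> # \<Gamma>) A"

primrec xis_tm :: "tm \<Rightarrow> (nat \<times> ty) set" where
  "xis_tm (Var w) = {}"
| "xis_tm (Bound i) = {}"
| "xis_tm (Const c) = (case c of Xi k \<tau> \<Rightarrow> {(k, \<tau>)} | _ \<Rightarrow> {})"
| "xis_tm (s \<cdot> t) = xis_tm s \<union> xis_tm t"

primrec xis :: "fm \<Rightarrow> (nat \<times> ty) set" where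
  "xis (s \<approx> t) = xis_tm s \<union> xis_tm t"
| "xis (St \<sigma> t) = xis_tm t"
| "xis Bot = {}"
| "xis (A \<^bold>\<longrightarrow> B) = xis A \<union> xis B"
| "xis (All \<sigma> A) = xis A"

text \<open>\<open>L\<close> is the set of those \<open>Xi k \<tau>\<close> that belong to the language under consideration.\<close>

definition is_tm :: "(nat \<times> ty) set \<Rightarrow> tm \<Rightarrow> ty \<Rightarrow> bool" where
  "is_tm L t \<sigma> \<longleftrightarrow> type_of [] t = Some \<sigma> \<and> xis_tm t \<subseteq> L"

definition is_fm :: "(nat \<times> ty) set \<Rightarrow> fm \<Rightarrow> bool" where
  "is_fm L A \<longleftrightarrow> wf_fm [] A \<and> xis A \<subseteq> L"

primrec internal :: "fm \<Rightarrow> bool" where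
  "internal (s \<approx> t) \<longleftrightarrow> True"
| "internal (St \<sigma> t) \<longleftrightarrow> False"
| "internal Bot \<longleftrightarrow> True"
| "internal (A \<^bold>\<longrightarrow> B) \<longleftrightarrow> internal A \<and> internal B"
| "internal (All \<sigma> A) \<longleftrightarrow> internal A"

primrec qfree :: "fm \<Rightarrow> bool" where
  "qfree (s \<approx> t) \<longleftrightarrow> True"
| "qfree (St \<sigma> t) \<longleftrightarrow> False"
| "qfree Bot \<longleftrightarrow> True"
| "qfree (A \<^bold>\<longrightarrow> B) \<longleftrightarrow> qfree A \<and> qfree B"
| "qfree (All \<sigma> A) \<longleftrightarrow> False"

text \<open>Relativisation to \<open>st\<close>.  Bounded number quantifiers are not primitive and are relativised as
  well; for standard bounds this makes no difference, as numbers below standard ones are standard.\<close>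

primrec rel :: "fm \<Rightarrow> fm" where
  "rel (s \<approx> t) = (s \<approx> t)"
| "rel (St \<sigma> t) = St \<sigma> t"
| "rel Bot = Bot"
| "rel (A \<^bold>\<longrightarrow> B) = (rel A \<^bold>\<longrightarrow> rel B)"
| "rel (All \<sigma> A) = All \<sigma> (St \<sigma> (Bound 0) \<^bold>\<longrightarrow> rel A)"


section \<open>Provability: classical natural deduction\<close>

text \<open>Axioms may contain free variables; as the eigenvariable condition of \<open>allI\<close> only concerns the
  hypotheses, they act as their universal closures.\<close>

inductive derives :: "(nat \<times> ty) set \<Rightarrow> fm set \<Rightarrow> fm list \<Rightarrow> fm \<Rightarrow> bool"
  for L :: "(nat \<times> ty) set" and T :: "fm set" where
  ax: "A \<in> T \<Longrightarrow> is_fm L A \<Longrightarrow> derives L T \<Gamma> A"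
| hyp: "A \<in> set \<Gamma> \<Longrightarrow> is_fm L A \<Longrightarrow> derives L T \<Gamma> A"
| impI: "derives L T (A # \<Gamma>) B \<Longrightarrow> is_fm L A \<Longrightarrow> derives L T \<Gamma> (A \<^bold>\<longrightarrow> B)"
| impE: "derives L T \<Gamma> (A \<^bold>\<longrightarrow> B) \<Longrightarrow> derives L T \<Gamma> A \<Longrightarrow> derives L T \<Gamma> B"
| classical: "derives L T ((\<^bold>\<not> A) # \<Gamma>) Bot \<Longrightarrow> is_fm L A \<Longrightarrow> derives L T \<Gamma> A"
| allI: "derives L T \<Gamma> (inst 0 (Var (n, \<sigma>)) A) \<Longrightarrow> (n, \<sigma>) \<notin> fv A \<union> (\<Union>B\<in>set \<Gamma>. fv B) \<Longrightarrow>
    derives L T \<Gamma> (All \<sigma> A)"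
| allE: "derives L T \<Gamma> (All \<sigma> A) \<Longrightarrow> is_tm L t \<sigma> \<Longrightarrow> derives L T \<Gamma> (inst 0 t A)"

definition provable :: "(nat \<times> ty) set \<Rightarrow> fm set \<Rightarrow> fm \<Rightarrow> bool" where
  "provable L T A \<longleftrightarrow> derives L T [] A"


section \<open>Abstraction and primitive recursive functions as closed terms\<close>

text \<open>Bracket abstraction, meant for well-typed terms without de Bruijn indices.\<close>

primrec lam :: "var \<Rightarrow> tm \<Rightarrow> tm" where
  "lam v (Var w) =
    (if w = v then Const (SC (snd v) (snd v \<rightarrow> snd v) (snd v)) \<cdot> Const (KC (snd v) (snd v \<rightarrow> snd v))
        \<cdot> Const (KC (snd v) (snd v))
     else Const (KC (snd w) (snd v)) \<cdot> Var w)"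
| "lam v (Bound i) = Bound i"
| "lam v (Const c) = Const (KC (cty c) (snd v)) \<cdot> Const c"
| "lam v (s \<cdot> t) =
    (if v \<notin> fv_tm (s \<cdot> t) then Const (KC (the (type_of [] (s \<cdot> t))) (snd v)) \<cdot> (s \<cdot> t)
     else Const (SC (snd v) (the (type_of [] t)) (the (type_of [] (s \<cdot> t)))) \<cdot> lam v s \<cdot> lam v t)"

abbreviation zero :: tm where "zero \<equiv> Const Zero"
abbreviation suc :: "tm \<Rightarrow> tm" where "suc t \<equiv> Const Succ \<cdot> t"
abbreviation "one \<equiv> suc zero"

text \<open>The names in the following definitions are local to each closed term.\<close>

abbreviation xv :: var where "xv \<equiv> (0, Ty0)"
abbreviation yv :: var where "yv \<equiv> (1, Ty0)"
abbreviation uv :: var where "uv \<equiv> (2, Ty0)"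
abbreviation vv :: var where "vv \<equiv> (3, Ty0)"
abbreviation gv :: var where "gv \<equiv> (0, Ty1)"

text \<open>\<open>rec t a b\<close> is the \<open>t\<close>-th iterate of \<open>u \<mapsto> b\<close>, starting from \<open>a\<close>, where \<open>b\<close> may depend on the
  previous value \<open>u\<close> and on the stage \<open>v\<close>.\<close>

definition rec :: "tm \<Rightarrow> tm \<Rightarrow> tm \<Rightarrow> tm" where
  "rec t a b = Const Rec \<cdot> t \<cdot> a \<cdot> lam uv (lam vv b)"

definition pred_c :: tm where "pred_c = lam xv (rec (Var xv) zero (Var vv))"
definition monus_c :: tm where
  "monus_c = lam xv (lam yv (rec (Var yv) (Var xv) (pred_c \<cdot> Var uv)))"
definition plus_c :: tm where
  "plus_c = lam xv (lam yv (rec (Var yv) (Var xv) (suc (Var uv))))"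
definition sg_c :: tm where "sg_c = lam xv (rec (Var xv) zero one)"
text \<open>\<open>cond_c z x y\<close> is \<open>x\<close> if \<open>z = 0\<close> and \<open>y\<close> otherwise.\<close>
definition cond_c :: tm where
  "cond_c = lam (4, Ty0) (lam xv (lam yv (rec (Var (4, Ty0)) (Var xv) (Var yv))))"

text \<open>Cantor pairing \<open>pair x y = tri (x + y) + y\<close> with \<open>tri x = 1 + ... + x\<close>; \<open>root z\<close> is the greatest
  \<open>w\<close> with \<open>tri w \<le> z\<close>.\<close>

definition tri_c :: tm where "tri_c = lam xv (rec (Var xv) zero (plus_c \<cdot> Var uv \<cdot> suc (Var vv)))"
definition pair_c :: tm where
  "pair_c = lam xv (lam yv (plus_c \<cdot> (tri_c \<cdot> (plus_c \<cdot> Var xv \<cdot> Var yv)) \<cdot> Var yv))"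
definition root_c :: tm where
  "root_c = lam xv (rec (Var xv) zero
     (cond_c \<cdot> (monus_c \<cdot> (tri_c \<cdot> suc (Var uv)) \<cdot> suc (Var vv)) \<cdot> suc (Var uv) \<cdot> Var uv))"
definition psnd_c :: tm where
  "psnd_c = lam xv (monus_c \<cdot> Var xv \<cdot> (tri_c \<cdot> (root_c \<cdot> Var xv)))"
definition pfst_c :: tm where
  "pfst_c = lam xv (monus_c \<cdot> (root_c \<cdot> Var xv) \<cdot> (psnd_c \<cdot> Var xv))"

text \<open>Number codes of finite sequences of numbers: the empty sequence is 0, and \<open>s\<close> extended by the
  last element \<open>a\<close> is \<open>pair s a + 1\<close>; every number codes exactly one sequence.  \<open>drop_c s k\<close> removes
  the last \<open>k\<close> elements of \<open>s\<close>, \<open>init_c s x\<close> keeps the first \<open>x\<close>, and \<open>bar_c g x\<close> codes the initial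
  segment of length \<open>x\<close> of the function \<open>g\<close>.\<close>

definition bar_c :: tm where
  "bar_c = lam gv (lam xv (rec (Var xv) zero (suc (pair_c \<cdot> Var uv \<cdot> (Var gv \<cdot> Var vv)))))"
definition drop_c :: tm where
  "drop_c = lam xv (lam yv (rec (Var yv) (Var xv) (pfst_c \<cdot> (pred_c \<cdot> Var uv))))"
definition lh_c :: tm where
  "lh_c = lam xv (rec (Var xv) zero (plus_c \<cdot> Var uv \<cdot> (sg_c \<cdot> (drop_c \<cdot> Var xv \<cdot> Var vv))))"
definition nth_c :: tm where
  "nth_c = lam xv (lam yv
     (psnd_c \<cdot> (pred_c \<cdot> (drop_c \<cdot> Var xv \<cdot> (monus_c \<cdot> (lh_c \<cdot> Var xv) \<cdot> suc (Var yv))))))"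
definition init_c :: tm where
  "init_c = lam xv (lam yv (drop_c \<cdot> Var xv \<cdot> (monus_c \<cdot> (lh_c \<cdot> Var xv) \<cdot> Var yv)))"


section \<open>Order, equality in all types, membership\<close>

definition le :: "tm \<Rightarrow> tm \<Rightarrow> fm" where "le s t = (monus_c \<cdot> s \<cdot> t \<approx> zero)"
definition less :: "tm \<Rightarrow> tm \<Rightarrow> fm" where "less s t = le (suc s) t"

primrec eq :: "ty \<Rightarrow> tm \<Rightarrow> tm \<Rightarrow> fm" where
  "eq Ty0 s t = (s \<approx> t)"
| "eq (\<sigma> \<rightarrow> \<tau>) s t = All \<sigma> (eq \<tau> (lift s \<cdot> Bound 0) (lift t \<cdot> Bound 0))"
| "eq (Seq \<sigma>) s t = (Const (Len \<sigma>) \<cdot> s \<approx> Const (Len \<sigma>) \<cdot> t) \<^bold>\<and>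
    All Ty0 (less (Bound 0) (Const (Len \<sigma>) \<cdot> lift s) \<^bold>\<longrightarrow>
      eq \<sigma> (Const (Idx \<sigma>) \<cdot> lift s \<cdot> Bound 0) (Const (Idx \<sigma>) \<cdot> lift t \<cdot> Bound 0))"

definition mem :: "ty \<Rightarrow> tm \<Rightarrow> tm \<Rightarrow> fm" where
  "mem \<sigma> z s = Ex Ty0 (less (Bound 0) (Const (Len \<sigma>) \<cdot> lift s) \<^bold>\<and>
    eq \<sigma> (lift z) (Const (Idx \<sigma>) \<cdot> lift s \<cdot> Bound 0))"

text \<open>Pointwise order of (codes of) finite sequences of the same length.\<close>

definition seq_le :: "tm \<Rightarrow> tm \<Rightarrow> fm" where
  "seq_le s t = (lh_c \<cdot> s \<approx> lh_c \<cdot> t) \<^bold>\<and>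
    All Ty0 (less (Bound 0) (lh_c \<cdot> lift t) \<^bold>\<longrightarrow>
      le (nth_c \<cdot> lift s \<cdot> Bound 0) (nth_c \<cdot> lift t \<cdot> Bound 0))"


section \<open>The base theories\<close>

inductive_set RCA0_omega :: "(nat \<times> ty) set \<Rightarrow> fm set" for L :: "(nat \<times> ty) set" where
  eq_refl: "(Var xv \<approx> Var xv) \<in> RCA0_omega L"
| eq_sym: "(Var xv \<approx> Var yv \<^bold>\<longrightarrow> Var yv \<approx> Var xv) \<in> RCA0_omega L"
| eq_trans: "(Var xv \<approx> Var yv \<^bold>\<longrightarrow> Var yv \<approx> Var uv \<^bold>\<longrightarrow> Var xv \<approx> Var uv) \<in> RCA0_omega L"
| extensionality:
    "(eq \<rho> (Var (0, \<rho>)) (Var (1, \<rho>)) \<^bold>\<longrightarrow>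
      eq \<tau> (Var (2, \<rho> \<rightarrow> \<tau>) \<cdot> Var (0, \<rho>)) (Var (2, \<rho> \<rightarrow> \<tau>) \<cdot> Var (1, \<rho>))) \<in> RCA0_omega L"
| suc_nonzero: "\<^bold>\<not> (suc (Var xv) \<approx> zero) \<in> RCA0_omega L"
| suc_inject: "(suc (Var xv) \<approx> suc (Var yv) \<^bold>\<longrightarrow> Var xv \<approx> Var yv) \<in> RCA0_omega L"
| K: "eq \<rho> (Const (KC \<rho> \<tau>) \<cdot> Var (0, \<rho>) \<cdot> Var (1, \<tau>)) (Var (0, \<rho>)) \<in> RCA0_omega L"
| S: "eq \<tau> (Const (SC \<sigma> \<rho> \<tau>) \<cdot> Var (0, \<sigma> \<rightarrow> \<rho> \<rightarrow> \<tau>) \<cdot> Var (1, \<sigma> \<rightarrow> \<rho>) \<cdot> Var (2, \<sigma>))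
      (Var (0, \<sigma> \<rightarrow> \<rho> \<rightarrow> \<tau>) \<cdot> Var (2, \<sigma>) \<cdot> (Var (1, \<sigma> \<rightarrow> \<rho>) \<cdot> Var (2, \<sigma>))) \<in> RCA0_omega L"
| rec_zero:
    "(Const Rec \<cdot> zero \<cdot> Var yv \<cdot> Var (0, Ty0 \<rightarrow> Ty0 \<rightarrow> Ty0) \<approx> Var yv) \<in> RCA0_omega L"
| rec_suc:
    "(Const Rec \<cdot> suc (Var xv) \<cdot> Var yv \<cdot> Var (0, Ty0 \<rightarrow> Ty0 \<rightarrow> Ty0) \<approx>
      Var (0, Ty0 \<rightarrow> Ty0 \<rightarrow> Ty0) \<cdot> (Const Rec \<cdot> Var xv \<cdot> Var yv \<cdot> Var (0, Ty0 \<rightarrow> Ty0 \<rightarrow> Ty0)) \<cdot> Var xv)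
      \<in> RCA0_omega L"
| len_tab:
    "(Const (Len \<sigma>) \<cdot> (Const (Tab \<sigma>) \<cdot> Var (0, Ty0 \<rightarrow> \<sigma>) \<cdot> Var xv) \<approx> Var xv) \<in> RCA0_omega L"
| idx_tab:
    "(less (Var yv) (Var xv) \<^bold>\<longrightarrow>
      eq \<sigma> (Const (Idx \<sigma>) \<cdot> (Const (Tab \<sigma>) \<cdot> Var (0, Ty0 \<rightarrow> \<sigma>) \<cdot> Var xv) \<cdot> Var yv)
        (Var (0, Ty0 \<rightarrow> \<sigma>) \<cdot> Var yv)) \<in> RCA0_omega L"
| QF_induction:
    "qfree A \<Longrightarrow> is_fm L A \<Longrightarrow> x = (n, Ty0) \<Longrightarrow>
      (subst x zero A \<^bold>\<longrightarrow> all x (A \<^bold>\<longrightarrow> subst x (suc (Var x)) A) \<^bold>\<longrightarrow> all x A) \<in> RCA0_omega L"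
| QF_AC:
    "qfree A \<Longrightarrow> is_fm L A \<Longrightarrow> x = (n, Ty1) \<Longrightarrow> y = (m, Ty0) \<Longrightarrow> F = (k, Ty2) \<Longrightarrow> F \<notin> fv A \<Longrightarrow>
      (all x (ex y A) \<^bold>\<longrightarrow> ex F (all x (subst y (Var F \<cdot> Var x) A))) \<in> RCA0_omega L"

text \<open>A choice of functionals with names: \<open>spec k = Some (\<tau>, D)\<close> means that \<open>Xi k \<tau>\<close> names the
  functional of type \<open>\<tau>\<close> specified by \<open>D\<close>, a formula in the variable \<open>(0, \<tau>)\<close>.\<close>

type_synonym spec = "nat \<Rightarrow> (ty \<times> fm) option"

definition lang :: "spec \<Rightarrow> (nat \<times> ty) set" where
  "lang spec = {(k, \<tau>). \<exists>D. spec k = Some (\<tau>, D)}"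

definition admissible :: "spec \<Rightarrow> bool" where
  "admissible spec \<longleftrightarrow> (\<forall>k \<tau> D. spec k = Some (\<tau>, D) \<longrightarrow>
     is_fm {} D \<and> internal D \<and> fv D \<subseteq> {(0, \<tau>)} \<and>
     provable {} (RCA0_omega {})
       (D \<^bold>\<longrightarrow> subst (0, \<tau>) (Var (1, \<tau>)) D \<^bold>\<longrightarrow> eq \<tau> (Var (0, \<tau>)) (Var (1, \<tau>))))"

text \<open>In \<open>standard_Xi\<close>, relativising the equation says that the functionals agree on all standard
  inputs.\<close>

inductive_set RCA0_Omega :: "spec \<Rightarrow> fm set" for spec :: spec where
  RCA0_omega: "A \<in> RCA0_omega (lang spec) \<Longrightarrow> A \<in> RCA0_Omega spec"
| st_eq:
    "(eq \<sigma> (Var (0, \<sigma>)) (Var (1, \<sigma>)) \<^bold>\<longrightarrow> St \<sigma> (Var (0, \<sigma>)) \<^bold>\<longrightarrow> St \<sigma> (Var (1, \<sigma>))) \<in> RCA0_Omega spec"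
| st_closed: "is_tm (lang spec) t \<sigma> \<Longrightarrow> fv_tm t = {} \<Longrightarrow> St \<sigma> t \<in> RCA0_Omega spec"
| st_app:
    "(St (\<sigma> \<rightarrow> \<tau>) (Var (0, \<sigma> \<rightarrow> \<tau>)) \<^bold>\<longrightarrow> St \<sigma> (Var (1, \<sigma>)) \<^bold>\<longrightarrow>
      St \<tau> (Var (0, \<sigma> \<rightarrow> \<tau>) \<cdot> Var (1, \<sigma>))) \<in> RCA0_Omega spec"
| st_below:
    "(le (Var xv) (Var yv) \<^bold>\<longrightarrow> St Ty0 (Var yv) \<^bold>\<longrightarrow> St Ty0 (Var xv)) \<in> RCA0_Omega spec"
| idealization:
    "internal A \<Longrightarrow> is_fm (lang spec) A \<Longrightarrow> z = (n, \<sigma>) \<Longrightarrow> y = (m, \<tau>) \<Longrightarrow> x = (k, Seq \<sigma>) \<Longrightarrow>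
      z \<noteq> y \<Longrightarrow> x \<noteq> y \<Longrightarrow> x \<notin> fv A \<Longrightarrow>
      (all_st x (ex y (all z (mem \<sigma> (Var z) (Var x) \<^bold>\<longrightarrow> A))) \<^bold>\<longrightarrow> ex y (all_st z A))
        \<in> RCA0_Omega spec"
| HAC_int:
    "internal A \<Longrightarrow> is_fm (lang spec) A \<Longrightarrow> x = (n, \<rho>) \<Longrightarrow> y = (m, \<tau>) \<Longrightarrow> F = (k, \<rho> \<rightarrow> Seq \<tau>) \<Longrightarrow>
      x \<noteq> y \<Longrightarrow> F \<noteq> y \<Longrightarrow> F \<notin> fv A \<Longrightarrow>
      (all_st x (ex_st y A) \<^bold>\<longrightarrow>
        ex_st F (all_st x (ex y (mem \<tau> (Var y) (Var F \<cdot> Var x) \<^bold>\<and> A)))) \<in> RCA0_Omega spec"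
| PF_TP:
    "internal A \<Longrightarrow> is_fm (lang spec) A \<Longrightarrow> fv A \<subseteq> {x} \<Longrightarrow>
      (all_st x A \<^bold>\<longrightarrow> all x A) \<in> RCA0_Omega spec"
| standard_Xi:
    "spec k = Some (\<tau>, D) \<Longrightarrow>
      (St \<tau> (Const (Xi k \<tau>)) \<^bold>\<and>
        all_st (0, \<tau>) (rel D \<^bold>\<longrightarrow> rel (eq \<tau> (Const (Xi k \<tau>)) (Var (0, \<tau>))))) \<in> RCA0_Omega spec"


section \<open>The principles\<close>

text \<open>Sets are given by binary characteristic functions, with value 1 on members.\<close>

definition is_set :: "tm \<Rightarrow> fm" where
  "is_set X = all xv (le (X \<cdot> Var xv) one)"

definition STP :: fm where
  "STP = (let X = (0, Ty1); Y = (1, Ty1) in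
     all X (is_set (Var X) \<^bold>\<longrightarrow> ex_st Y (is_set (Var Y) \<^bold>\<and>
       all_st xv ((Var X \<cdot> Var xv \<approx> one) \<^bold>\<longleftrightarrow> (Var Y \<cdot> Var xv \<approx> one)))))"

abbreviation Sv :: var where "Sv \<equiv> (0, Ty2)"

text \<open>A formula in the free variable \<open>Sv\<close>.\<close>

definition suslin :: fm where
  "suslin = (let f = (1, Ty1); g = (2, Ty1) in
     all f ((Var Sv \<cdot> Var f \<approx> zero) \<^bold>\<longleftrightarrow>
       ex g (all xv (\<^bold>\<not> (Var f \<cdot> (bar_c \<cdot> Var g \<cdot> Var xv) \<approx> zero)))))"

definition S2 :: fm where "S2 = ex Sv suslin"

text \<open>\<open>suslin\<close> determines a functional only up to its nonzero values; it becomes unique once these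
  are required to be 1.\<close>

definition suslin_spec :: fm where
  "suslin_spec = suslin \<^bold>\<and> (let f = (1, Ty1) in all f (le (Var Sv \<cdot> Var f) one))"

definition RB :: fm where
  "RB = (let \<Phi> = (0, Ty1 \<rightarrow> Ty1); f = (1, Ty1); M = (4, Ty0); s = (5, Ty0); g = (2, Ty1) in
     ex_st \<Phi> (all_st f (all M (\<^bold>\<not> (St Ty0 (Var M)) \<^bold>\<longrightarrow>
       (all s (seq_le (Var s) (bar_c \<cdot> (Var \<Phi> \<cdot> Var f) \<cdot> Var M) \<^bold>\<longrightarrow>
          ex xv (le (Var xv) (Var M) \<^bold>\<and> (Var f \<cdot> (init_c \<cdot> Var s \<cdot> Var xv) \<approx> zero)))
        \<^bold>\<longleftrightarrow>
        all g (ex xv (Var f \<cdot> (bar_c \<cdot> Var g \<cdot> Var xv) \<approx> zero)))))))"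

end

theory Submission
  imports Defs "HOL-Library.Countable"
begin

text \<open>
  By Henkin's method, with the quotient of the term model by extensional equality, derivability reduces
  to truth in extensional models, whose numbers satisfy only quantifier-free induction.  Inside such a
  model the argument runs as follows.

  Given the Suslin functional, its name \<open>\<Xi>\<close> is standard, and parameter-free transfer applied to formulas
  in \<open>\<Xi>\<close> yields \<open>\<Pi>\<^sup>0\<^sub>1\<close>-transfer for standard functions and a standard path for every standard \<open>f\<close>
  whose tree has a path at all.  \<open>HAC_int\<close> collects such paths into finitely many candidates, and the
  pointwise sum of the candidates is the bound \<open>\<Phi>(f)\<close>.  If the bounded search up to \<open>M\<close> fails, the
  offending sequence is bounded by a standard function, so \<open>STP\<close> turns it into a standard path.

  Conversely, applying the bound to \<open>s \<mapsto> h(|s|)\<close> shows that a zero of a standard \<open>h\<close> lies below every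
  infinite number, hence the least one is standard: \<open>\<Pi>\<^sup>0\<^sub>1\<close>-transfer again.  With \<open>STP\<close> every standard tree
  that has a path has a standard one.  \<open>HAC_int\<close> provides bounds on zeros, hence a standard functional
  deciding \<open>\<Pi>\<^sup>0\<^sub>1\<close> formulas, and finitely many candidate paths; testing these decides whether there is a path.
\<close>

section \<open>Typing, instantiation and closing\<close>

text \<open>Two scarcities shape the argument. Induction is available for quantifier-free predicates
  only, so arithmetic and sequence coding have to be rebuilt with explicit witnesses and cut-off
  differences where one would use existential quantifiers. And \<open>PF_TP\<close> tolerates no
  parameters: what makes it strong enough is that a constant such as \<open>\<Xi>\<close> may occur
  in the transferred formula without counting as one, provided that it is known to be standard and
  correct on standard arguments.

  \<open>HAC_int\<close> does not tell which candidate is the right one. For a bound this is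
  harmless, since being a bound is preserved upwards; a functional with values 0 and 1 has no such
  slack, which is why the converse direction first needs a way to test candidates.
  \<open>STP\<close> speaks of binary sets, so a nonstandard sequence can enter only through its
  graph, and its values at standard places must be standard for the graph to determine them: this is
  the role of the standard bound. Idealization contributes a single infinite number, without which
  \<open>RB\<close> would be vacuous.\<close>

lemma type_of_App [simp]:
  "type_of \<Gamma> (s \<cdot> t) = Some \<tau> \<longleftrightarrow> (\<exists>\<sigma>. type_of \<Gamma> s = Some (\<sigma> \<rightarrow> \<tau>) \<and> type_of \<Gamma> t = Some \<sigma>)"
  by (auto split: option.splits ty.splits)

declare type_of.simps(4) [simp del]

lemma type_of_weaken: "type_of \<Gamma> t = Some \<sigma> \<Longrightarrow> type_of (\<Gamma> @ \<Gamma>') t = Some \<sigma>"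
  by (induction t arbitrary: \<sigma>) (auto split: if_splits simp: nth_append)

lemma type_of_Nil: "type_of [] t = Some \<sigma> \<Longrightarrow> type_of \<Gamma> t = Some \<sigma>"
  using type_of_weaken[of "[]" t \<sigma> \<Gamma>] by simp

lemma type_of_lift: "type_of (\<rho> # \<Gamma>) (lift t) = type_of \<Gamma> t"
  by (induction t) (auto simp: type_of.simps(4) split: option.splits ty.splits)

text \<open>The index being replaced is the outermost one. Passing a quantifier puts a type at the
  front of \<open>\<Gamma>\<close>, so the type \<open>\<rho>\<close> of the replaced index stays at
  the end and its index is always \<open>length \<Gamma>\<close>.\<close>

lemma type_of_inst:
  "type_of (\<Gamma> @ [\<rho>]) t = Some \<sigma> \<Longrightarrow> type_of [] u = Some \<rho> \<Longrightarrow>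
    type_of \<Gamma> (inst_tm (length \<Gamma>) u t) = Some \<sigma>"
  by (induction t arbitrary: \<sigma>)
    (fastforce split: if_splits simp: nth_append intro: type_of_Nil)+

lemma wf_inst:
  "wf_fm (\<Gamma> @ [\<rho>]) A \<Longrightarrow> type_of [] u = Some \<rho> \<Longrightarrow> wf_fm \<Gamma> (inst (length \<Gamma>) u A)"
proof (induction A arbitrary: \<Gamma>)
  case (All \<sigma> A)
  from All.IH[of "\<sigma> # \<Gamma>"] All.prems show ?case by simp
qed (auto simp: type_of_inst)

lemma type_of_close:
  "type_of \<Gamma> t = Some \<sigma> \<Longrightarrow> type_of (\<Gamma> @ [snd v]) (close_tm (length \<Gamma>) v t) = Some \<sigma>"
  by (induction t arbitrary: \<sigma>) (fastforce split: if_splits simp: nth_append)+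

lemma wf_close:
  "wf_fm \<Gamma> A \<Longrightarrow> wf_fm (\<Gamma> @ [snd v]) (close (length \<Gamma>) v A)"
proof (induction A arbitrary: \<Gamma>)
  case (All \<sigma> A)
  from All.IH[of "\<sigma> # \<Gamma>"] All.prems show ?case by simp
qed (auto simp: type_of_close)

lemma wf_all [simp]: "wf_fm [] A \<Longrightarrow> wf_fm [] (all v A)"
  using wf_close[of "[]" A v] by (simp add: all_def)

lemma wf_ex [simp]: "wf_fm [] A \<Longrightarrow> wf_fm [] (ex v A)"
  by (simp add: ex_def)

lemma inst_tm_closed: "type_of \<Gamma> t = Some \<sigma> \<Longrightarrow> length \<Gamma> \<le> k \<Longrightarrow> inst_tm k u t = t"
  by (induction t arbitrary: \<sigma>) (auto split: if_splits)

lemma inst_closed: "wf_fm \<Gamma> A \<Longrightarrow> length \<Gamma> \<le> k \<Longrightarrow> inst k u A = A"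
  by (induction A arbitrary: \<Gamma> k) (auto simp: inst_tm_closed)

lemma inst_tm_close_tm: "type_of \<Gamma> t = Some \<sigma> \<Longrightarrow> length \<Gamma> \<le> k \<Longrightarrow> inst_tm k (Var v) (close_tm k v t) = t"
  by (induction t arbitrary: \<sigma>) (auto split: if_splits)

lemma inst_close: "wf_fm \<Gamma> A \<Longrightarrow> length \<Gamma> \<le> k \<Longrightarrow> inst k (Var v) (close k v A) = A"
  by (induction A arbitrary: \<Gamma> k) (auto simp: inst_tm_close_tm)

lemma close_tm_inst_tm: "v \<notin> fv_tm t \<Longrightarrow> close_tm k v (inst_tm k (Var v) t) = t"
  by (induction t) auto

lemma close_inst: "v \<notin> fv A \<Longrightarrow> close k v (inst k (Var v) A) = A"
  by (induction A arbitrary: k) (auto simp: close_tm_inst_tm)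

lemma close_tm_fresh: "v \<notin> fv_tm t \<Longrightarrow> close_tm k v t = t"
  by (induction t) auto

lemma close_fresh: "v \<notin> fv A \<Longrightarrow> close k v A = A"
  by (induction A arbitrary: k) (auto simp: close_tm_fresh)

lemma fv_close_tm [simp]: "fv_tm (close_tm k v t) = fv_tm t - {v}"
  by (induction t) auto

lemma fv_close [simp]: "fv (close k v A) = fv A - {v}"
  by (induction A arbitrary: k) auto

lemma fv_all [simp]: "fv (all v A) = fv A - {v}"
  by (simp add: all_def)

lemma fv_ex [simp]: "fv (ex v A) = fv A - {v}"
  by (simp add: ex_def)

lemma xis_close_tm [simp]: "xis_tm (close_tm k v t) = xis_tm t"
  by (induction t) auto

lemma xis_close [simp]: "xis (close k v A) = xis A"
  by (induction A arbitrary: k) auto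

lemma xis_all [simp]: "xis (all v A) = xis A"
  by (simp add: all_def)

lemma xis_ex [simp]: "xis (ex v A) = xis A"
  by (simp add: ex_def)

lemma xis_inst_tm: "xis_tm (inst_tm k u t) \<subseteq> xis_tm t \<union> xis_tm u"
  by (induction t) auto

lemma xis_inst: "xis (inst k u A) \<subseteq> xis A \<union> xis_tm u"
proof (induction A arbitrary: k)
  case (Eq s t)
  show ?case using xis_inst_tm[of k u s] xis_inst_tm[of k u t] by auto
next
  case (St \<sigma> t)
  show ?case using xis_inst_tm[of k u t] by auto
next
  case (Imp A B)
  show ?case using Imp.IH[of k] by auto
qed auto

lemma finite_fv_tm [simp]: "finite (fv_tm t)"
  by (induction t) auto

lemma finite_fv [simp]: "finite (fv A)"
  by (induction A) auto

lemma ex_fresh: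
  assumes "finite (V :: var set)"
  shows "\<exists>n. (n, \<sigma>) \<notin> V"
proof -
  from assms obtain n where "n \<notin> fst ` V"
    by (meson ex_new_if_finite finite_imageI infinite_UNIV_nat)
  then show ?thesis by force
qed

lemma is_fm_simps [simp]:
  "is_fm L Bot" "is_fm L (A \<^bold>\<longrightarrow> B) \<longleftrightarrow> is_fm L A \<and> is_fm L B"
  by (auto simp: is_fm_def)

lemma is_fm_inst: "is_fm L (All \<sigma> A) \<Longrightarrow> is_tm L t \<sigma> \<Longrightarrow> is_fm L (inst 0 t A)"
  using wf_inst[of "[]" \<sigma> A t] xis_inst[of 0 t A] by (auto simp: is_fm_def is_tm_def)

lemma is_fm_All_close: "is_fm L A \<Longrightarrow> is_fm L (All (snd v) (close 0 v A))"
  using wf_close[of "[]" A v] by (simp add: is_fm_def)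

lemma is_fm_all [simp]: "is_fm L A \<Longrightarrow> is_fm L (all v A)"
  by (simp add: all_def is_fm_All_close)

lemma is_tm_Var [simp]: "is_tm L (Var v) \<sigma> \<longleftrightarrow> \<sigma> = snd v"
  by (auto simp: is_tm_def)

lemma is_tm_App [simp]:
  "is_tm L (s \<cdot> t) \<tau> \<longleftrightarrow> (\<exists>\<sigma>. is_tm L s (\<sigma> \<rightarrow> \<tau>) \<and> is_tm L t \<sigma>)"
  by (auto simp: is_tm_def)

lemma is_tm_Const [simp]: "is_tm L (Const c) \<sigma> \<longleftrightarrow> \<sigma> = cty c \<and> xis_tm (Const c) \<subseteq> L"
  by (auto simp: is_tm_def)

lemma is_tm_Bound [simp]: "\<not> is_tm L (Bound i) \<sigma>"
  by (auto simp: is_tm_def)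

lemma is_tm_unique: "is_tm L t \<sigma> \<Longrightarrow> is_tm L t \<tau> \<Longrightarrow> \<sigma> = \<tau>"
  by (auto simp: is_tm_def)


section \<open>Hilbert-style consequence\<close>

text \<open>Weakening is problematic for \<open>derives\<close>: if a hypothesis contains a variable that is free in an
  axiom, the axiom can no longer be generalised over it.  All derivations below are therefore moved
  to the empty context.\<close>

locale calculus =
  fixes L :: "(nat \<times> ty) set" and T :: "fm set"
begin

text \<open>With the schemes proved from here on, each in the empty context, modus ponens becomes
  the only rule that ever has to be applied to premises.\<close>

lemma derives_K: "is_fm L A \<Longrightarrow> is_fm L B \<Longrightarrow> derives L T [] (A \<^bold>\<longrightarrow> B \<^bold>\<longrightarrow> A)"
  by (rule impI, rule impI, rule hyp) auto

lemma derives_S: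
  assumes "is_fm L A" "is_fm L B" "is_fm L C"
  shows "derives L T [] ((A \<^bold>\<longrightarrow> B \<^bold>\<longrightarrow> C) \<^bold>\<longrightarrow> (A \<^bold>\<longrightarrow> B) \<^bold>\<longrightarrow> A \<^bold>\<longrightarrow> C)"
proof -
  let ?\<Gamma> = "[A, A \<^bold>\<longrightarrow> B, A \<^bold>\<longrightarrow> B \<^bold>\<longrightarrow> C]"
  have "derives L T ?\<Gamma> (A \<^bold>\<longrightarrow> B \<^bold>\<longrightarrow> C)" "derives L T ?\<Gamma> (A \<^bold>\<longrightarrow> B)" "derives L T ?\<Gamma> A"
    using assms by (auto intro: hyp)
  then have "derives L T ?\<Gamma> C" by (meson impE)
  then show ?thesis using assms by (auto intro!: impI)
qed

lemma derives_DN: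
  assumes "is_fm L A"
  shows "derives L T [] (\<^bold>\<not> \<^bold>\<not> A \<^bold>\<longrightarrow> A)"
proof -
  let ?\<Gamma> = "[\<^bold>\<not> A, \<^bold>\<not> \<^bold>\<not> A]"
  have "derives L T ?\<Gamma> (\<^bold>\<not> \<^bold>\<not> A)" "derives L T ?\<Gamma> (\<^bold>\<not> A)"
    using assms by (auto intro: hyp)
  then have "derives L T ?\<Gamma> Bot" by (meson impE)
  then have "derives L T [\<^bold>\<not> \<^bold>\<not> A] A" using assms by (rule classical)
  then show ?thesis using assms by (auto intro: impI)
qed

lemma derives_allE: "is_fm L (All \<sigma> A) \<Longrightarrow> is_tm L t \<sigma> \<Longrightarrow> derives L T [] (All \<sigma> A \<^bold>\<longrightarrow> inst 0 t A)"
  by (intro impI allE hyp) auto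

text \<open>A well-formed formula has no dangling index and may stand under a quantifier unchanged.
  This handles the premises when a derivation is generalised over a variable that they do not
  contain.\<close>

lemma derives_vacuous:
  assumes "is_fm L A"
  shows "derives L T [] (A \<^bold>\<longrightarrow> All \<sigma> A)"
proof -
  obtain n where n: "(n, \<sigma>) \<notin> fv A" using ex_fresh[OF finite_fv] by blast
  have "inst 0 (Var (n, \<sigma>)) A = A"
    using assms by (auto simp: is_fm_def intro: inst_closed)
  then have "derives L T [A] (All \<sigma> A)"
    using n assms by (intro allI[where n = n]) (auto intro: hyp)
  then show ?thesis using assms by (auto intro: impI)
qed

lemma derives_all_mp:
  assumes "is_fm L (All \<sigma> A)" "is_fm L (All \<sigma> B)"
  shows "derives L T [] (All \<sigma> (A \<^bold>\<longrightarrow> B) \<^bold>\<longrightarrow> All \<sigma> A \<^bold>\<longrightarrow> All \<sigma> B)"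
proof -
  obtain n where n: "(n, \<sigma>) \<notin> fv A \<union> fv B"
    using ex_fresh[of "fv A \<union> fv B"] by auto
  let ?\<Gamma> = "[All \<sigma> A, All \<sigma> (A \<^bold>\<longrightarrow> B)]"
  have fm: "is_fm L (All \<sigma> (A \<^bold>\<longrightarrow> B))" using assms by (auto simp: is_fm_def)
  have "derives L T ?\<Gamma> (inst 0 (Var (n, \<sigma>)) (A \<^bold>\<longrightarrow> B))"
    using assms fm by (intro allE[where \<sigma> = \<sigma>] hyp) auto
  moreover have "derives L T ?\<Gamma> (inst 0 (Var (n, \<sigma>)) A)"
    using assms by (intro allE[where \<sigma> = \<sigma>] hyp) auto
  ultimately have "derives L T ?\<Gamma> (inst 0 (Var (n, \<sigma>)) B)" by (auto intro: impE)
  then have "derives L T ?\<Gamma> (All \<sigma> B)" using n by (intro allI) auto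
  then show ?thesis using assms fm by (auto intro!: impI)
qed

lemma derives_gen:
  assumes "derives L T [] A" "is_fm L A"
  shows "derives L T [] (all v A)"
proof -
  have "inst 0 (Var v) (close 0 v A) = A"
    using assms(2) by (auto simp: is_fm_def intro: inst_close)
  then show ?thesis
    using assms(1) by (cases v) (auto simp: all_def intro!: allI)
qed

text \<open>Generalisation is confined to theorems, premises enter through modus ponens alone. Hence
  weakening and compactness are immediate, and the deduction theorem holds without a condition on
  free variables.\<close>

inductive cons :: "fm set \<Rightarrow> fm \<Rightarrow> bool" for S :: "fm set" where
  base: "derives L T [] A \<Longrightarrow> is_fm L A \<Longrightarrow> cons S A"
| prem: "A \<in> S \<Longrightarrow> is_fm L A \<Longrightarrow> cons S A"
| mp: "cons S (A \<^bold>\<longrightarrow> B) \<Longrightarrow> cons S A \<Longrightarrow> cons S B"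

lemma cons_is_fm: "cons S A \<Longrightarrow> is_fm L A"
  by (induction rule: cons.induct) auto

lemma cons_mono: "cons S A \<Longrightarrow> S \<subseteq> S' \<Longrightarrow> cons S' A"
  by (induction rule: cons.induct) (auto intro: cons.intros)

lemma cons_finite: "cons S A \<Longrightarrow> \<exists>S'. finite S' \<and> S' \<subseteq> S \<and> cons S' A"
proof (induction rule: cons.induct)
  case (prem A)
  then show ?case by (intro exI[of _ "{A}"]) (auto intro: cons.prem)
next
  case (mp A B)
  then obtain S1 S2 where "finite S1" "S1 \<subseteq> S" "cons S1 (A \<^bold>\<longrightarrow> B)" "finite S2" "S2 \<subseteq> S" "cons S2 A"
    by blast
  then show ?case
    by (intro exI[of _ "S1 \<union> S2"]) (auto intro: cons.mp cons_mono)
qed (auto intro: cons.base)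

lemma cons_empty: "cons {} A \<Longrightarrow> derives L T [] A"
  by (induction rule: cons.induct) (auto intro: impE)

lemma deduction: "cons (insert A S) B \<Longrightarrow> is_fm L A \<Longrightarrow> cons S (A \<^bold>\<longrightarrow> B)"
proof (induction rule: cons.induct)
  case (base B)
  then have "cons S (B \<^bold>\<longrightarrow> A \<^bold>\<longrightarrow> B)" by (intro cons.base derives_K) auto
  then show ?case using base by (auto intro: cons.mp cons.base)
next
  case (prem B)
  show ?case
  proof (cases "B = A")
    case True
    have "derives L T [] (A \<^bold>\<longrightarrow> A)" by (rule impI, rule hyp) (use prem in auto)
    then show ?thesis using True prem by (auto intro: cons.base)
  next
    case False
    from prem have "cons S (B \<^bold>\<longrightarrow> A \<^bold>\<longrightarrow> B)" by (intro cons.base derives_K) auto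
    then show ?thesis using prem False by (auto intro: cons.mp cons.prem)
  qed
next
  case (mp B C)
  then have "is_fm L B" "is_fm L C" using cons_is_fm by fastforce+
  then have "cons S ((A \<^bold>\<longrightarrow> B \<^bold>\<longrightarrow> C) \<^bold>\<longrightarrow> (A \<^bold>\<longrightarrow> B) \<^bold>\<longrightarrow> A \<^bold>\<longrightarrow> C)"
    using mp by (intro cons.base derives_S) auto
  then show ?case using mp by (meson cons.mp)
qed

lemma cons_classical: "cons (insert (\<^bold>\<not> A) S) Bot \<Longrightarrow> is_fm L A \<Longrightarrow> cons S A"
  using deduction[of "\<^bold>\<not> A" S Bot] cons.base[OF derives_DN[of A], of S]
  by (auto intro: cons.mp)

text \<open>Generalisation is admissible all the same: it is pushed through the derivation,
  distributing over modus ponens and ending in a vacuous quantifier at each premise.\<close>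

lemma cons_all:
  assumes "cons S A" "\<And>B. B \<in> S \<Longrightarrow> v \<notin> fv B"
  shows "cons S (all v A)"
  using assms
proof (induction rule: cons.induct)
  case (base A)
  then show ?case by (auto intro!: cons.base derives_gen)
next
  case (prem A)
  then have eq: "all v A = All (snd v) A" by (simp add: all_def close_fresh)
  then have "is_fm L (All (snd v) A)" using prem is_fm_all by metis
  then have "cons S (A \<^bold>\<longrightarrow> All (snd v) A)"
    using prem by (intro cons.base derives_vacuous) auto
  then show ?case using prem eq by (auto intro: cons.mp cons.prem)
next
  case (mp A B)
  then have fm: "is_fm L A" "is_fm L B" using cons_is_fm by fastforce+
  have "derives L T [] (all v (A \<^bold>\<longrightarrow> B) \<^bold>\<longrightarrow> all v A \<^bold>\<longrightarrow> all v B)"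
    using derives_all_mp[of "snd v" "close 0 v A" "close 0 v B"] is_fm_all[OF fm(1), of v] is_fm_all[OF fm(2), of v]
    by (simp add: all_def)
  moreover have "is_fm L (all v (A \<^bold>\<longrightarrow> B) \<^bold>\<longrightarrow> all v A \<^bold>\<longrightarrow> all v B)"
    using fm by simp
  ultimately have "cons S (all v (A \<^bold>\<longrightarrow> B) \<^bold>\<longrightarrow> all v A \<^bold>\<longrightarrow> all v B)"
    by (intro cons.base)
  then show ?case using mp by (meson cons.mp)
qed

lemma cons_All:
  assumes "cons S (inst 0 (Var (n, \<sigma>)) A)" "(n, \<sigma>) \<notin> fv A" "\<And>B. B \<in> S \<Longrightarrow> (n, \<sigma>) \<notin> fv B"
  shows "cons S (All \<sigma> A)"
  using cons_all[OF assms(1) assms(3)] assms(2) by (simp add: all_def close_inst)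


section \<open>Maximal consistent sets\<close>

abbreviation "consistent S \<equiv> \<not> cons S Bot"

text \<open>A fresh variable plays the part of a Henkin constant. As there are infinitely many
  variables of each type and stages are finite, the language need not be extended.\<close>

lemma consistent_witness:
  assumes "consistent S" "\<^bold>\<not> (All \<sigma> A) \<in> S" "is_fm L (All \<sigma> A)" "\<And>B. B \<in> S \<Longrightarrow> (n, \<sigma>) \<notin> fv B"
  shows "consistent (insert (\<^bold>\<not> inst 0 (Var (n, \<sigma>)) A) S)"
proof
  assume "cons (insert (\<^bold>\<not> inst 0 (Var (n, \<sigma>)) A) S) Bot"
  then have "cons S (inst 0 (Var (n, \<sigma>)) A)"
    by (rule cons_classical) (use assms(3) in \<open>auto intro: is_fm_inst\<close>)
  moreover have "(n, \<sigma>) \<notin> fv A" using assms(4)[OF assms(2)] by simp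
  ultimately have "cons S (All \<sigma> A)" using assms(4) by (intro cons_All)
  moreover have "cons S (\<^bold>\<not> (All \<sigma> A))" using assms(2,3) by (intro cons.prem) auto
  ultimately show False using assms(1) by (meson cons.mp)
qed

text \<open>One step of the Lindenbaum construction: decide \<open>A\<close>, and if an accepted
  \<open>A\<close> denies a universal statement, name a counterexample. It is a relation because the
  construction proceeds by dependent choice.\<close>

definition extends :: "fm \<Rightarrow> fm set \<Rightarrow> fm set \<Rightarrow> bool" where
  "extends A S S' \<longleftrightarrow> S \<subseteq> S' \<and> finite S' \<and> consistent S' \<and>
     (is_fm L A \<longrightarrow> A \<in> S' \<or> \<not> consistent (insert A S)) \<and>
     (\<forall>\<sigma> B. A = \<^bold>\<not> (All \<sigma> B) \<and> A \<in> S' \<and> is_fm L A \<longrightarrow> (\<exists>n. \<^bold>\<not> inst 0 (Var (n, \<sigma>)) B \<in> S'))"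

lemma ex_extends:
  assumes "finite S" "consistent S"
  shows "\<exists>S'. extends A S S'"
proof -
  define S1 where "S1 = (if consistent (insert A S) then insert A S else S)"
  have S1: "S \<subseteq> S1" "finite S1" "consistent S1" "A \<in> S1 \<or> \<not> consistent (insert A S)"
    using assms by (auto simp: S1_def)
  show ?thesis
  proof (cases "\<exists>\<sigma> B. A = \<^bold>\<not> (All \<sigma> B) \<and> A \<in> S1 \<and> is_fm L A")
    case True
    then obtain \<sigma> B where A: "A = \<^bold>\<not> (All \<sigma> B)" "A \<in> S1" "is_fm L A" by blast
    have "finite (\<Union>C\<in>S1. fv C)" using S1(2) by simp
    then obtain n where "(n, \<sigma>) \<notin> (\<Union>C\<in>S1. fv C)" using ex_fresh by blast
    then have n: "(n, \<sigma>) \<notin> fv C" if "C \<in> S1" for C using that by force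
    have "consistent (insert (\<^bold>\<not> inst 0 (Var (n, \<sigma>)) B) S1)"
      using S1 A n by (intro consistent_witness) auto
    then have "extends A S (insert (\<^bold>\<not> inst 0 (Var (n, \<sigma>)) B) S1)"
      using S1 A unfolding extends_def by auto
    then show ?thesis by blast
  next
    case False
    then have "extends A S S1" using S1 unfolding extends_def by auto
    then show ?thesis by blast
  qed
qed

end

instance ty :: countable by countable_datatype
instance const :: countable by countable_datatype
instance tm :: countable by countable_datatype
instance fm :: countable by countable_datatype

section \<open>Henkin sets\<close>

locale henkin = calculus +
  fixes \<Delta> :: "fm set"
  assumes consistent: "\<not> cons \<Delta> Bot"
    and maximal: "is_fm L A \<Longrightarrow> A \<in> \<Delta> \<or> cons (insert A \<Delta>) Bot"
    and witness: "\<^bold>\<not> (All \<sigma> A) \<in> \<Delta> \<Longrightarrow> is_fm L (All \<sigma> A) \<Longrightarrow> \<exists>n. \<^bold>\<not> inst 0 (Var (n, \<sigma>)) A \<in> \<Delta>"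
begin

lemma cons_iff: "is_fm L A \<Longrightarrow> cons \<Delta> A \<longleftrightarrow> A \<in> \<Delta>"
  using maximal consistent deduction by (meson cons.mp cons.prem)

lemma Bot_not_in: "Bot \<notin> \<Delta>"
  using consistent cons_iff[of Bot] by simp

lemma neg_iff: "is_fm L A \<Longrightarrow> \<^bold>\<not> A \<in> \<Delta> \<longleftrightarrow> A \<notin> \<Delta>"
  using maximal[of A] consistent deduction[of A \<Delta> Bot] cons_iff[of "\<^bold>\<not> A"] cons_iff[of A]
  by (auto intro: cons.mp)

lemma Imp_iff:
  assumes "is_fm L A" "is_fm L B"
  shows "(A \<^bold>\<longrightarrow> B) \<in> \<Delta> \<longleftrightarrow> (A \<in> \<Delta> \<longrightarrow> B \<in> \<Delta>)"
proof
  assume "(A \<^bold>\<longrightarrow> B) \<in> \<Delta>"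
  then show "A \<in> \<Delta> \<longrightarrow> B \<in> \<Delta>" using assms cons_iff by (meson cons.mp is_fm_simps)
next
  assume *: "A \<in> \<Delta> \<longrightarrow> B \<in> \<Delta>"
  have "cons \<Delta> (A \<^bold>\<longrightarrow> B)"
  proof (cases "A \<in> \<Delta>")
    case True
    then have "cons (insert A \<Delta>) B" using * assms by (intro cons.prem) auto
    then show ?thesis using assms by (intro deduction)
  next
    case False
    then have "cons (insert A \<Delta>) Bot" using maximal assms by blast
    then have "cons (insert (\<^bold>\<not> B) (insert A \<Delta>)) Bot" by (rule cons_mono) auto
    then show ?thesis using assms by (meson deduction cons_classical)
  qed
  then show "(A \<^bold>\<longrightarrow> B) \<in> \<Delta>" using assms cons_iff by simp
qed

lemma All_iff:
  assumes "is_fm L (All \<sigma> A)"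
  shows "All \<sigma> A \<in> \<Delta> \<longleftrightarrow> (\<forall>t. is_tm L t \<sigma> \<longrightarrow> inst 0 t A \<in> \<Delta>)"
proof
  assume "All \<sigma> A \<in> \<Delta>"
  then show "\<forall>t. is_tm L t \<sigma> \<longrightarrow> inst 0 t A \<in> \<Delta>"
    using assms derives_allE is_fm_inst[OF assms] cons_iff cons_iff[OF assms]
    by (metis cons.mp cons.base is_fm_simps(2))
next
  assume "\<forall>t. is_tm L t \<sigma> \<longrightarrow> inst 0 t A \<in> \<Delta>"
  then show "All \<sigma> A \<in> \<Delta>"
    using witness[OF _ assms] neg_iff[OF assms] neg_iff is_fm_inst[OF assms] is_tm_Var
    by (metis snd_conv)
qed

lemma theorem_in: "derives L T [] A \<Longrightarrow> is_fm L A \<Longrightarrow> A \<in> \<Delta>"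
  using cons_iff cons.base by blast

end

text \<open>Stage \<open>n\<close> treats the formula with number \<open>n\<close>, starting from
  the negation of \<open>G\<close>. Finiteness is part of the invariant so that fresh variables
  remain; an inconsistency of the union would use finitely many formulas, all contained in one
  stage.\<close>

lemma (in calculus) ex_henkin:
  assumes "\<not> derives L T [] G" "is_fm L G"
  shows "\<exists>\<Delta>. henkin L T \<Delta> \<and> G \<notin> \<Delta>"
proof -
  let ?S0 = "{\<^bold>\<not> G}"
  have 0: "consistent ?S0"
    using cons_classical[of G "{}"] cons_empty assms by blast
  have "\<exists>f. \<forall>n. (finite (f n) \<and> consistent (f n) \<and> ?S0 \<subseteq> f n) \<and> extends (from_nat n) (f n) (f (Suc n))"
  proof (rule dependent_nat_choice)
    show "\<exists>x. finite x \<and> consistent x \<and> ?S0 \<subseteq> x" using 0 by blast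
  next
    fix S n assume S: "finite S \<and> consistent S \<and> ?S0 \<subseteq> S"
    then obtain S' where S': "extends (from_nat n) S S'" using ex_extends by meson
    then have "finite S'" "consistent S'" "S \<subseteq> S'" unfolding extends_def by blast+
    with S S' show "\<exists>S'. (finite S' \<and> consistent S' \<and> ?S0 \<subseteq> S') \<and> extends (from_nat n) S S'"
      by (meson order_trans)
  qed
  then obtain f where f: "\<And>n. consistent (f n)" "\<And>n. ?S0 \<subseteq> f n"
    "\<And>n. extends (from_nat n) (f n) (f (Suc n))"
    by blast
  define \<Delta> where "\<Delta> = (\<Union>n. f n)"
  have mono: "m \<le> n \<Longrightarrow> f m \<subseteq> f n" for m n
    using lift_Suc_mono_le[of f m n] f(3) by (auto simp: extends_def)
  have con: "consistent \<Delta>"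
  proof
    assume "cons \<Delta> Bot"
    then obtain S where S: "finite S" "S \<subseteq> \<Delta>" "cons S Bot" using cons_finite by blast
    from S(1,2) have "\<exists>n. S \<subseteq> f n"
    proof (induction rule: finite_induct)
      case (insert A S)
      then obtain m n where "S \<subseteq> f n" "A \<in> f m" by (auto simp: \<Delta>_def)
      then have "insert A S \<subseteq> f (max m n)" using mono[of m "max m n"] mono[of n "max m n"] by auto
      then show ?case by blast
    qed simp
    then show False using S(3) f(1) cons_mono by blast
  qed
  have "henkin L T \<Delta>"
  proof
    show "\<not> cons \<Delta> Bot" by (fact con)
  next
    fix A assume A: "is_fm L A"
    have "A \<in> f (Suc (to_nat A)) \<or> \<not> consistent (insert A (f (to_nat A)))"
      using f(3)[of "to_nat A"] A by (auto simp: extends_def)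
    moreover have "cons (insert A \<Delta>) Bot" if "cons (insert A (f (to_nat A))) Bot"
      using that by (rule cons_mono) (auto simp: \<Delta>_def)
    ultimately show "A \<in> \<Delta> \<or> cons (insert A \<Delta>) Bot" by (auto simp: \<Delta>_def)
  next
    fix \<sigma> A assume A: "\<^bold>\<not> (All \<sigma> A) \<in> \<Delta>" "is_fm L (All \<sigma> A)"
    let ?A = "\<^bold>\<not> (All \<sigma> A)" and ?n = "to_nat (\<^bold>\<not> (All \<sigma> A))"
    \<comment> \<open>The formula may have entered the union at any stage. Being consistent with the
      union, it is accepted at the stage that treats it, and there its witness is added.\<close>
    have "consistent (insert ?A (f ?n))"
      using con cons_mono[of "insert ?A (f ?n)" Bot \<Delta>] A(1) by (auto simp: \<Delta>_def)
    moreover have "is_fm L ?A \<longrightarrow> ?A \<in> f (Suc ?n) \<or> \<not> consistent (insert ?A (f ?n))"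
      using f(3)[of ?n] unfolding extends_def from_nat_to_nat by blast
    ultimately have "?A \<in> f (Suc ?n)" using A(2) by simp
    then have "\<exists>n. \<^bold>\<not> inst 0 (Var (n, \<sigma>)) A \<in> f (Suc ?n)"
      using f(3)[of ?n] A unfolding extends_def from_nat_to_nat by (metis is_fm_simps)
    then show "\<exists>n. \<^bold>\<not> inst 0 (Var (n, \<sigma>)) A \<in> \<Delta>" unfolding \<Delta>_def by blast
  qed
  moreover from this interpret henkin L T \<Delta> .
  have "\<^bold>\<not> G \<in> \<Delta>" using f(2)[of 0] by (auto simp: \<Delta>_def)
  then have "G \<notin> \<Delta>" using neg_iff assms(2) by blast
  ultimately show ?thesis by blast
qed

section \<open>Typing of the closed terms\<close>

lemma type_of_lam [simp]:
  "type_of [] t \<noteq> None \<Longrightarrow> type_of \<Gamma> (lam v t) = Some (snd v \<rightarrow> the (type_of [] t))"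
proof (induction t)
  case (App s t)
  then obtain \<tau> where "type_of [] (s \<cdot> t) = Some \<tau>" by blast
  moreover then obtain \<sigma> where "type_of [] s = Some (\<sigma> \<rightarrow> \<tau>)" "type_of [] t = Some \<sigma>" by auto
  moreover then have "type_of \<Gamma> s = Some (\<sigma> \<rightarrow> \<tau>)" "type_of \<Gamma> t = Some \<sigma>"
    by (auto intro: type_of_Nil)
  ultimately show ?case using App.IH by (auto simp: type_of.simps(4))
qed (auto simp: type_of.simps(4))

lemma fv_tm_lam [simp]: "fv_tm (lam v t) = fv_tm t - {v}"
  by (induction t) auto

lemma xis_tm_lam [simp]: "xis_tm (lam v t) = xis_tm t"
  by (induction t) auto

lemma type_of_rec [simp]:
  assumes "type_of \<Gamma> t = Some Ty0" "type_of \<Gamma> a = Some Ty0" "type_of [] b = Some Ty0"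
  shows "type_of \<Gamma> (rec t a b) = Some Ty0"
  using assms by (simp add: rec_def)

lemma fv_tm_rec [simp]: "fv_tm (rec t a b) = fv_tm t \<union> fv_tm a \<union> (fv_tm b - {uv, vv})"
  by (auto simp: rec_def)

lemma xis_tm_rec [simp]: "xis_tm (rec t a b) = xis_tm t \<union> xis_tm a \<union> xis_tm b"
  by (auto simp: rec_def)

lemma pred_c_typing [simp]: "type_of \<Gamma> pred_c = Some Ty1" "fv_tm pred_c = {}" "xis_tm pred_c = {}"
  by (auto simp: pred_c_def type_of.simps(4))

lemma monus_c_typing [simp]: "type_of \<Gamma> monus_c = Some (Ty0 \<rightarrow> Ty0 \<rightarrow> Ty0)" "fv_tm monus_c = {}" "xis_tm monus_c = {}"
  by (auto simp: monus_c_def type_of.simps(4))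

lemma plus_c_typing [simp]: "type_of \<Gamma> plus_c = Some (Ty0 \<rightarrow> Ty0 \<rightarrow> Ty0)" "fv_tm plus_c = {}" "xis_tm plus_c = {}"
  by (auto simp: plus_c_def type_of.simps(4))

lemma sg_c_typing [simp]: "type_of \<Gamma> sg_c = Some Ty1" "fv_tm sg_c = {}" "xis_tm sg_c = {}"
  by (auto simp: sg_c_def type_of.simps(4))

lemma cond_c_typing [simp]: "type_of \<Gamma> cond_c = Some (Ty0 \<rightarrow> Ty0 \<rightarrow> Ty0 \<rightarrow> Ty0)" "fv_tm cond_c = {}" "xis_tm cond_c = {}"
  by (auto simp: cond_c_def type_of.simps(4))

lemma tri_c_typing [simp]: "type_of \<Gamma> tri_c = Some Ty1" "fv_tm tri_c = {}" "xis_tm tri_c = {}"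
  by (auto simp: tri_c_def type_of.simps(4))

lemma pair_c_typing [simp]: "type_of \<Gamma> pair_c = Some (Ty0 \<rightarrow> Ty0 \<rightarrow> Ty0)" "fv_tm pair_c = {}" "xis_tm pair_c = {}"
  by (auto simp: pair_c_def type_of.simps(4))

lemma root_c_typing [simp]: "type_of \<Gamma> root_c = Some Ty1" "fv_tm root_c = {}" "xis_tm root_c = {}"
  by (auto simp: root_c_def type_of.simps(4))

lemma psnd_c_typing [simp]: "type_of \<Gamma> psnd_c = Some Ty1" "fv_tm psnd_c = {}" "xis_tm psnd_c = {}"
  by (auto simp: psnd_c_def type_of.simps(4))

lemma pfst_c_typing [simp]: "type_of \<Gamma> pfst_c = Some Ty1" "fv_tm pfst_c = {}" "xis_tm pfst_c = {}"
  by (auto simp: pfst_c_def type_of.simps(4))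

lemma bar_c_typing [simp]: "type_of \<Gamma> bar_c = Some (Ty1 \<rightarrow> Ty0 \<rightarrow> Ty0)" "fv_tm bar_c = {}" "xis_tm bar_c = {}"
  by (auto simp: bar_c_def type_of.simps(4))

lemma drop_c_typing [simp]: "type_of \<Gamma> drop_c = Some (Ty0 \<rightarrow> Ty0 \<rightarrow> Ty0)" "fv_tm drop_c = {}" "xis_tm drop_c = {}"
  by (auto simp: drop_c_def type_of.simps(4))

lemma lh_c_typing [simp]: "type_of \<Gamma> lh_c = Some Ty1" "fv_tm lh_c = {}" "xis_tm lh_c = {}"
  by (auto simp: lh_c_def type_of.simps(4))

lemma nth_c_typing [simp]: "type_of \<Gamma> nth_c = Some (Ty0 \<rightarrow> Ty0 \<rightarrow> Ty0)" "fv_tm nth_c = {}" "xis_tm nth_c = {}"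
  by (auto simp: nth_c_def type_of.simps(4))

lemma init_c_typing [simp]: "type_of \<Gamma> init_c = Some (Ty0 \<rightarrow> Ty0 \<rightarrow> Ty0)" "fv_tm init_c = {}" "xis_tm init_c = {}"
  by (auto simp: init_c_def type_of.simps(4))

lemma xis_tm_lift [simp]: "xis_tm (lift t) = xis_tm t"
  by (induction t) auto

lemma wf_less: "type_of \<Gamma> s = Some Ty0 \<Longrightarrow> type_of \<Gamma> t = Some Ty0 \<Longrightarrow> wf_fm \<Gamma> (less s t)"
  by (simp add: less_def le_def)

lemma wf_eq: "type_of \<Gamma> s = Some \<sigma> \<Longrightarrow> type_of \<Gamma> t = Some \<sigma> \<Longrightarrow> wf_fm \<Gamma> (eq \<sigma> s t)"
  by (induction \<sigma> arbitrary: \<Gamma> s t) (simp_all add: type_of_lift wf_less)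

lemma xis_eq [simp]: "xis (eq \<sigma> s t) \<subseteq> xis_tm s \<union> xis_tm t"
  by (induction \<sigma> arbitrary: s t) (fastforce simp: less_def le_def)+

lemma is_fm_eq: "is_tm L s \<sigma> \<Longrightarrow> is_tm L t \<sigma> \<Longrightarrow> is_fm L (eq \<sigma> s t)"
  unfolding is_tm_def is_fm_def using xis_eq[of \<sigma> s t] wf_eq[of "[]" s \<sigma> t] by blast


section \<open>Semantics\<close>

text \<open>One carrier holds the objects of all object-level types, as these types are data.
  Equality of numbers is a component because in the term model it is membership in
  \<open>\<Delta>\<close>; only the quotient turns it into identity.\<close>

record 'a interp =
  Dom :: "ty \<Rightarrow> 'a set"
  Ap :: "'a \<Rightarrow> 'a \<Rightarrow> 'a"
  Cn :: "const \<Rightarrow> 'a"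
  Eqv :: "'a \<Rightarrow> 'a \<Rightarrow> bool"
  Std :: "ty \<Rightarrow> 'a \<Rightarrow> bool"

primrec ev :: "'a interp \<Rightarrow> (var \<Rightarrow> 'a) \<Rightarrow> 'a list \<Rightarrow> tm \<Rightarrow> 'a" where
  "ev M e bs (Var v) = e v"
| "ev M e bs (Bound i) = bs ! i"
| "ev M e bs (Const c) = Cn M c"
| "ev M e bs (s \<cdot> t) = Ap M (ev M e bs s) (ev M e bs t)"

primrec sat :: "'a interp \<Rightarrow> (var \<Rightarrow> 'a) \<Rightarrow> 'a list \<Rightarrow> fm \<Rightarrow> bool" where
  "sat M e bs (s \<approx> t) \<longleftrightarrow> Eqv M (ev M e bs s) (ev M e bs t)"
| "sat M e bs (St \<sigma> t) \<longleftrightarrow> Std M \<sigma> (ev M e bs t)"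
| "sat M e bs Bot \<longleftrightarrow> False"
| "sat M e bs (A \<^bold>\<longrightarrow> B) \<longleftrightarrow> (sat M e bs A \<longrightarrow> sat M e bs B)"
| "sat M e bs (All \<sigma> A) \<longleftrightarrow> (\<forall>a\<in>Dom M \<sigma>. sat M e (a # bs) A)"

definition good :: "'a interp \<Rightarrow> (var \<Rightarrow> 'a) \<Rightarrow> bool" where
  "good M e \<longleftrightarrow> (\<forall>v. e v \<in> Dom M (snd v))"

definition valid :: "'a interp \<Rightarrow> fm \<Rightarrow> bool" where
  "valid M A \<longleftrightarrow> (\<forall>e. good M e \<longrightarrow> sat M e [] A)"

lemma good_upd [simp]: "good M e \<Longrightarrow> a \<in> Dom M (snd v) \<Longrightarrow> good M (e(v := a))"
  unfolding good_def by (metis fun_upd_apply)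

lemma ev_cong: "(\<And>v. v \<in> fv_tm t \<Longrightarrow> e v = e' v) \<Longrightarrow> ev M e bs t = ev M e' bs t"
  by (induction t) auto

lemma sat_cong: "(\<And>v. v \<in> fv A \<Longrightarrow> e v = e' v) \<Longrightarrow> sat M e bs A \<longleftrightarrow> sat M e' bs A"
proof (induction A arbitrary: bs)
  case (Eq s t)
  then show ?case using ev_cong[of s e e' M bs] ev_cong[of t e e' M bs] by auto
next
  case (St \<sigma> t)
  then show ?case using ev_cong[of t e e' M bs] by auto
qed auto

lemma ev_append: "type_of \<Gamma> t = Some \<sigma> \<Longrightarrow> length bs = length \<Gamma> \<Longrightarrow> ev M e (bs @ cs) t = ev M e bs t"
  by (induction t arbitrary: \<sigma>) (fastforce split: if_splits simp: nth_append)+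

lemma ev_Nil: "type_of [] t = Some \<sigma> \<Longrightarrow> ev M e bs t = ev M e [] t"
  using ev_append[of "[]" t \<sigma> "[]" M e bs] by simp

lemma ev_closed:
  assumes "type_of [] t = Some \<sigma>" "fv_tm t = {}"
  shows "ev M e bs t = ev M e' bs' t"
  using ev_Nil[OF assms(1), of M e bs] ev_Nil[OF assms(1), of M e' bs'] ev_cong[of t e e' M "[]"] assms(2)
  by simp

lemma ev_lift [simp]: "ev M e (a # bs) (lift t) = ev M e bs t"
  by (induction t) auto

lemma ev_close:
  "type_of \<Gamma> t = Some \<sigma> \<Longrightarrow> length bs = length \<Gamma> \<Longrightarrow>
    ev M e (bs @ [a]) (close_tm (length bs) v t) = ev M (e(v := a)) bs t"
  by (induction t arbitrary: \<sigma>) (fastforce split: if_splits simp: nth_append)+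

lemma sat_close:
  "wf_fm \<Gamma> A \<Longrightarrow> length bs = length \<Gamma> \<Longrightarrow>
    sat M e (bs @ [a]) (close (length bs) v A) \<longleftrightarrow> sat M (e(v := a)) bs A"
proof (induction A arbitrary: \<Gamma> bs)
  case (All \<sigma> A)
  have "sat M e ((b # bs) @ [a]) (close (length (b # bs)) v A) \<longleftrightarrow> sat M (e(v := a)) (b # bs) A" for b
    using All.IH[of "\<sigma> # \<Gamma>" "b # bs"] All.prems by (simp del: fun_upd_apply)
  then show ?case by (simp del: fun_upd_apply)
next
  case (Eq s t)
  show ?case using ev_close[OF _ Eq.prems(2)] Eq.prems(1) by (simp del: fun_upd_apply)
next
  case (St \<sigma> t)
  show ?case using ev_close[OF _ St.prems(2)] St.prems(1) by (simp del: fun_upd_apply)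
qed auto

lemma sat_all [simp]:
  "wf_fm [] A \<Longrightarrow> sat M e [] (all v A) \<longleftrightarrow> (\<forall>a\<in>Dom M (snd v). sat M (e(v := a)) [] A)"
  using sat_close[of "[]" A "[]" M e _ v] by (simp add: all_def)

lemma sat_ex [simp]:
  "wf_fm [] A \<Longrightarrow> sat M e [] (ex v A) \<longleftrightarrow> (\<exists>a\<in>Dom M (snd v). sat M (e(v := a)) [] A)"
  by (simp add: ex_def)

lemma ev_inst:
  "type_of (\<Gamma> @ [\<rho>]) t = Some \<sigma> \<Longrightarrow> length bs = length \<Gamma> \<Longrightarrow> type_of [] u = Some \<rho> \<Longrightarrow>
    ev M e bs (inst_tm (length bs) u t) = ev M e (bs @ [ev M e [] u]) t"
  by (induction t arbitrary: \<sigma>) (fastforce split: if_splits simp: nth_append dest: ev_Nil)+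

lemma sat_inst:
  "wf_fm (\<Gamma> @ [\<rho>]) A \<Longrightarrow> length bs = length \<Gamma> \<Longrightarrow> type_of [] u = Some \<rho> \<Longrightarrow>
    sat M e bs (inst (length bs) u A) \<longleftrightarrow> sat M e (bs @ [ev M e [] u]) A"
proof (induction A arbitrary: \<Gamma> bs)
  case (All \<sigma> A)
  have "sat M e (b # bs) (inst (length (b # bs)) u A) \<longleftrightarrow> sat M e ((b # bs) @ [ev M e [] u]) A" for b
    using All.IH[of "\<sigma> # \<Gamma>" "b # bs"] All.prems by simp
  then show ?case by simp
next
  case (Eq s t)
  show ?case using ev_inst[OF _ Eq.prems(2,3)] Eq.prems(1) by simp
next
  case (St \<sigma> t)
  show ?case using ev_inst[OF _ St.prems(2,3)] St.prems(1) by simp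
qed auto

lemma sat_subst:
  assumes "wf_fm [] A" "type_of [] t = Some (snd v)"
  shows "sat M e [] (subst v t A) \<longleftrightarrow> sat M (e(v := ev M e [] t)) [] A"
  using sat_inst[of "[]" "snd v" "close 0 v A" "[]" t M e] wf_close[of "[]" A v] assms
    sat_close[of "[]" A "[]" M e "ev M e [] t" v]
  by (simp add: subst_def)

text \<open>\<open>monus_c\<close> is closed and contains no index, so the assignment
  \<open>undefined\<close> does not influence its value.\<close>

definition less_val :: "'a interp \<Rightarrow> 'a \<Rightarrow> 'a \<Rightarrow> bool" where
  "less_val M a b \<longleftrightarrow> Eqv M (Ap M (Ap M (ev M undefined [] monus_c) (Ap M (Cn M Succ) a)) b) (Cn M Zero)"

lemma sat_less: "sat M e bs (less s t) \<longleftrightarrow> less_val M (ev M e bs s) (ev M e bs t)"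
  using ev_closed[of monus_c _ M e bs undefined "[]"] by (simp add: less_def le_def less_val_def)

primrec equal :: "'a interp \<Rightarrow> ty \<Rightarrow> 'a \<Rightarrow> 'a \<Rightarrow> bool" where
  "equal M Ty0 a b \<longleftrightarrow> Eqv M a b"
| "equal M (\<sigma> \<rightarrow> \<tau>) a b \<longleftrightarrow> (\<forall>c\<in>Dom M \<sigma>. equal M \<tau> (Ap M a c) (Ap M b c))"
| "equal M (Seq \<sigma>) a b \<longleftrightarrow> Eqv M (Ap M (Cn M (Len \<sigma>)) a) (Ap M (Cn M (Len \<sigma>)) b) \<and>
    (\<forall>i\<in>Dom M Ty0. less_val M i (Ap M (Cn M (Len \<sigma>)) a) \<longrightarrow>
      equal M \<sigma> (Ap M (Ap M (Cn M (Idx \<sigma>)) a) i) (Ap M (Ap M (Cn M (Idx \<sigma>)) b) i))"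

lemma sat_eq: "sat M e bs (eq \<sigma> s t) \<longleftrightarrow> equal M \<sigma> (ev M e bs s) (ev M e bs t)"
  by (induction \<sigma> arbitrary: s t bs) (auto simp: sat_less)

locale typed =
  fixes L :: "(nat \<times> ty) set" and M :: "'a interp"
  assumes Ap_Dom: "f \<in> Dom M (\<sigma> \<rightarrow> \<tau>) \<Longrightarrow> a \<in> Dom M \<sigma> \<Longrightarrow> Ap M f a \<in> Dom M \<tau>"
    and Cn_Dom: "xis_tm (Const c) \<subseteq> L \<Longrightarrow> Cn M c \<in> Dom M (cty c)"
begin

lemma ev_Dom_list:
  "type_of \<Gamma> t = Some \<sigma> \<Longrightarrow> xis_tm t \<subseteq> L \<Longrightarrow> good M e \<Longrightarrow>
    length bs = length \<Gamma> \<Longrightarrow> (\<And>i. i < length \<Gamma> \<Longrightarrow> bs ! i \<in> Dom M (\<Gamma> ! i)) \<Longrightarrow> ev M e bs t \<in> Dom M \<sigma>"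
proof (induction t arbitrary: \<sigma>)
  case (App s t)
  then obtain \<tau> where \<tau>: "type_of \<Gamma> s = Some (\<tau> \<rightarrow> \<sigma>)" "type_of \<Gamma> t = Some \<tau>" by auto
  then show ?case using App.IH(1)[OF \<tau>(1)] App.IH(2)[OF \<tau>(2)] App.prems by (auto intro: Ap_Dom)
next
  case (Const c)
  then show ?case using Cn_Dom[of c] by auto
qed (auto simp: good_def split: if_splits)

lemma ev_Dom: "is_tm L t \<sigma> \<Longrightarrow> good M e \<Longrightarrow> ev M e [] t \<in> Dom M \<sigma>"
  by (auto simp: is_tm_def intro: ev_Dom_list[of "[]"])

end

text \<open>Instantiates a universal closure one variable after the other. It leads from the truth
  of a closure under one assignment to the truth of its matrix under all of them.\<close>

lemma sat_alls:
  assumes "wf_fm [] A" "good M e" "good M e'" "sat M e [] (foldr all vs A)"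
  shows "sat M (\<lambda>v. if v \<in> set vs then e' v else e v) [] A"
  using assms(2-)
proof (induction vs arbitrary: e)
  case (Cons v vs)
  have wf: "wf_fm [] (foldr all vs A)" using assms(1) by (induction vs) auto
  have e'v: "e' v \<in> Dom M (snd v)" using Cons.prems unfolding good_def by blast
  then have "sat M (e(v := e' v)) [] (foldr all vs A)" using Cons.prems wf by simp
  then have "sat M (\<lambda>w. if w \<in> set vs then e' w else (e(v := e' v)) w) [] A"
    using Cons.prems e'v by (intro Cons.IH[of "e(v := e' v)"] good_upd)
  moreover have "(\<lambda>w. if w \<in> set vs then e' w else (e(v := e' v)) w) =
      (\<lambda>w. if w \<in> set (v # vs) then e' w else e w)" by auto
  ultimately show ?case by simp
qed simp


section \<open>The term model\<close>

text \<open>All dangling indices are filled at once, just as evaluation in the term model looks them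
  up in its stack of values; \<open>inst\<close> fills a single one.\<close>

primrec sb_tm :: "nat \<Rightarrow> tm list \<Rightarrow> tm \<Rightarrow> tm" where
  "sb_tm k ts (Var w) = Var w"
| "sb_tm k ts (Bound i) = (if i < k then Bound i else ts ! (i - k))"
| "sb_tm k ts (Const c) = Const c"
| "sb_tm k ts (s \<cdot> t) = sb_tm k ts s \<cdot> sb_tm k ts t"

primrec sb :: "nat \<Rightarrow> tm list \<Rightarrow> fm \<Rightarrow> fm" where
  "sb k ts (s \<approx> t) = (sb_tm k ts s \<approx> sb_tm k ts t)"
| "sb k ts (St \<sigma> t) = St \<sigma> (sb_tm k ts t)"
| "sb k ts Bot = Bot"
| "sb k ts (A \<^bold>\<longrightarrow> B) = (sb k ts A \<^bold>\<longrightarrow> sb k ts B)"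
| "sb k ts (All \<sigma> A) = All \<sigma> (sb (Suc k) ts A)"

context
  fixes L :: "(nat \<times> ty) set" and \<Gamma> :: "ty list" and ts :: "tm list"
  assumes ts: "length ts = length \<Gamma>" "\<And>i. i < length \<Gamma> \<Longrightarrow> is_tm L (ts ! i) (\<Gamma> ! i)"
begin

lemma type_of_sb_tm:
  "type_of (\<Gamma>' @ \<Gamma>) t = Some \<sigma> \<Longrightarrow> xis_tm t \<subseteq> L \<Longrightarrow>
    type_of \<Gamma>' (sb_tm (length \<Gamma>') ts t) = Some \<sigma> \<and> xis_tm (sb_tm (length \<Gamma>') ts t) \<subseteq> L"
proof (induction t arbitrary: \<sigma>)
  case (Bound i)
  then have "i \<ge> length \<Gamma>' \<Longrightarrow> is_tm L (ts ! (i - length \<Gamma>')) (\<Gamma> ! (i - length \<Gamma>'))"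
    by (intro ts(2)) (auto split: if_splits)
  then show ?case using Bound by (auto simp: nth_append is_tm_def split: if_splits intro: type_of_Nil)
qed fastforce+

lemma wf_sb:
  "wf_fm (\<Gamma>' @ \<Gamma>) A \<Longrightarrow> xis A \<subseteq> L \<Longrightarrow>
    wf_fm \<Gamma>' (sb (length \<Gamma>') ts A) \<and> xis (sb (length \<Gamma>') ts A) \<subseteq> L"
proof (induction A arbitrary: \<Gamma>')
  case (All \<sigma> A)
  then show ?case using All.IH[of "\<sigma> # \<Gamma>'"] by simp
qed (auto dest: type_of_sb_tm)

lemma is_fm_sb: "wf_fm \<Gamma> A \<Longrightarrow> xis A \<subseteq> L \<Longrightarrow> is_fm L (sb 0 ts A)"
  using wf_sb[of "[]" A] by (simp add: is_fm_def)

lemma inst_tm_sb_tm: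
  assumes "type_of (\<Gamma>' @ [\<rho>] @ \<Gamma>) t = Some \<sigma>"
  shows "inst_tm (length \<Gamma>') u (sb_tm (Suc (length \<Gamma>')) ts t) = sb_tm (length \<Gamma>') (u # ts) t"
  using assms
proof (induction t arbitrary: \<sigma>)
  case (Bound i)
  show ?case
  proof (cases "i \<le> length \<Gamma>'")
    case False
    then have "is_tm L (ts ! (i - Suc (length \<Gamma>'))) (\<Gamma> ! (i - Suc (length \<Gamma>')))"
      using Bound by (intro ts(2)) (auto split: if_splits)
    then have "inst_tm (length \<Gamma>') u (ts ! (i - Suc (length \<Gamma>'))) = ts ! (i - Suc (length \<Gamma>'))"
      by (auto simp: is_tm_def intro: inst_tm_closed)
    then show ?thesis using False by (auto simp: nth_Cons')
  qed auto
qed auto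

lemma inst_sb:
  "wf_fm (\<Gamma>' @ [\<rho>] @ \<Gamma>) A \<Longrightarrow>
    inst (length \<Gamma>') u (sb (Suc (length \<Gamma>')) ts A) = sb (length \<Gamma>') (u # ts) A"
proof (induction A arbitrary: \<Gamma>')
  case (All \<sigma> A)
  then show ?case using All.IH[of "\<sigma> # \<Gamma>'"] by simp
qed (auto dest: inst_tm_sb_tm[unfolded append.simps append_Cons])

end

lemma sb_tm_Nil: "type_of \<Gamma> t = Some \<sigma> \<Longrightarrow> sb_tm (length \<Gamma>) [] t = t"
  by (induction t arbitrary: \<sigma>) (auto split: if_splits)

lemma sb_fm_Nil: "wf_fm \<Gamma> A \<Longrightarrow> sb (length \<Gamma>) [] A = A"
proof (induction A arbitrary: \<Gamma>)
  case (All \<sigma> A)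
  then show ?case using All.IH[of "\<sigma> # \<Gamma>"] by simp
qed (auto simp: sb_tm_Nil)

context henkin
begin

definition term_model :: "tm interp" where
  "term_model = \<lparr>Dom = \<lambda>\<sigma>. {t. is_tm L t \<sigma>}, Ap = App, Cn = Const, Eqv = \<lambda>s t. (s \<approx> t) \<in> \<Delta>,
     Std = \<lambda>\<sigma> t. St \<sigma> t \<in> \<Delta>\<rparr>"

lemma term_model_simps [simp]:
  "Dom term_model \<sigma> = {t. is_tm L t \<sigma>}" "Ap term_model = App" "Cn term_model = Const"
  "Eqv term_model s t \<longleftrightarrow> (s \<approx> t) \<in> \<Delta>" "Std term_model \<sigma> t \<longleftrightarrow> St \<sigma> t \<in> \<Delta>"
  by (simp_all add: term_model_def)

lemma typed_term_model: "typed L term_model"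
  by unfold_locales auto

lemma ev_term_model:
  "type_of \<Gamma> t = Some \<sigma> \<Longrightarrow> length ts = length \<Gamma> \<Longrightarrow> ev term_model Var ts t = sb_tm 0 ts t"
  by (induction t arbitrary: \<sigma>) (auto split: if_splits)

text \<open>The quantifier case pushes a term onto the stack, so the induction has to cover formulas
  with dangling indices. Free variables are kept as themselves here; other assignments are reached
  through universal closures.\<close>

lemma truth:
  "wf_fm \<Gamma> A \<Longrightarrow> xis A \<subseteq> L \<Longrightarrow> length ts = length \<Gamma> \<Longrightarrow>
    (\<And>i. i < length \<Gamma> \<Longrightarrow> is_tm L (ts ! i) (\<Gamma> ! i)) \<Longrightarrow> sat term_model Var ts A \<longleftrightarrow> sb 0 ts A \<in> \<Delta>"
proof (induction A arbitrary: \<Gamma> ts)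
  case (All \<sigma> A)
  have fm: "is_fm L (sb 0 ts (All \<sigma> A))"
    using All.prems by (intro is_fm_sb[of _ \<Gamma>]) auto
  have "sat term_model Var (t # ts) A \<longleftrightarrow> inst 0 t (sb 1 ts A) \<in> \<Delta>" if "is_tm L t \<sigma>" for t
  proof -
    have "is_tm L ((t # ts) ! i) ((\<sigma> # \<Gamma>) ! i)" if "i < length (\<sigma> # \<Gamma>)" for i
      using that All.prems(4) \<open>is_tm L t \<sigma>\<close> by (cases i) auto
    then have "sat term_model Var (t # ts) A \<longleftrightarrow> sb 0 (t # ts) A \<in> \<Delta>"
      using All.prems All.IH[of "\<sigma> # \<Gamma>" "t # ts"] by simp
    moreover have "inst 0 t (sb 1 ts A) = sb 0 (t # ts) A"
      using inst_sb[of ts \<Gamma> L "[]" \<sigma> A t] All.prems by simp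
    ultimately show ?thesis by simp
  qed
  then show ?case using All_iff[of \<sigma> "sb 1 ts A"] fm by simp
next
  case (Imp A B)
  have "is_fm L (sb 0 ts A)" "is_fm L (sb 0 ts B)"
    using Imp.prems by (auto intro!: is_fm_sb[of _ \<Gamma>])
  then show ?case using Imp.IH[of \<Gamma> ts] Imp.prems Imp_iff by simp
next
  case (Eq s t)
  then show ?case by (simp add: ev_term_model[of \<Gamma>])
next
  case (St \<sigma> t)
  then show ?case by (simp add: ev_term_model[of \<Gamma>])
qed (auto simp: Bot_not_in)

lemma truth_sentence: "is_fm L A \<Longrightarrow> sat term_model Var [] A \<longleftrightarrow> A \<in> \<Delta>"
  using truth[of "[]" A "[]"] sb_fm_Nil[of "[]" A] by (simp add: is_fm_def)

lemma good_Var [simp]: "good term_model Var"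
  by (simp add: good_def)

text \<open>An axiom can be generalised over all its variables in the empty context, so its
  universal closure lies in \<open>\<Delta>\<close>; the truth lemma for the identical assignment
  then covers every assignment.\<close>

lemma valid_term_model:
  assumes "A \<in> T" "is_fm L A"
  shows "valid term_model A"
  unfolding valid_def
proof (intro HOL.allI HOL.impI)
  fix e assume e: "good term_model e"
  obtain vs where vs: "set vs = fv A" using finite_list[OF finite_fv] by blast
  have "derives L T [] (foldr all vs A) \<and> is_fm L (foldr all vs A)"
    using assms by (induction vs) (auto intro: ax derives_gen)
  then have "sat term_model Var [] (foldr all vs A)" using theorem_in truth_sentence by blast
  then have "sat term_model (\<lambda>v. if v \<in> set vs then e v else Var v) [] A"
    using assms e by (intro sat_alls) (auto simp: is_fm_def)
  then show "sat term_model e [] A"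
    using sat_cong[of A e "\<lambda>v. if v \<in> set vs then e v else Var v" term_model "[]"] vs by auto
qed

end


section \<open>The extensional quotient\<close>

locale theory_model = henkin +
  assumes base: "RCA0_omega L \<subseteq> T"
    and st_eq: "\<And>\<sigma>. (eq \<sigma> (Var (0, \<sigma>)) (Var (1, \<sigma>)) \<^bold>\<longrightarrow> St \<sigma> (Var (0, \<sigma>)) \<^bold>\<longrightarrow> St \<sigma> (Var (1, \<sigma>))) \<in> T"
begin

abbreviation "Q \<equiv> equal term_model"

lemma sat_axiom: "A \<in> RCA0_omega L \<Longrightarrow> is_fm L A \<Longrightarrow> good term_model e \<Longrightarrow> sat term_model e [] A"
  using valid_term_model[of A] base by (auto simp: valid_def)

lemma Eqv_refl: "is_tm L a Ty0 \<Longrightarrow> (a \<approx> a) \<in> \<Delta>"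
  using sat_axiom[OF RCA0_omega.eq_refl, of "Var(xv := a)"] by (simp add: is_fm_def)

lemma Eqv_sym: "is_tm L a Ty0 \<Longrightarrow> is_tm L b Ty0 \<Longrightarrow> (a \<approx> b) \<in> \<Delta> \<Longrightarrow> (b \<approx> a) \<in> \<Delta>"
  using sat_axiom[OF RCA0_omega.eq_sym, of "Var(xv := a, yv := b)"] by (simp add: is_fm_def)

lemma Eqv_trans:
  "is_tm L a Ty0 \<Longrightarrow> is_tm L b Ty0 \<Longrightarrow> is_tm L c Ty0 \<Longrightarrow> (a \<approx> b) \<in> \<Delta> \<Longrightarrow> (b \<approx> c) \<in> \<Delta> \<Longrightarrow> (a \<approx> c) \<in> \<Delta>"
  using sat_axiom[OF RCA0_omega.eq_trans, of "Var(xv := a, yv := b, uv := c)"] by (simp add: is_fm_def)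

text \<open>Congruence in the function is part of the definition of equality at function types. The
  axiom of extensionality supplies the other half, congruence in the argument.\<close>

lemma Q_ext:
  assumes "is_tm L f (\<rho> \<rightarrow> \<tau>)" "is_tm L a \<rho>" "is_tm L b \<rho>" "Q \<rho> a b"
  shows "Q \<tau> (f \<cdot> a) (f \<cdot> b)"
proof -
  let ?e = "Var((0, \<rho>) := a, (1, \<rho>) := b, (2, \<rho> \<rightarrow> \<tau>) := f)"
  have "sat term_model ?e [] (eq \<rho> (Var (0, \<rho>)) (Var (1, \<rho>)) \<^bold>\<longrightarrow>
      eq \<tau> (Var (2, \<rho> \<rightarrow> \<tau>) \<cdot> Var (0, \<rho>)) (Var (2, \<rho> \<rightarrow> \<tau>) \<cdot> Var (1, \<rho>)))"
    using assms by (intro sat_axiom RCA0_omega.extensionality) (auto intro!: is_fm_eq)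
  then show ?thesis using assms by (simp add: sat_eq)
qed

lemma Std_cong:
  assumes "is_tm L a \<sigma>" "is_tm L b \<sigma>" "Q \<sigma> a b" "St \<sigma> a \<in> \<Delta>"
  shows "St \<sigma> b \<in> \<Delta>"
proof -
  let ?e = "Var((0, \<sigma>) := a, (1, \<sigma>) := b)"
  have "is_fm L (eq \<sigma> (Var (0, \<sigma>)) (Var (1, \<sigma>)) \<^bold>\<longrightarrow> St \<sigma> (Var (0, \<sigma>)) \<^bold>\<longrightarrow> St \<sigma> (Var (1, \<sigma>)))"
    using is_fm_eq[of L "Var (0, \<sigma>)" \<sigma> "Var (1, \<sigma>)"] by (simp add: is_fm_def)
  then have "sat term_model ?e [] (eq \<sigma> (Var (0, \<sigma>)) (Var (1, \<sigma>)) \<^bold>\<longrightarrow> St \<sigma> (Var (0, \<sigma>)) \<^bold>\<longrightarrow> St \<sigma> (Var (1, \<sigma>)))"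
    using valid_term_model[OF st_eq[of \<sigma>]] assms unfolding valid_def by (simp del: sat.simps)
  then show ?thesis using assms by (simp add: sat_eq)
qed

text \<open>Equality of sequences compares entries below the length of the left one. Symmetry and
  transitivity therefore have to move the bound from one length to an equal one.\<close>

lemma less_val_cong:
  assumes "is_tm L i Ty0" "is_tm L a Ty0" "is_tm L b Ty0" "(a \<approx> b) \<in> \<Delta>" "less_val term_model i a"
  shows "less_val term_model i b"
proof -
  let ?m = "ev term_model undefined [] monus_c \<cdot> suc i"
  have "ev term_model Var [] monus_c \<in> Dom term_model (Ty0 \<rightarrow> Ty0 \<rightarrow> Ty0)"
    by (rule typed.ev_Dom[OF typed_term_model]) (auto simp: is_tm_def)
  moreover have "ev term_model Var [] monus_c = ev term_model undefined [] monus_c" by (rule ev_closed) auto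
  ultimately have m: "is_tm L ?m Ty1" using assms by auto
  then have "Q Ty0 (?m \<cdot> b) (?m \<cdot> a)"
    using assms Eqv_sym by (intro Q_ext) auto
  then show ?thesis
    using assms m Eqv_trans[of "?m \<cdot> b" "?m \<cdot> a" zero] by (auto simp: less_val_def)
qed

lemma Q_refl: "is_tm L a \<sigma> \<Longrightarrow> Q \<sigma> a a"
proof (induction \<sigma> arbitrary: a)
  case (Fun \<sigma> \<tau>)
  have "is_tm L (a \<cdot> c) \<tau>" if "is_tm L c \<sigma>" for c using that Fun.prems by auto
  then show ?case using Fun.IH(2) by simp
next
  case (Seq \<sigma>)
  have "is_tm L (Const (Len \<sigma>) \<cdot> a) Ty0" using Seq.prems by simp
  moreover have "is_tm L (Const (Idx \<sigma>) \<cdot> a \<cdot> i) \<sigma>" if "is_tm L i Ty0" for i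
    using that Seq.prems by simp
  ultimately show ?case using Seq.IH Eqv_refl by simp
qed (simp add: Eqv_refl)

lemma Q_sym: "is_tm L a \<sigma> \<Longrightarrow> is_tm L b \<sigma> \<Longrightarrow> Q \<sigma> a b \<Longrightarrow> Q \<sigma> b a"
proof (induction \<sigma> arbitrary: a b)
  case (Seq \<sigma>)
  then show ?case
    using Eqv_sym[of "Const (Len \<sigma>) \<cdot> a" "Const (Len \<sigma>) \<cdot> b"]
      less_val_cong[of _ "Const (Len \<sigma>) \<cdot> b" "Const (Len \<sigma>) \<cdot> a"]
    by auto
next
  case (Fun \<sigma> \<tau>)
  show ?case
  proof (clarsimp)
    fix d assume "is_tm L d \<sigma>"
    then show "Q \<tau> (b \<cdot> d) (a \<cdot> d)"
      using Fun.prems by (intro Fun.IH(2)[of "a \<cdot> d" "b \<cdot> d"]) auto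
  qed
qed (auto intro: Eqv_sym)

lemma Q_trans:
  "is_tm L a \<sigma> \<Longrightarrow> is_tm L b \<sigma> \<Longrightarrow> is_tm L c \<sigma> \<Longrightarrow> Q \<sigma> a b \<Longrightarrow> Q \<sigma> b c \<Longrightarrow> Q \<sigma> a c"
proof (induction \<sigma> arbitrary: a b c)
  case Ty0
  then show ?case using Eqv_trans[of a b c] by simp
next
  case (Fun \<sigma> \<tau>)
  show ?case
  proof (clarsimp)
    fix d assume "is_tm L d \<sigma>"
    then show "Q \<tau> (a \<cdot> d) (c \<cdot> d)"
      using Fun.prems by (intro Fun.IH(2)[of "a \<cdot> d" "b \<cdot> d" "c \<cdot> d"]) auto
  qed
next
  case (Seq \<sigma>)
  have len: "is_tm L (Const (Len \<sigma>) \<cdot> x) Ty0" if "is_tm L x (Seq \<sigma>)" for x using that by simp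
  have idx: "is_tm L (Const (Idx \<sigma>) \<cdot> x \<cdot> i) \<sigma>" if "is_tm L x (Seq \<sigma>)" "is_tm L i Ty0" for x i
    using that by simp
  show ?case
    unfolding equal.simps
  proof (intro conjI ballI HOL.impI)
    show "Eqv term_model (Ap term_model (Cn term_model (Len \<sigma>)) a) (Ap term_model (Cn term_model (Len \<sigma>)) c)"
      using Seq.prems Eqv_trans[OF len len len, of a b c] by simp
  next
    fix i assume i: "i \<in> Dom term_model Ty0" "less_val term_model i (Ap term_model (Cn term_model (Len \<sigma>)) a)"
    then have "less_val term_model i (Const (Len \<sigma>) \<cdot> b)"
      using Seq.prems less_val_cong[OF _ len len, of i a b] by simp
    then show "Q \<sigma> (Ap term_model (Ap term_model (Cn term_model (Idx \<sigma>)) a) i) (Ap term_model (Ap term_model (Cn term_model (Idx \<sigma>)) c) i)"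
      using i Seq.prems Seq.IH[OF idx idx idx, of a i b i c i] by auto
  qed
qed

definition cls :: "tm \<Rightarrow> tm set" where
  "cls t = {s. \<exists>\<sigma>. is_tm L s \<sigma> \<and> is_tm L t \<sigma> \<and> Q \<sigma> s t}"

definition rp :: "tm set \<Rightarrow> tm" where
  "rp X = (SOME t. t \<in> X)"

lemma cls_eq_iff:
  assumes "is_tm L s \<sigma>" "is_tm L t \<sigma>"
  shows "cls s = cls t \<longleftrightarrow> Q \<sigma> s t"
proof
  assume "cls s = cls t"
  then have "s \<in> cls t" using Q_refl assms(1) by (auto simp: cls_def)
  then show "Q \<sigma> s t" using assms is_tm_unique by (auto simp: cls_def)
next
  assume st: "Q \<sigma> s t"
  then have ts: "Q \<sigma> t s" using assms Q_sym by blast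
  show "cls s = cls t"
    unfolding cls_def using assms is_tm_unique Q_trans[OF _ assms(1,2) _ st] Q_trans[OF _ assms(2,1) _ ts]
    by blast
qed

lemma rp_cls:
  assumes "is_tm L t \<sigma>"
  shows "is_tm L (rp (cls t)) \<sigma>" "Q \<sigma> (rp (cls t)) t"
proof -
  have "t \<in> cls t" using assms Q_refl by (auto simp: cls_def)
  then have "rp (cls t) \<in> cls t" unfolding rp_def by (rule someI)
  then show "is_tm L (rp (cls t)) \<sigma>" "Q \<sigma> (rp (cls t)) t"
    using assms is_tm_unique by (auto simp: cls_def)
qed

text \<open>Both application and standardness are read off representatives; \<open>Q_ext\<close> and
  \<open>Std_cong\<close> make the result independent of the choice.\<close>

definition quot_model :: "tm set interp" where
  "quot_model = \<lparr>Dom = \<lambda>\<sigma>. cls ` {t. is_tm L t \<sigma>}, Ap = \<lambda>X Y. cls (rp X \<cdot> rp Y), Cn = \<lambda>c. cls (Const c),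
     Eqv = (=), Std = \<lambda>\<sigma> X. St \<sigma> (rp X) \<in> \<Delta>\<rparr>"

lemma quot_model_simps:
  "Dom quot_model \<sigma> = cls ` {t. is_tm L t \<sigma>}" "Cn quot_model c = cls (Const c)" "Eqv quot_model = (=)"
  by (simp_all add: quot_model_def)

lemma Ap_quot_model:
  assumes "is_tm L f (\<sigma> \<rightarrow> \<tau>)" "is_tm L a \<sigma>"
  shows "Ap quot_model (cls f) (cls a) = cls (f \<cdot> a)"
proof -
  let ?f = "rp (cls f)" and ?a = "rp (cls a)"
  note rp = rp_cls[OF assms(1)] rp_cls[OF assms(2)]
  have "Q \<tau> (?f \<cdot> ?a) (f \<cdot> ?a)" using rp by simp
  moreover have "Q \<tau> (f \<cdot> ?a) (f \<cdot> a)" using rp assms by (intro Q_ext)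
  ultimately have "Q \<tau> (?f \<cdot> ?a) (f \<cdot> a)"
    using rp assms Q_trans[of "?f \<cdot> ?a" \<tau> "f \<cdot> ?a" "f \<cdot> a"] by auto
  moreover have "is_tm L (?f \<cdot> ?a) \<tau>" "is_tm L (f \<cdot> a) \<tau>" using rp assms by auto
  ultimately show ?thesis unfolding quot_model_def using cls_eq_iff by simp
qed

lemma Std_quot_model:
  assumes "is_tm L a \<sigma>"
  shows "Std quot_model \<sigma> (cls a) \<longleftrightarrow> St \<sigma> a \<in> \<Delta>"
  using rp_cls[OF assms] assms Std_cong Q_sym unfolding quot_model_def by auto

lemma typed_quot_model: "typed L quot_model"
proof
  fix f \<sigma> \<tau> a assume "f \<in> Dom quot_model (\<sigma> \<rightarrow> \<tau>)" "a \<in> Dom quot_model \<sigma>"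
  then obtain f' a' where "is_tm L f' (\<sigma> \<rightarrow> \<tau>)" "f = cls f'" "is_tm L a' \<sigma>" "a = cls a'"
    by (auto simp: quot_model_simps)
  moreover then have "is_tm L (f' \<cdot> a') \<tau>" by auto
  ultimately show "Ap quot_model f a \<in> Dom quot_model \<tau>" by (auto simp: quot_model_simps Ap_quot_model simp del: is_tm_App)
qed (auto simp: quot_model_simps)

lemma ev_quot_model:
  "type_of \<Gamma> t = Some \<sigma> \<Longrightarrow> xis_tm t \<subseteq> L \<Longrightarrow> good term_model e \<Longrightarrow> length bs = length \<Gamma> \<Longrightarrow>
    (\<And>i. i < length \<Gamma> \<Longrightarrow> is_tm L (bs ! i) (\<Gamma> ! i)) \<Longrightarrow>
    ev quot_model (\<lambda>v. cls (e v)) (map cls bs) t = cls (ev term_model e bs t)"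
proof (induction t arbitrary: \<sigma>)
  case (App s t)
  then obtain \<tau> where \<tau>: "type_of \<Gamma> s = Some (\<tau> \<rightarrow> \<sigma>)" "type_of \<Gamma> t = Some \<tau>" by auto
  have "is_tm L (ev term_model e bs s) (\<tau> \<rightarrow> \<sigma>)" "is_tm L (ev term_model e bs t) \<tau>"
    using typed.ev_Dom_list[OF typed_term_model \<tau>(1)] typed.ev_Dom_list[OF typed_term_model \<tau>(2)] App.prems by auto
  then show ?case using App \<tau> by (simp add: Ap_quot_model)
qed (auto simp: quot_model_simps split: if_splits)

lemma sat_quot_model:
  "wf_fm \<Gamma> A \<Longrightarrow> xis A \<subseteq> L \<Longrightarrow> good term_model e \<Longrightarrow> length bs = length \<Gamma> \<Longrightarrow>
    (\<And>i. i < length \<Gamma> \<Longrightarrow> is_tm L (bs ! i) (\<Gamma> ! i)) \<Longrightarrow>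
    sat quot_model (\<lambda>v. cls (e v)) (map cls bs) A \<longleftrightarrow> sat term_model e bs A"
proof (induction A arbitrary: \<Gamma> bs)
  case (Eq s t)
  have "is_tm L (ev term_model e bs s) Ty0" "is_tm L (ev term_model e bs t) Ty0"
    using typed.ev_Dom_list[OF typed_term_model, of \<Gamma> _ Ty0 e bs] Eq.prems by auto
  then show ?case using Eq.prems by (simp add: ev_quot_model[of \<Gamma>] quot_model_simps cls_eq_iff[of _ Ty0])
next
  case (St \<sigma> t)
  have "is_tm L (ev term_model e bs t) \<sigma>"
    using typed.ev_Dom_list[OF typed_term_model, of \<Gamma> _ \<sigma> e bs] St.prems by auto
  then show ?case using St.prems by (simp add: ev_quot_model[of \<Gamma>] Std_quot_model)
next
  case (All \<sigma> A)
  have "sat quot_model (\<lambda>v. cls (e v)) (cls t # map cls bs) A \<longleftrightarrow> sat term_model e (t # bs) A" if "is_tm L t \<sigma>" for t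
  proof -
    have "is_tm L ((t # bs) ! i) ((\<sigma> # \<Gamma>) ! i)" if "i < length (\<sigma> # \<Gamma>)" for i
      using that All.prems(5) \<open>is_tm L t \<sigma>\<close> by (cases i) auto
    then show ?thesis using All.prems All.IH[of "\<sigma> # \<Gamma>" "t # bs"] by simp
  qed
  then show ?case by (simp add: quot_model_simps)
next
  case (Imp A B)
  show ?case using Imp.IH[of \<Gamma> bs] Imp.prems by simp
qed simp

lemma good_quot_model:
  assumes "good quot_model e"
  obtains e' where "good term_model e'" "e = (\<lambda>v. cls (e' v))"
proof -
  have "\<forall>v. \<exists>t. is_tm L t (snd v) \<and> e v = cls t"
    using assms unfolding good_def quot_model_simps by blast
  then obtain e' where e': "\<And>v. is_tm L (e' v) (snd v) \<and> e v = cls (e' v)"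
    by metis
  then have "good term_model e'" "e = (\<lambda>v. cls (e' v))" by (auto simp: good_def simp del: split_paired_All)
  then show ?thesis by (rule that)
qed

lemma valid_quot_model:
  assumes "A \<in> T" "is_fm L A"
  shows "valid quot_model A"
  unfolding valid_def
proof (intro HOL.allI HOL.impI)
  fix e assume "good quot_model e"
  then obtain e' where "good term_model e'" "e = (\<lambda>v. cls (e' v))" by (rule good_quot_model)
  then show "sat quot_model e [] A"
    using sat_quot_model[of "[]" A e' "[]"] valid_term_model[OF assms] assms(2) by (auto simp: valid_def is_fm_def)
qed

lemma not_valid_quot_model:
  assumes "A \<notin> \<Delta>" "is_fm L A"
  shows "\<not> valid quot_model A"
proof -
  have "good quot_model (\<lambda>v. cls (Var v))" by (auto simp: good_def quot_model_simps)
  moreover have "\<not> sat quot_model (\<lambda>v. cls (Var v)) [] A"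
    using sat_quot_model[of "[]" A Var "[]"] truth_sentence[of A] assms by (auto simp: is_fm_def)
  ultimately show ?thesis unfolding valid_def by blast
qed

lemma extensional_quot_model:
  assumes "a \<in> Dom quot_model \<sigma>" "b \<in> Dom quot_model \<sigma>" "equal quot_model \<sigma> a b"
  shows "a = b"
proof -
  obtain s t where st: "is_tm L s \<sigma>" "a = cls s" "is_tm L t \<sigma>" "b = cls t"
    using assms by (auto simp: quot_model_simps)
  \<comment> \<open>Equality in the quotient is the truth of this formula, so it can be carried back
    to the term model like any other formula.\<close>
  let ?A = "eq \<sigma> (Bound 0) (Bound 1)"
  have "is_tm L ([s, t] ! i) ([\<sigma>, \<sigma>] ! i)" if "i < length [\<sigma>, \<sigma>]" for i
    using that st by (cases i) auto
  moreover have "wf_fm [\<sigma>, \<sigma>] ?A" by (rule wf_eq) auto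
  moreover have "xis ?A \<subseteq> L" using xis_eq[of \<sigma> "Bound 0" "Bound 1"] by simp
  ultimately have "sat quot_model (\<lambda>v. cls (Var v)) (map cls [s, t]) ?A \<longleftrightarrow> sat term_model Var [s, t] ?A"
    by (intro sat_quot_model) auto
  then have "Q \<sigma> s t" using assms(3) st by (simp add: sat_eq)
  then show ?thesis using st cls_eq_iff by blast
qed

end

locale extensional = typed +
  assumes Eqv: "Eqv M = (=)"
    and extensional: "a \<in> Dom M \<sigma> \<Longrightarrow> b \<in> Dom M \<sigma> \<Longrightarrow> equal M \<sigma> a b \<Longrightarrow> a = b"
    and inhabited: "Dom M \<sigma> \<noteq> {}"

text \<open>The semantic premise concerns the single carrier \<open>tm set\<close>, the one produced
  by the quotient of the term model, since a premise cannot range over all carrier types.\<close>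

theorem completeness:
  assumes "RCA0_omega L \<subseteq> T"
    and "\<And>\<sigma>. (eq \<sigma> (Var (0, \<sigma>)) (Var (1, \<sigma>)) \<^bold>\<longrightarrow> St \<sigma> (Var (0, \<sigma>)) \<^bold>\<longrightarrow> St \<sigma> (Var (1, \<sigma>))) \<in> T"
    and G: "is_fm L G"
    and sound: "\<And>M :: tm set interp. extensional L M \<Longrightarrow> (\<And>A. A \<in> T \<Longrightarrow> is_fm L A \<Longrightarrow> valid M A) \<Longrightarrow> valid M G"
  shows "provable L T G"
proof (rule ccontr)
  assume "\<not> provable L T G"
  then obtain \<Delta> where \<Delta>: "henkin L T \<Delta>" "G \<notin> \<Delta>"
    using calculus.ex_henkin G unfolding provable_def by blast
  interpret henkin L T \<Delta> by (fact \<Delta>)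
  interpret theory_model L T \<Delta> by unfold_locales (fact assms)+
  have "extensional L quot_model"
  proof (intro extensional.intro extensional_axioms.intro typed_quot_model extensional_quot_model)
    show "Dom quot_model \<sigma> \<noteq> {}" for \<sigma> using is_tm_Var[of L "(0, \<sigma>)" \<sigma>] by (auto simp: quot_model_simps simp del: is_tm_Var)
  qed (auto simp: quot_model_simps)
  then have "valid quot_model G" using sound valid_quot_model by blast
  then show False using not_valid_quot_model \<Delta>(2) G by blast
qed

section \<open>Combinators and quantifier-free induction\<close>

locale base_model = extensional +
  assumes valid_base: "A \<in> RCA0_omega L \<Longrightarrow> is_fm L A \<Longrightarrow> valid M A"
begin

abbreviation app (infixl \<open>\<star>\<close> 200) where "f \<star> x \<equiv> Ap M f x"
abbreviation "N \<equiv> Dom M Ty0"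
abbreviation Z where "Z \<equiv> Cn M Zero"
abbreviation S where "S n \<equiv> Cn M Succ \<star> n"

declare Eqv [simp]

lemma equal_refl: "equal M \<sigma> a a"
  by (induction \<sigma> arbitrary: a) auto

lemma equal_iff: "a \<in> Dom M \<sigma> \<Longrightarrow> b \<in> Dom M \<sigma> \<Longrightarrow> equal M \<sigma> a b \<longleftrightarrow> a = b"
  using extensional equal_refl by blast

lemma fun_eqI:
  assumes "f \<in> Dom M (\<sigma> \<rightarrow> \<tau>)" "g \<in> Dom M (\<sigma> \<rightarrow> \<tau>)" "\<And>a. a \<in> Dom M \<sigma> \<Longrightarrow> f \<star> a = g \<star> a"
  shows "f = g"
  by (rule extensional[OF assms(1,2)]) (simp add: assms(3) equal_refl)

definition e0 :: "var \<Rightarrow> 'a" where "e0 v = (SOME a. a \<in> Dom M (snd v))"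

lemma good_e0 [simp]: "good M e0"
  unfolding good_def e0_def using inhabited by (metis some_in_eq)

lemma sat_base: "A \<in> RCA0_omega L \<Longrightarrow> is_fm L A \<Longrightarrow> good M e \<Longrightarrow> sat M e [] A"
  using valid_base by (auto simp: valid_def)

lemma const_Dom:
  "Z \<in> N" "Cn M Succ \<in> Dom M Ty1" "Cn M Rec \<in> Dom M (Ty0 \<rightarrow> Ty0 \<rightarrow> (Ty0 \<rightarrow> Ty0 \<rightarrow> Ty0) \<rightarrow> Ty0)"
  "Cn M (KC \<rho> \<tau>) \<in> Dom M (\<rho> \<rightarrow> \<tau> \<rightarrow> \<rho>)"
  "Cn M (SC \<sigma> \<rho> \<tau>) \<in> Dom M ((\<sigma> \<rightarrow> \<rho> \<rightarrow> \<tau>) \<rightarrow> (\<sigma> \<rightarrow> \<rho>) \<rightarrow> \<sigma> \<rightarrow> \<tau>)"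
  "Cn M (Len \<sigma>) \<in> Dom M (Seq \<sigma> \<rightarrow> Ty0)" "Cn M (Idx \<sigma>) \<in> Dom M (Seq \<sigma> \<rightarrow> Ty0 \<rightarrow> \<sigma>)"
  using Cn_Dom[of Zero] Cn_Dom[of Succ] Cn_Dom[of Rec] Cn_Dom[of "KC \<rho> \<tau>"] Cn_Dom[of "SC \<sigma> \<rho> \<tau>"]
    Cn_Dom[of "Len \<sigma>"] Cn_Dom[of "Idx \<sigma>"]
  by simp_all

lemma Z_N [simp]: "Z \<in> N" by (rule const_Dom)
lemma app_N [simp]: "f \<in> Dom M Ty1 \<Longrightarrow> x \<in> N \<Longrightarrow> f \<star> x \<in> N" by (rule Ap_Dom)
lemma S_N [simp]: "n \<in> N \<Longrightarrow> S n \<in> N" using const_Dom(2) by simp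

lemma K_eq [simp]:
  assumes "a \<in> Dom M \<rho>" "b \<in> Dom M \<tau>"
  shows "Cn M (KC \<rho> \<tau>) \<star> a \<star> b = a"
proof -
  have "sat M (e0((0, \<rho>) := a, (1, \<tau>) := b)) [] (eq \<rho> (Const (KC \<rho> \<tau>) \<cdot> Var (0, \<rho>) \<cdot> Var (1, \<tau>)) (Var (0, \<rho>)))"
    using assms by (intro sat_base RCA0_omega.K is_fm_eq) auto
  moreover have "Cn M (KC \<rho> \<tau>) \<star> a \<star> b \<in> Dom M \<rho>"
    using assms const_Dom(4) by (blast intro: Ap_Dom)
  ultimately show ?thesis using assms by (simp add: sat_eq equal_iff)
qed

lemma S_eq [simp]:
  assumes "f \<in> Dom M (\<sigma> \<rightarrow> \<rho> \<rightarrow> \<tau>)" "g \<in> Dom M (\<sigma> \<rightarrow> \<rho>)" "a \<in> Dom M \<sigma>"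
  shows "Cn M (SC \<sigma> \<rho> \<tau>) \<star> f \<star> g \<star> a = f \<star> a \<star> (g \<star> a)"
proof -
  let ?e = "e0((0, \<sigma> \<rightarrow> \<rho> \<rightarrow> \<tau>) := f, (1, \<sigma> \<rightarrow> \<rho>) := g, (2, \<sigma>) := a)"
  have "sat M ?e [] (eq \<tau> (Const (SC \<sigma> \<rho> \<tau>) \<cdot> Var (0, \<sigma> \<rightarrow> \<rho> \<rightarrow> \<tau>) \<cdot> Var (1, \<sigma> \<rightarrow> \<rho>) \<cdot> Var (2, \<sigma>))
      (Var (0, \<sigma> \<rightarrow> \<rho> \<rightarrow> \<tau>) \<cdot> Var (2, \<sigma>) \<cdot> (Var (1, \<sigma> \<rightarrow> \<rho>) \<cdot> Var (2, \<sigma>))))"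
    using assms by (intro sat_base RCA0_omega.S is_fm_eq) auto
  moreover have "Cn M (SC \<sigma> \<rho> \<tau>) \<star> f \<star> g \<star> a \<in> Dom M \<tau>" "f \<star> a \<star> (g \<star> a) \<in> Dom M \<tau>"
    using assms const_Dom(5) by (blast intro: Ap_Dom)+
  ultimately show ?thesis using assms by (simp add: sat_eq equal_iff)
qed

lemma Rec_Z:
  assumes "a \<in> N" "h \<in> Dom M (Ty0 \<rightarrow> Ty0 \<rightarrow> Ty0)"
  shows "Cn M Rec \<star> Z \<star> a \<star> h = a"
  using sat_base[OF RCA0_omega.rec_zero, of "e0(yv := a, (0, Ty0 \<rightarrow> Ty0 \<rightarrow> Ty0) := h)"] assms
  by (simp add: is_fm_def)

lemma Rec_S:
  assumes "n \<in> N" "a \<in> N" "h \<in> Dom M (Ty0 \<rightarrow> Ty0 \<rightarrow> Ty0)"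
  shows "Cn M Rec \<star> S n \<star> a \<star> h = h \<star> (Cn M Rec \<star> n \<star> a \<star> h) \<star> n"
  using sat_base[OF RCA0_omega.rec_suc, of "e0(xv := n, yv := a, (0, Ty0 \<rightarrow> Ty0 \<rightarrow> Ty0) := h)"] assms
  by (simp add: is_fm_def)

lemma S_neq_Z [simp]:
  assumes "n \<in> N"
  shows "S n \<noteq> Z" "Z \<noteq> S n"
  using sat_base[OF RCA0_omega.suc_nonzero, of "e0(xv := n)"] assms by (auto simp: is_fm_def)

lemma S_inject [simp]:
  assumes "m \<in> N" "n \<in> N"
  shows "S m = S n \<longleftrightarrow> m = n"
  using sat_base[OF RCA0_omega.suc_inject, of "e0(xv := m, yv := n)"] assms by (auto simp: is_fm_def)

lemma ev_in_Dom:
  "good M e \<Longrightarrow> type_of [] t = Some \<sigma> \<Longrightarrow> xis_tm t \<subseteq> L \<Longrightarrow> ev M e [] t \<in> Dom M \<sigma>"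
  by (rule ev_Dom) (auto simp: is_tm_def)

text \<open>The beta rule for bracket abstraction: the combination \<open>S K K\<close> stands for
  the abstracted variable, \<open>K\<close> absorbs parts that do not contain it, and
  \<open>S\<close> distributes over application.\<close>

lemma app_lam:
  assumes "good M e" "type_of [] t \<noteq> None" "xis_tm t \<subseteq> L" "a \<in> Dom M (snd v)"
  shows "ev M e [] (lam v t) \<star> a = ev M (e(v := a)) [] t"
  using assms(2,3)
proof (induction t)
  case (Var w)
  show ?case
  proof (cases "w = v")
    case True
    have "Cn M (KC (snd v) \<tau>) \<star> a \<in> Dom M (\<tau> \<rightarrow> snd v)" for \<tau>
      using assms(4) const_Dom(4) by (blast intro: Ap_Dom)
    moreover have "Cn M (KC (snd v) (snd v)) \<in> Dom M (snd v \<rightarrow> snd v \<rightarrow> snd v)"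
      "Cn M (KC (snd v) (snd v \<rightarrow> snd v)) \<in> Dom M (snd v \<rightarrow> (snd v \<rightarrow> snd v) \<rightarrow> snd v)"
      by (rule const_Dom)+
    ultimately show ?thesis using True assms by simp
  next
    case False
    moreover have "e w \<in> Dom M (snd w)" using assms(1) unfolding good_def by blast
    ultimately show ?thesis using assms by simp
  qed
next
  case (Const c)
  then show ?case using assms(4) Cn_Dom[of c] by simp
next
  case (App s t)
  then obtain \<sigma> \<tau> where ty: "type_of [] s = Some (\<sigma> \<rightarrow> \<tau>)" "type_of [] t = Some \<sigma>" "type_of [] (s \<cdot> t) = Some \<tau>"
    by auto
  have xis: "xis_tm s \<subseteq> L" "xis_tm t \<subseteq> L" using App.prems by auto
  have the: "the (type_of [] (s \<cdot> t)) = \<tau>" unfolding ty(3) by simp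
  show ?case
  proof (cases "v \<in> fv_tm (s \<cdot> t)")
    case False
    have "ev M e [] (s \<cdot> t) \<in> Dom M \<tau>" using ty(3) App.prems assms by (intro ev_in_Dom)
    then have "ev M e [] (lam v (s \<cdot> t)) \<star> a = ev M e [] (s \<cdot> t)"
      using False the assms(4) by simp
    also have "\<dots> = ev M (e(v := a)) [] (s \<cdot> t)" using False by (intro ev_cong) auto
    finally show ?thesis .
  next
    case True
    have "ev M e [] (lam v s) \<in> Dom M (snd v \<rightarrow> \<sigma> \<rightarrow> \<tau>)" "ev M e [] (lam v t) \<in> Dom M (snd v \<rightarrow> \<sigma>)"
      using ty xis assms(1) by (auto intro!: ev_in_Dom)
    then show ?thesis using True ty(1,2) the xis App.IH assms by simp
  qed
qed simp

declare lam.simps [simp del]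

section \<open>Representable functions and quantifier-free predicates\<close>

definition rep :: "ty \<Rightarrow> ty \<Rightarrow> ('a \<Rightarrow> 'a) \<Rightarrow> bool" where
  "rep \<sigma> \<tau> F \<longleftrightarrow> (\<exists>h\<in>Dom M (\<sigma> \<rightarrow> \<tau>). \<forall>x\<in>Dom M \<sigma>. h \<star> x = F x)"

lemma rep_const: "c \<in> Dom M \<tau> \<Longrightarrow> rep \<sigma> \<tau> (\<lambda>x. c)"
  unfolding rep_def using Ap_Dom[OF const_Dom(4)] K_eq by blast

lemma rep_id: "rep \<sigma> \<sigma> (\<lambda>x. x)"
proof -
  let ?h = "ev M e0 [] (lam (0, \<sigma>) (Var (0, \<sigma>)))"
  have "?h \<in> Dom M (\<sigma> \<rightarrow> \<sigma>)" by (rule ev_in_Dom) auto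
  moreover have "?h \<star> x = x" if "x \<in> Dom M \<sigma>" for x
    using app_lam[of e0 "Var (0, \<sigma>)" x "(0, \<sigma>)"] that by simp
  ultimately show ?thesis unfolding rep_def by blast
qed

lemma rep_app:
  assumes "rep \<sigma> (\<rho> \<rightarrow> \<tau>) F" "rep \<sigma> \<rho> G"
  shows "rep \<sigma> \<tau> (\<lambda>x. F x \<star> G x)"
proof -
  obtain f g where fg: "f \<in> Dom M (\<sigma> \<rightarrow> \<rho> \<rightarrow> \<tau>)" "g \<in> Dom M (\<sigma> \<rightarrow> \<rho>)"
    "\<And>x. x \<in> Dom M \<sigma> \<Longrightarrow> f \<star> x = F x" "\<And>x. x \<in> Dom M \<sigma> \<Longrightarrow> g \<star> x = G x"
    using assms unfolding rep_def by blast
  have "Cn M (SC \<sigma> \<rho> \<tau>) \<star> f \<star> g \<in> Dom M (\<sigma> \<rightarrow> \<tau>)"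
    using fg(1,2) const_Dom(5) by (blast intro: Ap_Dom)
  moreover have "Cn M (SC \<sigma> \<rho> \<tau>) \<star> f \<star> g \<star> x = F x \<star> G x" if "x \<in> Dom M \<sigma>" for x
    using fg that by simp
  ultimately show ?thesis unfolding rep_def by blast
qed

text \<open>The predicates on the numbers of the model for which the model has induction. Parameters
  need no separate treatment: a term with parameters is a represented function of the
  number.\<close>

inductive QF :: "('a \<Rightarrow> bool) \<Rightarrow> bool" where
  QF_eq: "rep Ty0 Ty0 F \<Longrightarrow> rep Ty0 Ty0 G \<Longrightarrow> QF (\<lambda>n. F n = G n)"
| QF_False: "QF (\<lambda>n. False)"
| QF_imp: "QF P \<Longrightarrow> QF Q \<Longrightarrow> QF (\<lambda>n. P n \<longrightarrow> Q n)"

lemma QF_not: "QF P \<Longrightarrow> QF (\<lambda>n. \<not> P n)"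
  using QF_imp[OF _ QF_False] by simp

lemma QF_disj: "QF P \<Longrightarrow> QF Q \<Longrightarrow> QF (\<lambda>n. P n \<or> Q n)"
  using QF_imp[OF QF_not, of P Q] by (simp add: disj_imp)

lemma QF_conj: "QF P \<Longrightarrow> QF Q \<Longrightarrow> QF (\<lambda>n. P n \<and> Q n)"
  using QF_not[OF QF_imp[OF _ QF_not], of P Q] by simp

lemmas QF_intros = QF_not QF_conj QF_disj QF_imp QF_eq rep_const rep_id rep_app

text \<open>Each represented function becomes a parameter variable of type 1. The numbers of these
  variables are confined to an interval from \<open>k\<close> to \<open>k'\<close>, so that two
  formulas can be given disjoint parameters and joined by an implication.\<close>

lemma QF_formula:
  assumes "QF P"
  shows "\<exists>A k' e. k \<le> k' \<and> qfree A \<and> is_fm L A \<and> good M e \<and> fv A \<subseteq> insert xv {(i, Ty1) |i. k \<le> i \<and> i < k'} \<and>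
    (\<forall>n\<in>N. P n \<longleftrightarrow> sat M (e(xv := n)) [] A)"
  using assms
proof (induction arbitrary: k)
  case (QF_eq F G)
  then obtain f g where fg: "f \<in> Dom M Ty1" "g \<in> Dom M Ty1" "\<And>x. x \<in> N \<Longrightarrow> f \<star> x = F x" "\<And>x. x \<in> N \<Longrightarrow> g \<star> x = G x"
    unfolding rep_def by blast
  let ?A = "Var (k, Ty1) \<cdot> Var xv \<approx> Var (Suc k, Ty1) \<cdot> Var xv"
  define e where "e = e0((k, Ty1) := f, (Suc k, Ty1) := g)"
  have "good M e" "e (k, Ty1) = f" "e (Suc k, Ty1) = g" using fg by (simp_all add: e_def)
  then show ?case
    by (intro exI[of _ ?A] exI[of _ "Suc (Suc k)"] exI[of _ e]) (use fg in \<open>auto simp: is_fm_def\<close>)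
next
  case QF_False
  show ?case
    by (rule exI[of _ Bot], rule exI[of _ k], rule exI[of _ e0]) auto
next
  case (QF_imp P Q)
  obtain A k1 e where A: "k \<le> k1" "qfree A" "is_fm L A" "good M e"
    "fv A \<subseteq> insert xv {(i, Ty1) |i. k \<le> i \<and> i < k1}" "\<forall>n\<in>N. P n \<longleftrightarrow> sat M (e(xv := n)) [] A"
    using QF_imp.IH(1)[of k] by blast
  obtain B k2 e' where B: "k1 \<le> k2" "qfree B" "is_fm L B" "good M e'"
    "fv B \<subseteq> insert xv {(i, Ty1) |i. k1 \<le> i \<and> i < k2}" "\<forall>n\<in>N. Q n \<longleftrightarrow> sat M (e'(xv := n)) [] B"
    using QF_imp.IH(2)[of k1] by blast
  \<comment> \<open>The intervals meet at \<open>k1\<close>, so both assignments survive in the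
    merged one; the common variable \<open>xv\<close> is overwritten anyway.\<close>
  define e'' where "e'' = (\<lambda>v. if fst v < k1 then e v else e' v)"
  have "sat M (e''(xv := n)) [] A \<longleftrightarrow> sat M (e(xv := n)) [] A" for n
    using A(5) by (intro sat_cong) (auto simp: e''_def)
  moreover have "sat M (e''(xv := n)) [] B \<longleftrightarrow> sat M (e'(xv := n)) [] B" for n
    using B(5) by (intro sat_cong) (auto simp: e''_def)
  moreover have "good M e''" using A(4) B(4) unfolding good_def e''_def by auto
  moreover have "fv (A \<^bold>\<longrightarrow> B) \<subseteq> insert xv {(i, Ty1) |i. k \<le> i \<and> i < k2}" using A(1,5) B(1,5) by fastforce
  moreover have "\<forall>n\<in>N. (P n \<longrightarrow> Q n) \<longleftrightarrow> sat M (e''(xv := n)) [] (A \<^bold>\<longrightarrow> B)"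
    using calculation(1,2) A(6) B(6) by (simp del: fun_upd_apply)
  moreover have "k \<le> k2" "qfree (A \<^bold>\<longrightarrow> B)" "is_fm L (A \<^bold>\<longrightarrow> B)" using A B by auto
  ultimately show ?case by blast
qed

lemma N_induct [consumes 1, case_names QF zero suc]:
  assumes "n \<in> N" "QF P" "P Z" "\<And>n. n \<in> N \<Longrightarrow> P n \<Longrightarrow> P (S n)"
  shows "P n"
proof -
  obtain A k e where A: "qfree A" "is_fm L A" "good M e" "\<And>n. n \<in> N \<Longrightarrow> P n \<longleftrightarrow> sat M (e(xv := n)) [] A"
    using QF_formula[OF assms(2), of 0] by blast
  let ?I = "subst xv zero A \<^bold>\<longrightarrow> all xv (A \<^bold>\<longrightarrow> subst xv (suc (Var xv)) A) \<^bold>\<longrightarrow> all xv A"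
  have wf: "wf_fm [] A" using A(2) by (simp add: is_fm_def)
  have fm: "is_fm L (subst xv t A)" if "is_tm L t Ty0" for t
    using is_fm_inst[OF _ that] is_fm_All_close[OF A(2), of xv] by (simp add: subst_def)
  have "is_fm L ?I" using A(2) fm by simp
  then have "sat M e [] ?I" using A by (intro sat_base RCA0_omega.QF_induction) auto
  moreover have wf': "wf_fm [] (subst xv (suc (Var xv)) A)" using fm[of "suc (Var xv)"] by (simp add: is_fm_def)
  ultimately have "sat M (e(xv := Z)) [] A \<Longrightarrow>
      (\<And>n. n \<in> N \<Longrightarrow> sat M (e(xv := n)) [] A \<Longrightarrow> sat M (e(xv := S n)) [] A) \<Longrightarrow> sat M (e(xv := n)) [] A"
    using wf assms(1) by (simp add: sat_subst)
  then show ?thesis using A(4) assms by simp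
qed

text \<open>\<open>w\<close> is kept apart from \<open>uv\<close>, \<open>vv\<close> and the
  variables of \<open>a\<close> and \<open>b\<close>: assigning the number of steps then changes
  neither the start nor the step of the recursion.\<close>

lemma rec_eqs:
  assumes "good M e" "snd w = Ty0" "w \<noteq> uv" "w \<noteq> vv" "w \<notin> fv_tm a" "w \<notin> fv_tm b"
    "type_of [] a = Some Ty0" "type_of [] b = Some Ty0" "xis_tm a \<subseteq> L" "xis_tm b \<subseteq> L"
  shows "ev M e [] (lam w (rec (Var w) a b)) \<star> Z = ev M e [] a" (is "?h \<star> Z = _")
    and "n \<in> N \<Longrightarrow> ev M e [] (lam w (rec (Var w) a b)) \<star> S n =
      ev M (e(uv := ev M e [] (lam w (rec (Var w) a b)) \<star> n, vv := n)) [] b"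
proof -
  let ?b = "lam uv (lam vv b)"
  let ?h = "ev M e [] (lam w (rec (Var w) a b))"
  have a: "ev M e [] a \<in> N" using assms by (intro ev_in_Dom)
  have b: "ev M e [] ?b \<in> Dom M (Ty0 \<rightarrow> Ty0 \<rightarrow> Ty0)" using assms by (intro ev_in_Dom) auto
  have h: "?h \<star> n = Cn M Rec \<star> n \<star> ev M e [] a \<star> ev M e [] ?b" if "n \<in> N" for n
  proof -
    have "?h \<star> n = ev M (e(w := n)) [] (rec (Var w) a b)"
      using assms that by (intro app_lam) auto
    also have "\<dots> = Cn M Rec \<star> n \<star> ev M (e(w := n)) [] a \<star> ev M (e(w := n)) [] ?b"
      by (simp add: rec_def)
    also have "ev M (e(w := n)) [] a = ev M e [] a" using assms by (intro ev_cong) auto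
    also have "ev M (e(w := n)) [] ?b = ev M e [] ?b" using assms by (intro ev_cong) auto
    finally show ?thesis .
  qed
  have hN: "?h \<star> n \<in> N" if "n \<in> N" for n
    unfolding h[OF that] using const_Dom(3) a b that by (blast intro: Ap_Dom)
  show "?h \<star> Z = ev M e [] a" using h a b Rec_Z by simp
  assume n: "n \<in> N"
  have "?h \<star> S n = ev M e [] ?b \<star> (?h \<star> n) \<star> n" using h a b Rec_S n by simp
  also have "\<dots> = ev M (e(uv := ?h \<star> n)) [] (lam vv b) \<star> n"
    using assms hN n by (subst app_lam) auto
  also have "\<dots> = ev M (e(uv := ?h \<star> n, vv := n)) [] b"
    using assms hN n by (subst app_lam) auto
  finally show "?h \<star> S n = ev M (e(uv := ?h \<star> n, vv := n)) [] b" .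
qed


section \<open>Arithmetic\<close>

definition "predE = ev M e0 [] pred_c"
definition "monusE = ev M e0 [] monus_c"
definition "plusE = ev M e0 [] plus_c"
definition "sgE = ev M e0 [] sg_c"
definition "condE = ev M e0 [] cond_c"
definition "triE = ev M e0 [] tri_c"
definition "pairE = ev M e0 [] pair_c"
definition "rootE = ev M e0 [] root_c"
definition "psndE = ev M e0 [] psnd_c"
definition "pfstE = ev M e0 [] pfst_c"
definition "barE = ev M e0 [] bar_c"
definition "dropE = ev M e0 [] drop_c"
definition "lhE = ev M e0 [] lh_c"
definition "nthE = ev M e0 [] nth_c"
definition "initE = ev M e0 [] init_c"

lemmas E_defs = predE_def monusE_def plusE_def sgE_def condE_def triE_def pairE_def rootE_def
  psndE_def pfstE_def barE_def dropE_def lhE_def nthE_def initE_def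

lemma ev_E [simp]:
  "ev M e bs pred_c = predE" "ev M e bs monus_c = monusE" "ev M e bs plus_c = plusE"
  "ev M e bs sg_c = sgE" "ev M e bs cond_c = condE" "ev M e bs tri_c = triE"
  "ev M e bs pair_c = pairE" "ev M e bs root_c = rootE" "ev M e bs psnd_c = psndE"
  "ev M e bs pfst_c = pfstE" "ev M e bs bar_c = barE" "ev M e bs drop_c = dropE"
  "ev M e bs lh_c = lhE" "ev M e bs nth_c = nthE" "ev M e bs init_c = initE"
  unfolding E_defs by (rule ev_closed; simp)+

lemma E_Dom [simp]:
  "predE \<in> Dom M Ty1" "sgE \<in> Dom M Ty1" "triE \<in> Dom M Ty1" "rootE \<in> Dom M Ty1"
  "psndE \<in> Dom M Ty1" "pfstE \<in> Dom M Ty1" "lhE \<in> Dom M Ty1"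
  "monusE \<in> Dom M (Ty0 \<rightarrow> Ty0 \<rightarrow> Ty0)" "plusE \<in> Dom M (Ty0 \<rightarrow> Ty0 \<rightarrow> Ty0)"
  "pairE \<in> Dom M (Ty0 \<rightarrow> Ty0 \<rightarrow> Ty0)" "dropE \<in> Dom M (Ty0 \<rightarrow> Ty0 \<rightarrow> Ty0)"
  "nthE \<in> Dom M (Ty0 \<rightarrow> Ty0 \<rightarrow> Ty0)" "initE \<in> Dom M (Ty0 \<rightarrow> Ty0 \<rightarrow> Ty0)"
  "condE \<in> Dom M (Ty0 \<rightarrow> Ty0 \<rightarrow> Ty0 \<rightarrow> Ty0)" "barE \<in> Dom M (Ty1 \<rightarrow> Ty0 \<rightarrow> Ty0)"
  unfolding E_defs by (rule ev_in_Dom; simp)+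

lemma app2_Dom [simp]:
  "f \<in> Dom M (Ty0 \<rightarrow> Ty0 \<rightarrow> Ty0) \<Longrightarrow> x \<in> N \<Longrightarrow> f \<star> x \<in> Dom M Ty1"
  "f \<in> Dom M (Ty0 \<rightarrow> Ty0 \<rightarrow> Ty0 \<rightarrow> Ty0) \<Longrightarrow> x \<in> N \<Longrightarrow> f \<star> x \<in> Dom M (Ty0 \<rightarrow> Ty0 \<rightarrow> Ty0)"
  "f \<in> Dom M (Ty1 \<rightarrow> Ty0 \<rightarrow> Ty0) \<Longrightarrow> g \<in> Dom M Ty1 \<Longrightarrow> f \<star> g \<in> Dom M Ty1"
  by (blast intro: Ap_Dom)+

abbreviation plus (infixl \<open>\<oplus>\<close> 65) where "x \<oplus> y \<equiv> plusE \<star> x \<star> y"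
abbreviation monus (infixl \<open>\<ominus>\<close> 65) where "x \<ominus> y \<equiv> monusE \<star> x \<star> y"
abbreviation leq (infix \<open>\<sqsubseteq>\<close> 50) where "x \<sqsubseteq> y \<equiv> x \<ominus> y = Z"
abbreviation lt (infix \<open>\<sqsubset>\<close> 50) where "x \<sqsubset> y \<equiv> S x \<sqsubseteq> y"

lemma pred_Z [simp]: "predE \<star> Z = Z"
  and pred_S [simp]: "n \<in> N \<Longrightarrow> predE \<star> S n = n"
  using rec_eqs[of e0 xv zero "Var vv"] unfolding predE_def pred_c_def by auto

lemma sg_Z [simp]: "sgE \<star> Z = Z"
  and sg_S [simp]: "n \<in> N \<Longrightarrow> sgE \<star> S n = S Z"
  using rec_eqs[of e0 xv zero one] unfolding sgE_def sg_c_def by auto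

lemma plus_Z [simp]: "x \<in> N \<Longrightarrow> x \<oplus> Z = x"
  and plus_S [simp]: "x \<in> N \<Longrightarrow> n \<in> N \<Longrightarrow> x \<oplus> S n = S (x \<oplus> n)"
  using app_lam[of e0 "lam yv (rec (Var yv) (Var xv) (suc (Var uv)))" x xv]
    rec_eqs[of "e0(xv := x)" yv "Var xv" "suc (Var uv)"]
  unfolding plusE_def plus_c_def by auto

lemma monus_Z [simp]: "x \<in> N \<Longrightarrow> x \<ominus> Z = x"
  and monus_S: "x \<in> N \<Longrightarrow> n \<in> N \<Longrightarrow> x \<ominus> S n = predE \<star> (x \<ominus> n)"
  using app_lam[of e0 "lam yv (rec (Var yv) (Var xv) (pred_c \<cdot> Var uv))" x xv]
    rec_eqs[of "e0(xv := x)" yv "Var xv" "pred_c \<cdot> Var uv"]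
  unfolding monusE_def monus_c_def by auto

lemma tri_Z [simp]: "triE \<star> Z = Z"
  and tri_S [simp]: "n \<in> N \<Longrightarrow> triE \<star> S n = triE \<star> n \<oplus> S n"
  using rec_eqs[of e0 xv zero "plus_c \<cdot> Var uv \<cdot> suc (Var vv)"] unfolding triE_def tri_c_def by auto

lemma cond_eq:
  assumes "z \<in> N" "x \<in> N" "y \<in> N"
  shows "condE \<star> z \<star> x \<star> y = ev M (e0((4, Ty0) := z, xv := x, yv := y)) [] (rec (Var (4, Ty0)) (Var xv) (Var yv))"
proof -
  let ?t = "rec (Var (4, Ty0)) (Var xv) (Var yv)"
  have "condE \<star> z = ev M (e0((4, Ty0) := z)) [] (lam xv (lam yv ?t))"
    unfolding condE_def cond_c_def using assms by (intro app_lam) auto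
  moreover have "ev M (e0((4, Ty0) := z)) [] (lam xv (lam yv ?t)) \<star> x =
      ev M (e0((4, Ty0) := z, xv := x)) [] (lam yv ?t)"
    using assms by (intro app_lam) auto
  moreover have "ev M (e0((4, Ty0) := z, xv := x)) [] (lam yv ?t) \<star> y =
      ev M (e0((4, Ty0) := z, xv := x, yv := y)) [] ?t"
    using assms by (intro app_lam) auto
  ultimately show ?thesis by simp
qed

lemma cond_Z [simp]:
  assumes "x \<in> N" "y \<in> N"
  shows "condE \<star> Z \<star> x \<star> y = x"
proof -
  have "ev M (e0((4, Ty0) := Z, xv := x, yv := y)) [] (lam uv (lam vv (Var yv))) \<in> Dom M (Ty0 \<rightarrow> Ty0 \<rightarrow> Ty0)"
    using assms by (intro ev_in_Dom) auto
  then show ?thesis using assms by (simp add: cond_eq rec_def Rec_Z)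
qed

lemma cond_S [simp]:
  assumes "z \<in> N" "x \<in> N" "y \<in> N"
  shows "condE \<star> S z \<star> x \<star> y = y"
proof -
  let ?e = "e0((4, Ty0) := S z, xv := x, yv := y)"
  let ?h = "ev M ?e [] (lam uv (lam vv (Var yv)))"
  have h: "?h \<in> Dom M (Ty0 \<rightarrow> Ty0 \<rightarrow> Ty0)"
    using assms by (intro ev_in_Dom) auto
  have r: "Cn M Rec \<star> z \<star> x \<star> ?h \<in> N" (is "?r \<in> N")
    using const_Dom(3) assms h by (blast intro: Ap_Dom)
  have "condE \<star> S z \<star> x \<star> y = Cn M Rec \<star> S z \<star> x \<star> ?h"
    using assms by (simp add: cond_eq rec_def)
  also have "\<dots> = ?h \<star> ?r \<star> z" using assms h by (intro Rec_S)
  also have "?h \<star> ?r = ev M (?e(uv := ?r)) [] (lam vv (Var yv))"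
    using assms r by (intro app_lam) auto
  also have "\<dots> \<star> z = ev M (?e(uv := ?r, vv := z)) [] (Var yv)"
    using assms r by (intro app_lam) auto
  finally show ?thesis by simp
qed


text \<open>Backward application of these rules proves an induction predicate quantifier-free by its
  shape alone.\<close>

lemmas qf = QF_intros E_Dom const_Dom

lemma N_cases:
  assumes "n \<in> N"
  obtains "n = Z" | m where "m \<in> N" "n = S m"
proof -
  \<comment> \<open>The predecessor is named by a term, because a predicate with an existential
    quantifier would not be open to induction.\<close>
  from assms have "n = Z \<or> n = S (predE \<star> n)"
  proof (induction n rule: N_induct)
    case QF
    show ?case by (rule qf | fact)+
  qed auto
  then show ?thesis using assms that E_Dom app_N by metis
qed

lemma Z_plus [simp]: "n \<in> N \<Longrightarrow> Z \<oplus> n = n"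
proof (induction n rule: N_induct)
  case QF
  show ?case by (rule qf | fact)+
qed auto

lemma S_plus [simp]:
  assumes "x \<in> N"
  shows "n \<in> N \<Longrightarrow> S x \<oplus> n = S (x \<oplus> n)"
proof (induction n rule: N_induct)
  case QF
  show ?case by (rule qf | fact)+
qed (auto simp: assms)

lemma plus_commute:
  assumes "x \<in> N"
  shows "n \<in> N \<Longrightarrow> x \<oplus> n = n \<oplus> x"
proof (induction n rule: N_induct)
  case QF
  show ?case by (rule qf | fact)+
qed (auto simp: assms)

lemma plus_assoc:
  assumes "x \<in> N" "y \<in> N"
  shows "n \<in> N \<Longrightarrow> x \<oplus> y \<oplus> n = x \<oplus> (y \<oplus> n)"
proof (induction n rule: N_induct)
  case QF
  show ?case by (rule qf | fact)+
qed (auto simp: assms)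

lemma plus_left_commute: "x \<in> N \<Longrightarrow> y \<in> N \<Longrightarrow> z \<in> N \<Longrightarrow> x \<oplus> (y \<oplus> z) = y \<oplus> (x \<oplus> z)"
  by (metis plus_assoc plus_commute)

lemmas plus_ac = plus_assoc plus_commute plus_left_commute

lemma plus_eq_Z: "x \<in> N \<Longrightarrow> y \<in> N \<Longrightarrow> x \<oplus> y = Z \<longleftrightarrow> x = Z \<and> y = Z"
  by (erule N_cases[of y]) auto

lemma monus_SS [simp]:
  assumes "x \<in> N"
  shows "n \<in> N \<Longrightarrow> S x \<ominus> S n = x \<ominus> n"
proof (induction n rule: N_induct)
  case QF
  show ?case by (rule qf | fact)+
next
  case (suc n)
  then show ?case using assms by (simp add: monus_S[of _ "S n"] monus_S[of x n])
qed (auto simp: assms monus_S)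

lemma Z_monus [simp]: "n \<in> N \<Longrightarrow> Z \<ominus> n = Z"
proof (induction n rule: N_induct)
  case QF
  show ?case by (rule qf | fact)+
qed (auto simp: monus_S)

lemma monus_add_right [simp]:
  assumes "x \<in> N" "y \<in> N"
  shows "n \<in> N \<Longrightarrow> (x \<oplus> n) \<ominus> (y \<oplus> n) = x \<ominus> y"
proof (induction n rule: N_induct)
  case QF
  show ?case by (rule qf | fact)+
qed (auto simp: assms)

lemma add_monus [simp]: "x \<in> N \<Longrightarrow> y \<in> N \<Longrightarrow> (x \<oplus> y) \<ominus> y = x"
  using monus_add_right[of x Z y] by simp

lemma monus_self [simp]: "x \<in> N \<Longrightarrow> x \<ominus> x = Z"
  using add_monus[of Z x] by simp

lemma le_add [simp]: "x \<in> N \<Longrightarrow> y \<in> N \<Longrightarrow> y \<sqsubseteq> x \<oplus> y"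
  using monus_add_right[of Z x y] by simp

text \<open>Linearity of the order in a form that is free of quantifiers and strong enough as an
  induction hypothesis: one of the two cut-off differences is a true difference.\<close>

lemma monus_total:
  assumes "y \<in> N"
  shows "x \<in> N \<Longrightarrow> (y \<ominus> x) \<oplus> x = y \<or> (x \<ominus> y) \<oplus> y = x"
proof (induction x rule: N_induct)
  case QF
  show ?case by (rule qf | fact)+
next
  case zero
  then show ?case using assms by simp
next
  case (suc x)
  from suc.IH show ?case
  proof
    assume *: "(y \<ominus> x) \<oplus> x = y"
    have "y \<ominus> x \<in> N" using assms suc.hyps by simp
    then show ?thesis
    proof (cases rule: N_cases)
      case 1
      then have "x = y" using * suc.hyps by simp
      moreover have "S x \<ominus> x = S Z" using add_monus[of "S Z" x] suc.hyps by simp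
      ultimately show ?thesis using suc.hyps by simp
    next
      case (2 m)
      then have "(y \<ominus> S x) \<oplus> S x = y" using * assms suc.hyps by (simp add: monus_S)
      then show ?thesis ..
    qed
  next
    assume *: "(x \<ominus> y) \<oplus> y = x"
    let ?d = "x \<ominus> y"
    have d: "?d \<in> N" using assms suc.hyps by simp
    have "S x = S ?d \<oplus> y" using * d assms by simp
    moreover from this have "S x \<ominus> y = S ?d" using add_monus[of "S ?d" y] d assms by simp
    ultimately show ?thesis by simp
  qed
qed

lemma le_diff_add:
  assumes "x \<in> N" "y \<in> N" "x \<sqsubseteq> y"
  shows "(y \<ominus> x) \<oplus> x = y"
  using monus_total[OF assms(2,1)] assms by auto

lemma leE:
  assumes "x \<sqsubseteq> y" "x \<in> N" "y \<in> N"
  obtains z where "z \<in> N" "y = z \<oplus> x"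
  using le_diff_add[OF assms(2,3,1)] assms by (metis E_Dom(8) app2_Dom(1) app_N)

lemma le_total: "x \<in> N \<Longrightarrow> y \<in> N \<Longrightarrow> x \<sqsubseteq> y \<or> y \<sqsubseteq> x"
  using monus_total[of y x] le_add[of "y \<ominus> x" x] le_add[of "x \<ominus> y" y]
  by (metis E_Dom(8) app2_Dom(1) app_N)

lemma le_antisym:
  assumes "x \<sqsubseteq> y" "y \<sqsubseteq> x" "x \<in> N" "y \<in> N"
  shows "x = y"
  using le_diff_add[OF assms(3,4,1)] assms by simp

lemma le_trans:
  assumes "x \<sqsubseteq> y" "y \<sqsubseteq> z" "x \<in> N" "y \<in> N" "z \<in> N"
  shows "x \<sqsubseteq> z"
proof -
  obtain u v where "u \<in> N" "v \<in> N" "y = u \<oplus> x" "z = v \<oplus> y" using assms leE by metis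
  then have "z = (v \<oplus> u) \<oplus> x" using assms plus_assoc by simp
  then show ?thesis using \<open>u \<in> N\<close> \<open>v \<in> N\<close> assms le_add[of "v \<oplus> u" x] by simp
qed

lemma le_Z [simp]: "x \<in> N \<Longrightarrow> x \<sqsubseteq> Z \<longleftrightarrow> x = Z"
  by auto

lemma le_S: "x \<in> N \<Longrightarrow> x \<sqsubseteq> S x"
  using le_add[of "S Z" x] by simp

lemma not_lt_self [simp]: "x \<in> N \<Longrightarrow> \<not> x \<sqsubset> x"
  using add_monus[of "S Z" x] by simp

lemma not_le:
  assumes "x \<in> N" "y \<in> N"
  shows "\<not> x \<sqsubseteq> y \<longleftrightarrow> y \<sqsubset> x"
proof
  assume "\<not> x \<sqsubseteq> y"
  then have *: "(x \<ominus> y) \<oplus> y = x" using le_total[OF assms] le_diff_add[of y x] assms by blast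
  have "x \<ominus> y \<in> N" using assms by simp
  then show "y \<sqsubset> x"
  proof (cases rule: N_cases)
    case 1
    then show ?thesis using \<open>\<not> x \<sqsubseteq> y\<close> assms by simp
  next
    case (2 m)
    then have "x = m \<oplus> S y" using * assms by simp
    then show ?thesis using 2 assms le_add[of m "S y"] by (simp del: plus_S)
  qed
next
  assume "y \<sqsubset> x"
  then show "\<not> x \<sqsubseteq> y" using le_trans[of "S y" x y] assms by auto
qed

lemma lt_imp_le: "x \<sqsubset> y \<Longrightarrow> x \<in> N \<Longrightarrow> y \<in> N \<Longrightarrow> x \<sqsubseteq> y"
  using le_trans[OF le_S] by simp

lemma le_S_iff:
  assumes "x \<in> N" "y \<in> N"
  shows "x \<sqsubseteq> S y \<longleftrightarrow> x \<sqsubseteq> y \<or> x = S y"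
proof
  assume "x \<sqsubseteq> S y"
  show "x \<sqsubseteq> y \<or> x = S y"
  proof (rule ccontr)
    assume *: "\<not> (x \<sqsubseteq> y \<or> x = S y)"
    then have "S y \<sqsubseteq> x" using not_le assms by blast
    then show False using le_antisym[OF \<open>x \<sqsubseteq> S y\<close>] * assms by simp
  qed
qed (use assms le_trans[OF _ le_S] in auto)

lemma le_neq_lt: "x \<sqsubseteq> y \<Longrightarrow> x \<noteq> y \<Longrightarrow> x \<in> N \<Longrightarrow> y \<in> N \<Longrightarrow> x \<sqsubset> y"
  by (metis le_antisym not_le)

lemma add_mono:
  assumes "x \<sqsubseteq> y" "x' \<sqsubseteq> y'" "x \<in> N" "y \<in> N" "x' \<in> N" "y' \<in> N"
  shows "x \<oplus> x' \<sqsubseteq> y \<oplus> y'"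
proof -
  obtain u v where "u \<in> N" "v \<in> N" "y = u \<oplus> x" "y' = v \<oplus> x'" using assms leE by metis
  then have "y \<oplus> y' = (u \<oplus> v) \<oplus> (x \<oplus> x')" using assms by (simp add: plus_ac)
  then show ?thesis using \<open>u \<in> N\<close> \<open>v \<in> N\<close> assms le_add[of "u \<oplus> v" "x \<oplus> x'"] by simp
qed

lemma le_add_left [simp]: "x \<in> N \<Longrightarrow> y \<in> N \<Longrightarrow> x \<sqsubseteq> x \<oplus> y"
  using le_add[of y x] plus_commute by simp

lemma pred_mono:
  assumes "x \<sqsubseteq> y" "x \<in> N" "y \<in> N"
  shows "predE \<star> x \<sqsubseteq> predE \<star> y"
  using assms(2)
proof (cases rule: N_cases)
  case (2 m)
  from assms(3) show ?thesis by (cases rule: N_cases) (use 2 assms in auto)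
qed (use assms in simp)

lemma S_pred: "x \<in> N \<Longrightarrow> x \<noteq> Z \<Longrightarrow> S (predE \<star> x) = x"
  by (erule N_cases) auto

lemma S_monus:
  assumes "x \<sqsubset> y" "x \<in> N" "y \<in> N"
  shows "y \<ominus> x = S (y \<ominus> S x)"
  using assms not_le[of y x] by (subst S_pred[symmetric]) (auto simp: monus_S)

lemma monus_le [simp]:
  assumes "x \<in> N" "y \<in> N"
  shows "x \<ominus> y \<sqsubseteq> x"
proof (cases "y \<sqsubseteq> x")
  case True
  then show ?thesis using le_diff_add[of y x] le_add_left[of "x \<ominus> y" y] assms by simp
next
  case False
  then have "x \<sqsubseteq> y" using le_total assms by blast
  then show ?thesis using assms by simp
qed


section \<open>Pairing\<close>

lemma pair_eq:
  assumes "x \<in> N" "y \<in> N"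
  shows "pairE \<star> x \<star> y = triE \<star> (x \<oplus> y) \<oplus> y"
  using app_lam[of e0 "lam yv (plus_c \<cdot> (tri_c \<cdot> (plus_c \<cdot> Var xv \<cdot> Var yv)) \<cdot> Var yv)" x xv]
    app_lam[of "e0(xv := x)" "plus_c \<cdot> (tri_c \<cdot> (plus_c \<cdot> Var xv \<cdot> Var yv)) \<cdot> Var yv" y yv] assms
  unfolding pairE_def pair_c_def by (simp add: type_of.simps(4))

lemma root_Z [simp]: "rootE \<star> Z = Z"
  and root_S: "z \<in> N \<Longrightarrow> rootE \<star> S z =
    condE \<star> (triE \<star> S (rootE \<star> z) \<ominus> S z) \<star> S (rootE \<star> z) \<star> (rootE \<star> z)"
  using rec_eqs[of e0 xv zero "cond_c \<cdot> (monus_c \<cdot> (tri_c \<cdot> suc (Var uv)) \<cdot> suc (Var vv)) \<cdot> suc (Var uv) \<cdot> Var uv"]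
  unfolding rootE_def root_c_def by (auto simp: type_of.simps(4))

lemma psnd_eq: "z \<in> N \<Longrightarrow> psndE \<star> z = z \<ominus> triE \<star> (rootE \<star> z)"
  using app_lam[of e0 "monus_c \<cdot> Var xv \<cdot> (tri_c \<cdot> (root_c \<cdot> Var xv))" z xv]
  unfolding psndE_def psnd_c_def by (simp add: type_of.simps(4))

lemma pfst_eq: "z \<in> N \<Longrightarrow> pfstE \<star> z = rootE \<star> z \<ominus> psndE \<star> z"
  using app_lam[of e0 "monus_c \<cdot> (root_c \<cdot> Var xv) \<cdot> (psnd_c \<cdot> Var xv)" z xv]
  unfolding pfstE_def pfst_c_def by (simp add: type_of.simps(4))

lemma cond_eq_if:
  assumes "z \<in> N" "x \<in> N" "y \<in> N"
  shows "condE \<star> z \<star> x \<star> y = (if z = Z then x else y)"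
  using assms(1) by (cases rule: N_cases) (use assms in auto)

lemma tri_mono:
  assumes "a \<in> N"
  shows "n \<in> N \<Longrightarrow> triE \<star> a \<sqsubseteq> triE \<star> (n \<oplus> a)"
proof (induction n rule: N_induct)
  case QF
  show ?case by (rule qf | fact)+
next
  case (suc n)
  have "triE \<star> (n \<oplus> a) \<sqsubseteq> triE \<star> (n \<oplus> a) \<oplus> S (n \<oplus> a)" using suc.hyps assms by (intro le_add_left) auto
  then show ?case using suc assms le_trans[of "triE \<star> a" "triE \<star> (n \<oplus> a)"] by (simp del: plus_S)
qed (simp add: assms)

lemma tri_le: "a \<sqsubseteq> b \<Longrightarrow> a \<in> N \<Longrightarrow> b \<in> N \<Longrightarrow> triE \<star> a \<sqsubseteq> triE \<star> b"
  using tri_mono by (auto elim!: leE)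

text \<open>The bounds serve as the invariant of the recursion. Increasing \<open>z\<close> by one
  can at most just reach the next triangular number, so the root never has to rise by more than
  one.\<close>

lemma root_spec: "z \<in> N \<Longrightarrow> triE \<star> (rootE \<star> z) \<sqsubseteq> z \<and> z \<sqsubset> triE \<star> S (rootE \<star> z)"
proof (induction z rule: N_induct)
  case QF
  show ?case by (rule qf | fact)+
next
  case (suc z)
  let ?r = "rootE \<star> z"
  have r: "?r \<in> N" "triE \<star> ?r \<in> N" using suc.hyps by auto
  show ?case
  proof (cases "triE \<star> S ?r \<sqsubseteq> S z")
    case True
    then have "rootE \<star> S z = S ?r" using suc.hyps r by (simp add: root_S cond_eq_if)
    \<comment> \<open>The invariant gives one inequality, the case assumption the other.\<close>
    moreover have "S z = triE \<star> S ?r"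
      by (rule le_antisym) (use True suc r in \<open>auto simp del: tri_S\<close>)
    moreover have "S (triE \<star> S ?r) \<sqsubseteq> triE \<star> S ?r \<oplus> S (S ?r)"
      using r le_add_left[of "S (triE \<star> S ?r)" "S ?r"] by (simp del: tri_S)
    ultimately show ?thesis using True r by (simp del: tri_S plus_S add: tri_S[of "S ?r"])
  next
    case False
    then have "rootE \<star> S z = ?r" using suc.hyps r by (simp add: root_S cond_eq_if del: tri_S)
    moreover have "S z \<sqsubset> triE \<star> S ?r" using False not_le[of "triE \<star> S ?r" "S z"] suc.hyps r by (simp del: tri_S)
    moreover have "triE \<star> ?r \<sqsubseteq> S z" using suc r le_trans[of "triE \<star> ?r" z "S z"] le_S[of z] by simp
    ultimately show ?thesis by simp
  qed
qed simp

lemma root_unique: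
  assumes "triE \<star> r \<sqsubseteq> z" "z \<sqsubset> triE \<star> S r" "r \<in> N" "z \<in> N"
  shows "rootE \<star> z = r"
proof -
  have no: "\<not> r \<sqsubset> r'" if "triE \<star> r' \<sqsubseteq> z" "z \<sqsubset> triE \<star> S r" "r \<in> N" "r' \<in> N" for r r'
  proof
    assume "r \<sqsubset> r'"
    then have "triE \<star> S r \<sqsubseteq> triE \<star> r'" using that by (intro tri_le) auto
    then have "S z \<sqsubseteq> z" using that assms(4) le_trans[of "S z" "triE \<star> S r" "triE \<star> r'"]
        le_trans[of "S z" "triE \<star> r'" z] by (simp del: tri_S)
    then show False using assms(4) by simp
  qed
  note s = root_spec[OF assms(4)]
  have "rootE \<star> z \<in> N" using assms by simp
  then show ?thesis using no[of "rootE \<star> z" r] no[of r "rootE \<star> z"] s assms not_le le_antisym by metis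
qed

text \<open>As \<open>y\<close> is at most \<open>x \<oplus> y\<close>, adding it to a triangular
  number stays below the next one.\<close>

lemma root_pair:
  assumes "x \<in> N" "y \<in> N"
  shows "rootE \<star> (pairE \<star> x \<star> y) = x \<oplus> y"
proof (rule root_unique)
  have "S y \<sqsubseteq> S (x \<oplus> y)" using assms by simp
  then have "triE \<star> (x \<oplus> y) \<oplus> S y \<sqsubseteq> triE \<star> (x \<oplus> y) \<oplus> S (x \<oplus> y)"
    using assms by (intro add_mono) auto
  then show "pairE \<star> x \<star> y \<sqsubset> triE \<star> S (x \<oplus> y)" using assms by (simp add: pair_eq)
qed (use assms in \<open>auto simp: pair_eq\<close>)

lemma psnd_pair [simp]:
  assumes "x \<in> N" "y \<in> N"
  shows "psndE \<star> (pairE \<star> x \<star> y) = y"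
proof -
  have "psndE \<star> (pairE \<star> x \<star> y) = pairE \<star> x \<star> y \<ominus> triE \<star> (x \<oplus> y)"
    using assms by (simp add: psnd_eq root_pair)
  also have "\<dots> = (y \<oplus> triE \<star> (x \<oplus> y)) \<ominus> triE \<star> (x \<oplus> y)"
    using assms plus_commute[of y "triE \<star> (x \<oplus> y)"] by (simp add: pair_eq)
  finally show ?thesis using assms by simp
qed

lemma pfst_pair [simp]: "x \<in> N \<Longrightarrow> y \<in> N \<Longrightarrow> pfstE \<star> (pairE \<star> x \<star> y) = x"
  by (simp add: pfst_eq root_pair)

text \<open>Cancelling the triangular number in \<open>z \<sqsubset> triE \<star> S r\<close> shows
  that the second component is at most the root \<open>r\<close>. So neither subtraction in the two
  projections is cut off, and pairing is onto.\<close>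

lemma pfst_psnd_root:
  assumes "z \<in> N"
  shows "pfstE \<star> z \<oplus> psndE \<star> z = rootE \<star> z" "z = triE \<star> (rootE \<star> z) \<oplus> psndE \<star> z"
proof -
  let ?r = "rootE \<star> z" and ?p = "psndE \<star> z"
  have N: "?r \<in> N" "?p \<in> N" "triE \<star> ?r \<in> N" using assms by auto
  note s = root_spec[OF assms]
  have z: "z = ?p \<oplus> triE \<star> ?r" using le_diff_add[of "triE \<star> ?r" z] s assms N by (simp add: psnd_eq)
  then show "z = triE \<star> ?r \<oplus> ?p" using N plus_commute by simp
  have "S ?p \<oplus> triE \<star> ?r \<sqsubseteq> S ?r \<oplus> triE \<star> ?r"
    using s z N plus_commute[of "triE \<star> ?r" "S ?r"] assms by simp
  then have "S ?p \<sqsubseteq> S ?r" using N by (simp only: monus_add_right S_N)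
  then have "?p \<sqsubseteq> ?r" using N by simp
  then show "pfstE \<star> z \<oplus> ?p = ?r" using le_diff_add[of ?p ?r] N assms by (simp add: pfst_eq)
qed

lemma pair_surj: "z \<in> N \<Longrightarrow> pairE \<star> (pfstE \<star> z) \<star> (psndE \<star> z) = z"
  using pfst_psnd_root[of z] by (simp add: pair_eq)

lemma le_tri: "n \<in> N \<Longrightarrow> n \<sqsubseteq> triE \<star> n"
proof (induction n rule: N_induct)
  case QF
  show ?case by (rule qf | fact)+
next
  case (suc n)
  then show ?case using le_add[of "triE \<star> n" "S n"] by simp
qed simp

text \<open>Removing the last element of a sequence takes a predecessor and then a first component,
  so it lowers a nonzero code. Hence \<open>s\<close> removals certainly empty the sequence coded by
  \<open>s\<close>.\<close>

lemma pfst_le: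
  assumes "z \<in> N"
  shows "pfstE \<star> z \<sqsubseteq> z"
proof -
  have "pfstE \<star> z \<sqsubseteq> rootE \<star> z" using pfst_psnd_root[OF assms] le_add_left[of "pfstE \<star> z" "psndE \<star> z"] assms by simp
  moreover have "rootE \<star> z \<sqsubseteq> triE \<star> (rootE \<star> z)" using le_tri assms by simp
  moreover have "triE \<star> (rootE \<star> z) \<sqsubseteq> z" using root_spec[OF assms] by simp
  ultimately show ?thesis
    using assms le_trans[of "pfstE \<star> z" "rootE \<star> z" "triE \<star> (rootE \<star> z)"] le_trans[of "pfstE \<star> z" "triE \<star> (rootE \<star> z)" z]
    by simp
qed

lemma pfst_Z [simp]: "pfstE \<star> Z = Z"
  using pfst_le[of Z] by simp

end

section \<open>Bounded search and finite sums\<close>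

text \<open>The iterate is a candidate that stays put once it is a zero and otherwise moves to the
  next stage. The result is the least zero up to the bound if there is one, and the bound itself if
  not.\<close>

definition search_c :: tm where
  "search_c = lam gv (lam yv (rec (Var yv) zero (cond_c \<cdot> (Var gv \<cdot> Var uv) \<cdot> Var uv \<cdot> suc (Var vv))))"

definition sum_c :: tm where
  "sum_c = lam gv (lam yv (rec (Var yv) zero (plus_c \<cdot> Var uv \<cdot> (Var gv \<cdot> Var vv))))"

lemma search_c_typing [simp]:
  "type_of \<Gamma> search_c = Some (Ty1 \<rightarrow> Ty0 \<rightarrow> Ty0)" "fv_tm search_c = {}" "xis_tm search_c = {}"
  by (auto simp: search_c_def type_of.simps(4))

lemma sum_c_typing [simp]:
  "type_of \<Gamma> sum_c = Some (Ty1 \<rightarrow> Ty0 \<rightarrow> Ty0)" "fv_tm sum_c = {}" "xis_tm sum_c = {}"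
  by (auto simp: sum_c_def type_of.simps(4))

context base_model
begin

definition "searchE = ev M e0 [] search_c"
definition "sumE = ev M e0 [] sum_c"

lemma ev_search [simp]: "ev M e bs search_c = searchE" "ev M e bs sum_c = sumE"
  unfolding searchE_def sumE_def by (rule ev_closed; simp)+

lemma search_Dom [simp]:
  "searchE \<in> Dom M (Ty1 \<rightarrow> Ty0 \<rightarrow> Ty0)" "sumE \<in> Dom M (Ty1 \<rightarrow> Ty0 \<rightarrow> Ty0)"
  unfolding searchE_def sumE_def by (rule ev_in_Dom; simp)+

lemmas qf' = qf search_Dom

lemma search_Z [simp]: "h \<in> Dom M Ty1 \<Longrightarrow> searchE \<star> h \<star> Z = Z"
  and search_S: "h \<in> Dom M Ty1 \<Longrightarrow> n \<in> N \<Longrightarrow> searchE \<star> h \<star> S n =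
    condE \<star> (h \<star> (searchE \<star> h \<star> n)) \<star> (searchE \<star> h \<star> n) \<star> S n"
  using app_lam[of e0 "lam yv (rec (Var yv) zero (cond_c \<cdot> (Var gv \<cdot> Var uv) \<cdot> Var uv \<cdot> suc (Var vv)))" h gv]
    rec_eqs[of "e0(gv := h)" yv zero "cond_c \<cdot> (Var gv \<cdot> Var uv) \<cdot> Var uv \<cdot> suc (Var vv)"]
  unfolding searchE_def search_c_def by (auto simp: type_of.simps(4))

lemma sum_Z [simp]: "h \<in> Dom M Ty1 \<Longrightarrow> sumE \<star> h \<star> Z = Z"
  and sum_S [simp]: "h \<in> Dom M Ty1 \<Longrightarrow> n \<in> N \<Longrightarrow> sumE \<star> h \<star> S n = sumE \<star> h \<star> n \<oplus> h \<star> n"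
  using app_lam[of e0 "lam yv (rec (Var yv) zero (plus_c \<cdot> Var uv \<cdot> (Var gv \<cdot> Var vv)))" h gv]
    rec_eqs[of "e0(gv := h)" yv zero "plus_c \<cdot> Var uv \<cdot> (Var gv \<cdot> Var vv)"]
  unfolding sumE_def sum_c_def by (auto simp: type_of.simps(4))

lemma search_S_if:
  "h \<in> Dom M Ty1 \<Longrightarrow> n \<in> N \<Longrightarrow> searchE \<star> h \<star> S n =
    (if h \<star> (searchE \<star> h \<star> n) = Z then searchE \<star> h \<star> n else S n)"
  by (simp add: search_S cond_eq_if)

lemma search_le:
  assumes "h \<in> Dom M Ty1"
  shows "n \<in> N \<Longrightarrow> searchE \<star> h \<star> n \<sqsubseteq> n"
proof (induction n rule: N_induct)
  case QF
  show ?case by (rule qf' | fact)+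
qed (use assms in \<open>auto simp: search_S_if le_S_iff\<close>)

lemma search_zero:
  assumes "h \<in> Dom M Ty1" "x \<in> N" "h \<star> x = Z"
  shows "n \<in> N \<Longrightarrow> x \<sqsubseteq> n \<longrightarrow> h \<star> (searchE \<star> h \<star> n) = Z"
proof (induction n rule: N_induct)
  case QF
  show ?case by (rule qf' | fact)+
qed (use assms in \<open>auto simp: search_S_if le_S_iff\<close>)

lemma search_least:
  assumes "h \<in> Dom M Ty1" "y \<in> N"
  shows "n \<in> N \<Longrightarrow> y \<sqsubset> searchE \<star> h \<star> n \<longrightarrow> h \<star> y \<noteq> Z"
proof (induction n rule: N_induct)
  case QF
  show ?case by (rule qf' | fact)+
next
  case (suc n)
  \<comment> \<open>The search leaves a candidate only if it is not a zero, and in that case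
    \<open>search_zero\<close> excludes every zero up to \<open>n\<close>.\<close>
  then show ?case using assms search_zero[OF assms(1,2) _ suc.hyps] by (auto simp: search_S_if)
qed (use assms in auto)

lemma sum_ge:
  assumes "h \<in> Dom M Ty1" "i \<in> N"
  shows "n \<in> N \<Longrightarrow> i \<sqsubset> n \<longrightarrow> h \<star> i \<sqsubseteq> sumE \<star> h \<star> n"
proof (induction n rule: N_induct)
  case QF
  show ?case by (rule qf' | fact)+
next
  case (suc n)
  show ?case
  proof
    assume "i \<sqsubset> S n"
    then have "i \<sqsubseteq> n" using assms suc.hyps by simp
    show "h \<star> i \<sqsubseteq> sumE \<star> h \<star> S n"
    proof (cases "i = n")
      case True
      then show ?thesis using assms suc.hyps by simp
    next
      case False
      then have "h \<star> i \<sqsubseteq> sumE \<star> h \<star> n" using suc assms le_neq_lt \<open>i \<sqsubseteq> n\<close> by blast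
      moreover have "sumE \<star> h \<star> n \<sqsubseteq> sumE \<star> h \<star> n \<oplus> h \<star> n" using assms suc.hyps by (intro le_add_left) auto
      ultimately show ?thesis
        using assms suc.hyps le_trans[of "h \<star> i" "sumE \<star> h \<star> n" "sumE \<star> h \<star> S n"] by simp
    qed
  qed
qed (use assms in auto)


section \<open>Sequence codes\<close>

lemma bar_Z [simp]: "g \<in> Dom M Ty1 \<Longrightarrow> barE \<star> g \<star> Z = Z"
  and bar_S [simp]: "g \<in> Dom M Ty1 \<Longrightarrow> n \<in> N \<Longrightarrow> barE \<star> g \<star> S n = S (pairE \<star> (barE \<star> g \<star> n) \<star> (g \<star> n))"
  using app_lam[of e0 "lam xv (rec (Var xv) zero (suc (pair_c \<cdot> Var uv \<cdot> (Var gv \<cdot> Var vv))))" g gv]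
    rec_eqs[of "e0(gv := g)" xv zero "suc (pair_c \<cdot> Var uv \<cdot> (Var gv \<cdot> Var vv))"]
  unfolding barE_def bar_c_def by (auto simp: type_of.simps(4))

lemma drop_Z [simp]: "s \<in> N \<Longrightarrow> dropE \<star> s \<star> Z = s"
  and drop_S [simp]: "s \<in> N \<Longrightarrow> n \<in> N \<Longrightarrow> dropE \<star> s \<star> S n = pfstE \<star> (predE \<star> (dropE \<star> s \<star> n))"
  using app_lam[of e0 "lam yv (rec (Var yv) (Var xv) (pfst_c \<cdot> (pred_c \<cdot> Var uv)))" s xv]
    rec_eqs[of "e0(xv := s)" yv "Var xv" "pfst_c \<cdot> (pred_c \<cdot> Var uv)"]
  unfolding dropE_def drop_c_def by (auto simp: type_of.simps(4))

text \<open>The recursion in \<open>lh_c\<close> uses the code both as the sequence and as the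
  number of steps. Here the number of steps is a separate argument, which makes induction on it
  possible.\<close>

definition countE :: "'a \<Rightarrow> 'a" where
  "countE s = ev M (e0(xv := s)) [] (lam yv (rec (Var yv) zero (plus_c \<cdot> Var uv \<cdot> (sg_c \<cdot> (drop_c \<cdot> Var xv \<cdot> Var vv)))))"

lemma count_Dom [simp]: "s \<in> N \<Longrightarrow> countE s \<in> Dom M Ty1"
  unfolding countE_def by (rule ev_in_Dom) (auto simp: type_of.simps(4))

lemma count_Z [simp]: "s \<in> N \<Longrightarrow> countE s \<star> Z = Z"
  and count_S: "s \<in> N \<Longrightarrow> n \<in> N \<Longrightarrow> countE s \<star> S n = countE s \<star> n \<oplus> sgE \<star> (dropE \<star> s \<star> n)"
  using rec_eqs[of "e0(xv := s)" yv zero "plus_c \<cdot> Var uv \<cdot> (sg_c \<cdot> (drop_c \<cdot> Var xv \<cdot> Var vv))"]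
  unfolding countE_def by (auto simp: type_of.simps(4))

lemma lh_count:
  assumes "s \<in> N"
  shows "lhE \<star> s = countE s \<star> s"
proof -
  let ?b = "plus_c \<cdot> Var uv \<cdot> (sg_c \<cdot> (drop_c \<cdot> Var xv \<cdot> Var vv))"
  have "lhE \<star> s = ev M (e0(xv := s)) [] (rec (Var xv) zero ?b)"
    unfolding lhE_def lh_c_def using assms by (intro app_lam) (auto simp: type_of.simps(4))
  also have "\<dots> = ev M (e0(xv := s, yv := s)) [] (rec (Var yv) zero ?b)"
  proof -
    have "ev M (e0(xv := s)) [] (lam uv (lam vv ?b)) = ev M (e0(xv := s, yv := s)) [] (lam uv (lam vv ?b))"
      by (rule ev_cong) auto
    then show ?thesis by (simp add: rec_def)
  qed
  also have "\<dots> = countE s \<star> s"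
    unfolding countE_def using assms by (intro app_lam[symmetric]) (auto simp: type_of.simps(4))
  finally show ?thesis .
qed

lemma init_eq: "s \<in> N \<Longrightarrow> x \<in> N \<Longrightarrow> initE \<star> s \<star> x = dropE \<star> s \<star> (lhE \<star> s \<ominus> x)"
  using app_lam[of e0 "lam yv (drop_c \<cdot> Var xv \<cdot> (monus_c \<cdot> (lh_c \<cdot> Var xv) \<cdot> Var yv))" s xv]
    app_lam[of "e0(xv := s)" "drop_c \<cdot> Var xv \<cdot> (monus_c \<cdot> (lh_c \<cdot> Var xv) \<cdot> Var yv)" x yv]
  unfolding initE_def init_c_def by (simp add: type_of.simps(4))

lemma nth_eq: "s \<in> N \<Longrightarrow> x \<in> N \<Longrightarrow> nthE \<star> s \<star> x = psndE \<star> (predE \<star> (dropE \<star> s \<star> (lhE \<star> s \<ominus> S x)))"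
  using app_lam[of e0 "lam yv (psnd_c \<cdot> (pred_c \<cdot> (drop_c \<cdot> Var xv \<cdot> (monus_c \<cdot> (lh_c \<cdot> Var xv) \<cdot> suc (Var yv)))))" s xv]
    app_lam[of "e0(xv := s)" "psnd_c \<cdot> (pred_c \<cdot> (drop_c \<cdot> Var xv \<cdot> (monus_c \<cdot> (lh_c \<cdot> Var xv) \<cdot> suc (Var yv))))" x yv]
  unfolding nthE_def nth_c_def by (simp add: type_of.simps(4))

lemma sg_nonzero: "x \<in> N \<Longrightarrow> x \<noteq> Z \<Longrightarrow> sgE \<star> x = S Z"
  by (erule N_cases) auto

lemma drop_le:
  assumes "s \<in> N"
  shows "k \<in> N \<Longrightarrow> dropE \<star> s \<star> k \<sqsubseteq> s \<ominus> k"
proof (induction k rule: N_induct)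
  case QF
  show ?case by (rule qf' | fact)+
next
  case (suc k)
  let ?d = "dropE \<star> s \<star> k"
  have N: "?d \<in> N" "s \<ominus> k \<in> N" using assms suc.hyps by auto
  then have "predE \<star> ?d \<sqsubseteq> predE \<star> (s \<ominus> k)" using suc.IH pred_mono by blast
  moreover have "pfstE \<star> (predE \<star> ?d) \<sqsubseteq> predE \<star> ?d" using N by (intro pfst_le) auto
  ultimately show ?case
    using assms suc.hyps N le_trans[of "pfstE \<star> (predE \<star> ?d)" "predE \<star> ?d" "predE \<star> (s \<ominus> k)"]
    by (simp add: monus_S)
qed (use assms in auto)

lemma drop_self: "s \<in> N \<Longrightarrow> dropE \<star> s \<star> s = Z"
  using drop_le[of s s] by simp

lemma drop_pair:
  assumes "s \<in> N" "a \<in> N"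
  shows "k \<in> N \<Longrightarrow> dropE \<star> S (pairE \<star> s \<star> a) \<star> S k = dropE \<star> s \<star> k"
proof (induction k rule: N_induct)
  case QF
  show ?case by (rule qf' | fact)+
next
  case (suc k)
  then show ?case using assms drop_S[of "S (pairE \<star> s \<star> a)" "S k"] by (simp del: drop_S) simp
qed (use assms in auto)

text \<open>The count keeps pace with the number of dropped elements until nothing is left and then
  stands still. With \<open>count_drop\<close>, the length is the least number of elements whose
  removal empties the sequence.\<close>

lemma count_cases:
  assumes "s \<in> N"
  shows "n \<in> N \<Longrightarrow> countE s \<star> n = n \<or> dropE \<star> s \<star> (countE s \<star> n) = Z \<and> dropE \<star> s \<star> n = Z"
proof (induction n rule: N_induct)
  case QF
  have "countE s \<in> Dom M Ty1" using assms by simp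
  show ?case by (rule qf' | fact)+
next
  case (suc n)
  have N: "countE s \<star> n \<in> N" "dropE \<star> s \<star> n \<in> N" using assms suc.hyps by auto
  show ?case
  proof (cases "dropE \<star> s \<star> n = Z")
    case True
    then show ?thesis using suc assms N by (auto simp: count_S)
  next
    case False
    then show ?thesis using suc assms N sg_nonzero[of "dropE \<star> s \<star> n"] by (auto simp: count_S)
  qed
qed (use assms in auto)

lemma count_drop:
  assumes "s \<in> N" "v \<in> N"
  shows "n \<in> N \<Longrightarrow> v \<sqsubset> countE s \<star> n \<longrightarrow> dropE \<star> s \<star> v \<noteq> Z"
proof (induction n rule: N_induct)
  case QF
  have "countE s \<in> Dom M Ty1" using assms by simp
  show ?case by (rule qf' | fact)+
next
  case (suc n)
  have N: "countE s \<star> n \<in> N" "dropE \<star> s \<star> n \<in> N" using assms suc.hyps by auto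
  show ?case
  proof (cases "dropE \<star> s \<star> n = Z")
    case True
    then show ?thesis using suc assms N by (simp add: count_S)
  next
    case False
    then have *: "countE s \<star> n = n" "countE s \<star> S n = S n"
      using count_cases[OF assms(1) suc.hyps] sg_nonzero[of "dropE \<star> s \<star> n"] suc.hyps assms N
      by (auto simp: count_S)
    show ?thesis
    proof
      assume "v \<sqsubset> countE s \<star> S n"
      then have "v \<sqsubseteq> n" using * assms suc.hyps by simp
      then show "dropE \<star> s \<star> v \<noteq> Z"
        using suc * False le_neq_lt[of v n] assms by auto
    qed
  qed
qed (use assms in auto)

lemma drop_lh: "s \<in> N \<Longrightarrow> dropE \<star> s \<star> (lhE \<star> s) = Z"
  using count_cases[of s s] drop_self[of s] by (auto simp: lh_count)

lemma drop_below_lh: "s \<in> N \<Longrightarrow> v \<in> N \<Longrightarrow> v \<sqsubset> lhE \<star> s \<Longrightarrow> dropE \<star> s \<star> v \<noteq> Z"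
  using count_drop[of s v s] by (simp add: lh_count)

lemma drop_bar:
  assumes "g \<in> Dom M Ty1" "x \<in> N"
  shows "k \<in> N \<Longrightarrow> dropE \<star> (barE \<star> g \<star> (x \<oplus> k)) \<star> k = barE \<star> g \<star> x"
proof (induction k rule: N_induct)
  case QF
  show ?case by (rule qf' | fact)+
next
  case (suc k)
  then show ?case using assms drop_pair[of "barE \<star> g \<star> (x \<oplus> k)" "g \<star> (x \<oplus> k)" k] by (simp del: drop_S)
qed (use assms in auto)

text \<open>Dropping elements of an initial segment of \<open>g\<close> gives shorter segments,
  which are nonempty until \<open>x\<close> elements are gone. The length, being the least number of
  removals that empties the code, can then be neither smaller nor larger than
  \<open>x\<close>.\<close>

lemma lh_bar [simp]:
  assumes "g \<in> Dom M Ty1" "x \<in> N"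
  shows "lhE \<star> (barE \<star> g \<star> x) = x"
proof (rule ccontr)
  let ?s = "barE \<star> g \<star> x" and ?l = "lhE \<star> (barE \<star> g \<star> x)"
  have N: "?s \<in> N" "?l \<in> N" using assms by auto
  have Z: "dropE \<star> ?s \<star> x = Z" using drop_bar[OF assms(1) Z_N assms(2)] assms by simp
  have nZ: "dropE \<star> ?s \<star> v \<noteq> Z" if v: "v \<in> N" "v \<sqsubset> x" for v
  proof -
    obtain w where w: "w \<in> N" "x = w \<oplus> S v" using leE[OF v(2)] v assms by auto
    then have "dropE \<star> ?s \<star> v = barE \<star> g \<star> S w" using drop_bar[OF assms(1), of "S w" v] v by simp
    then show ?thesis using w assms by simp
  qed
  assume "?l \<noteq> x"
  then consider "?l \<sqsubset> x" | "x \<sqsubset> ?l" using N assms le_neq_lt le_total by metis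
  then show False
    using drop_lh[OF N(1)] nZ[OF N(2)] Z drop_below_lh[OF N(1) assms(2)] by cases auto
qed

lemma init_bar:
  assumes "g \<in> Dom M Ty1" "x \<in> N" "n \<in> N" "x \<sqsubseteq> n"
  shows "initE \<star> (barE \<star> g \<star> n) \<star> x = barE \<star> g \<star> x"
proof -
  have "n = x \<oplus> (n \<ominus> x)" using le_diff_add[of x n] plus_commute[of x "n \<ominus> x"] assms by simp
  then show ?thesis using drop_bar[OF assms(1,2), of "n \<ominus> x"] assms by (simp add: init_eq)
qed

lemma nth_bar:
  assumes "g \<in> Dom M Ty1" "x \<in> N" "n \<in> N" "x \<sqsubset> n"
  shows "nthE \<star> (barE \<star> g \<star> n) \<star> x = g \<star> x"
  using init_bar[OF assms(1) _ assms(3,4)] assms by (simp add: nth_eq init_eq)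

text \<open>Pairing is onto, so every nonzero code splits into a shorter code and a last element. An
  arbitrary code thus becomes an initial segment of a function, the form in which it can be compared
  with a path.\<close>

lemma bar_nth:
  assumes "s \<in> N"
  shows "x \<in> N \<Longrightarrow> x \<sqsubseteq> lhE \<star> s \<longrightarrow> initE \<star> s \<star> x = barE \<star> (nthE \<star> s) \<star> x"
proof (induction x rule: N_induct)
  case QF
  show ?case by (rule qf' | fact)+
next
  case zero
  then show ?case using assms drop_lh by (simp add: init_eq)
next
  case (suc x)
  show ?case
  proof
    let ?u = "dropE \<star> s \<star> (lhE \<star> s \<ominus> S x)"
    assume lt: "x \<sqsubset> lhE \<star> s"
    have N: "?u \<in> N" "lhE \<star> s \<ominus> S x \<in> N" using assms suc.hyps by auto
    have eq: "lhE \<star> s \<ominus> x = S (lhE \<star> s \<ominus> S x)" by (rule S_monus[OF lt]) (use assms suc.hyps in auto)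
    have "S (lhE \<star> s \<ominus> S x) \<sqsubseteq> lhE \<star> s" unfolding eq[symmetric] using assms suc.hyps by simp
    then have "?u \<noteq> Z" using drop_below_lh assms N by blast
    then have u: "S (predE \<star> ?u) = ?u" using S_pred N by blast
    have "initE \<star> s \<star> x = pfstE \<star> (predE \<star> ?u)" using assms suc.hyps N by (simp add: init_eq eq)
    moreover have "initE \<star> s \<star> x = barE \<star> (nthE \<star> s) \<star> x"
      using suc lt lt_imp_le assms by simp
    moreover have "nthE \<star> s \<star> x = psndE \<star> (predE \<star> ?u)" using assms suc.hyps by (simp add: nth_eq)
    ultimately have "barE \<star> (nthE \<star> s) \<star> S x = S (pairE \<star> (pfstE \<star> (predE \<star> ?u)) \<star> (psndE \<star> (predE \<star> ?u)))"
      using bar_S[of "nthE \<star> s" x] assms suc.hyps by simp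
    also have "\<dots> = ?u" using pair_surj[OF app_N[OF E_Dom(1) N(1)]] u by (simp only:)
    finally show "initE \<star> s \<star> S x = barE \<star> (nthE \<star> s) \<star> S x" using assms suc.hyps by (simp add: init_eq)
  qed
qed

lemma bar_cong:
  assumes "g \<in> Dom M Ty1" "g' \<in> Dom M Ty1" "m \<in> N" "\<And>i. i \<in> N \<Longrightarrow> i \<sqsubset> m \<Longrightarrow> g \<star> i = g' \<star> i"
  shows "x \<in> N \<Longrightarrow> x \<sqsubseteq> m \<longrightarrow> barE \<star> g \<star> x = barE \<star> g' \<star> x"
proof (induction x rule: N_induct)
  case QF
  show ?case by (rule qf' | fact)+
next
  case (suc x)
  then show ?case using assms lt_imp_le[of x m] by simp
qed (use assms in auto)

end

section \<open>Standardness\<close>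

lemma rel_close: "rel (close k v A) = close k v (rel A)"
  by (induction A arbitrary: k) auto

lemma rel_all [simp]: "rel (all v A) = all_st v (rel A)"
  by (simp add: all_def all_st_def rel_close)

lemma rel_ex [simp]: "rel (ex v A) = \<^bold>\<not> all_st v (\<^bold>\<not> rel A)"
  by (simp add: ex_def)

lemma wf_rel [simp]: "wf_fm \<Gamma> A \<Longrightarrow> wf_fm \<Gamma> (rel A)"
  by (induction A arbitrary: \<Gamma>) auto

lemma wf_all_st [simp]: "wf_fm [] A \<Longrightarrow> wf_fm [] (all_st v A)"
  by (simp add: all_st_def)

lemma wf_ex_st [simp]: "wf_fm [] A \<Longrightarrow> wf_fm [] (ex_st v A)"
  by (simp add: ex_st_def)

lemma xis_rel [simp]: "xis (rel A) = xis A"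
  by (induction A) auto

lemma xis_all_st [simp]: "xis (all_st v A) = xis A"
  by (simp add: all_st_def)

lemma xis_ex_st [simp]: "xis (ex_st v A) = xis A"
  by (simp add: ex_st_def)

lemma sat_all_st [simp]:
  "wf_fm [] A \<Longrightarrow> sat M e [] (all_st v A) \<longleftrightarrow>
    (\<forall>a\<in>Dom M (snd v). Std M (snd v) a \<longrightarrow> sat M (e(v := a)) [] A)"
  by (simp add: all_st_def)

lemma sat_ex_st [simp]:
  "wf_fm [] A \<Longrightarrow> sat M e [] (ex_st v A) \<longleftrightarrow>
    (\<exists>a\<in>Dom M (snd v). Std M (snd v) a \<and> sat M (e(v := a)) [] A)"
  by (auto simp: ex_st_def)

lemma internal_close [simp]: "internal (close k v A) \<longleftrightarrow> internal A"
  by (induction A arbitrary: k) auto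

lemma internal_all [simp]: "internal (all v A) \<longleftrightarrow> internal A" "internal (ex v A) \<longleftrightarrow> internal A"
  by (simp_all add: all_def ex_def)

section \<open>Closed terms for trees, shifts and graphs\<close>

definition path_c :: tm where
  "path_c = lam (1, Ty1) (lam gv (lam xv (Var (1, Ty1) \<cdot> (bar_c \<cdot> Var gv \<cdot> Var xv))))"

text \<open>The resulting tree looks only at the length of a sequence, so it has a path exactly if
  the given function has no zero. This embeds statements about numbers into statements about
  paths.\<close>

definition comp_c :: tm where
  "comp_c = lam gv (lam xv (Var gv \<cdot> (lh_c \<cdot> Var xv)))"

text \<open>A function split into its value at 0 and its tail carries a number and a function in one
  object.\<close>

definition tail_c :: tm where
  "tail_c = lam gv (lam xv (Var gv \<cdot> suc (Var xv)))"

text \<open>The value is subtracted from 1 because the search looks for zeros: for a binary set of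
  pairs, the zeros of a slice are the second components of its members.\<close>

definition slice_c :: tm where
  "slice_c = lam gv (lam xv (lam yv (monus_c \<cdot> one \<cdot> (Var gv \<cdot> (pair_c \<cdot> Var xv \<cdot> Var yv)))))"

lemma path_c_typing [simp]:
  "type_of \<Gamma> path_c = Some (Ty1 \<rightarrow> Ty1 \<rightarrow> Ty1)" "fv_tm path_c = {}" "xis_tm path_c = {}"
  by (auto simp: path_c_def type_of.simps(4))

lemma comp_c_typing [simp]:
  "type_of \<Gamma> comp_c = Some (Ty1 \<rightarrow> Ty1)" "fv_tm comp_c = {}" "xis_tm comp_c = {}"
  by (auto simp: comp_c_def type_of.simps(4))

lemma tail_c_typing [simp]:
  "type_of \<Gamma> tail_c = Some (Ty1 \<rightarrow> Ty1)" "fv_tm tail_c = {}" "xis_tm tail_c = {}"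
  by (auto simp: tail_c_def type_of.simps(4))

lemma slice_c_typing [simp]:
  "type_of \<Gamma> slice_c = Some (Ty1 \<rightarrow> Ty0 \<rightarrow> Ty1)" "fv_tm slice_c = {}" "xis_tm slice_c = {}"
  by (auto simp: slice_c_def type_of.simps(4))

context base_model
begin

definition "pathE = ev M e0 [] path_c"
definition "compE = ev M e0 [] comp_c"
definition "tailE = ev M e0 [] tail_c"
definition "sliceE = ev M e0 [] slice_c"

lemma ev_path [simp]:
  "ev M e bs path_c = pathE" "ev M e bs comp_c = compE" "ev M e bs tail_c = tailE" "ev M e bs slice_c = sliceE"
  unfolding pathE_def compE_def tailE_def sliceE_def by (rule ev_closed; simp)+

lemma path_Dom:
  "pathE \<in> Dom M (Ty1 \<rightarrow> Ty1 \<rightarrow> Ty1)" "compE \<in> Dom M (Ty1 \<rightarrow> Ty1)" "tailE \<in> Dom M (Ty1 \<rightarrow> Ty1)"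
  "sliceE \<in> Dom M (Ty1 \<rightarrow> Ty0 \<rightarrow> Ty1)"
  unfolding pathE_def compE_def tailE_def sliceE_def by (rule ev_in_Dom; simp)+

lemma path_app_Dom [simp]:
  "f \<in> Dom M Ty1 \<Longrightarrow> g \<in> Dom M Ty1 \<Longrightarrow> pathE \<star> f \<star> g \<in> Dom M Ty1"
  "f \<in> Dom M Ty1 \<Longrightarrow> compE \<star> f \<in> Dom M Ty1" "f \<in> Dom M Ty1 \<Longrightarrow> tailE \<star> f \<in> Dom M Ty1"
  "f \<in> Dom M Ty1 \<Longrightarrow> n \<in> N \<Longrightarrow> sliceE \<star> f \<star> n \<in> Dom M Ty1"
  using path_Dom by (blast intro: Ap_Dom)+

lemma path_eq [simp]:
  "f \<in> Dom M Ty1 \<Longrightarrow> g \<in> Dom M Ty1 \<Longrightarrow> x \<in> N \<Longrightarrow> pathE \<star> f \<star> g \<star> x = f \<star> (barE \<star> g \<star> x)"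
  by (simp add: pathE_def path_c_def app_lam type_of.simps(4))

lemma comp_eq [simp]: "f \<in> Dom M Ty1 \<Longrightarrow> x \<in> N \<Longrightarrow> compE \<star> f \<star> x = f \<star> (lhE \<star> x)"
  by (simp add: compE_def comp_c_def app_lam type_of.simps(4))

lemma tail_eq [simp]: "f \<in> Dom M Ty1 \<Longrightarrow> x \<in> N \<Longrightarrow> tailE \<star> f \<star> x = f \<star> S x"
  by (simp add: tailE_def tail_c_def app_lam type_of.simps(4))

lemma slice_eq [simp]:
  "f \<in> Dom M Ty1 \<Longrightarrow> x \<in> N \<Longrightarrow> y \<in> N \<Longrightarrow> sliceE \<star> f \<star> x \<star> y = S Z \<ominus> f \<star> (pairE \<star> x \<star> y)"
  by (simp add: sliceE_def slice_c_def app_lam type_of.simps(4))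

lemma sat_le [simp]: "sat M e bs (le s t) \<longleftrightarrow> ev M e bs s \<sqsubseteq> ev M e bs t"
  by (simp add: le_def)

lemma sat_less' [simp]: "sat M e bs (less s t) \<longleftrightarrow> ev M e bs s \<sqsubset> ev M e bs t"
  by (simp add: less_def)

definition seqle :: "'a \<Rightarrow> 'a \<Rightarrow> bool" where
  "seqle s t \<longleftrightarrow> lhE \<star> s = lhE \<star> t \<and> (\<forall>i\<in>N. i \<sqsubset> lhE \<star> t \<longrightarrow> nthE \<star> s \<star> i \<sqsubseteq> nthE \<star> t \<star> i)"

lemma sat_seq_le [simp]: "sat M e bs (seq_le s t) \<longleftrightarrow> seqle (ev M e bs s) (ev M e bs t)"
  by (simp add: seq_le_def seqle_def)

lemma sat_mem [simp]:
  "sat M e bs (mem \<sigma> z s) \<longleftrightarrow> (\<exists>i\<in>N. i \<sqsubset> Cn M (Len \<sigma>) \<star> ev M e bs s \<and>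
    equal M \<sigma> (ev M e bs z) (Cn M (Idx \<sigma>) \<star> ev M e bs s \<star> i))"
  by (simp add: mem_def sat_eq)

end

lemma wf_order_fms [simp]:
  "type_of \<Gamma> s = Some Ty0 \<Longrightarrow> type_of \<Gamma> t = Some Ty0 \<Longrightarrow> wf_fm \<Gamma> (le s t)"
  "type_of \<Gamma> s = Some Ty0 \<Longrightarrow> type_of \<Gamma> t = Some Ty0 \<Longrightarrow> wf_fm \<Gamma> (less s t)"
  "type_of \<Gamma> s = Some Ty0 \<Longrightarrow> type_of \<Gamma> t = Some Ty0 \<Longrightarrow> wf_fm \<Gamma> (seq_le s t)"
  "type_of \<Gamma> s = Some \<sigma> \<Longrightarrow> type_of \<Gamma> t = Some (Seq \<sigma>) \<Longrightarrow> wf_fm \<Gamma> (mem \<sigma> s t)"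
  by (simp_all add: le_def less_def seq_le_def mem_def type_of_lift wf_eq)

lemma xis_order_fms [simp]:
  "xis (le s t) = xis_tm s \<union> xis_tm t" "xis (less s t) = xis_tm s \<union> xis_tm t"
  "xis (seq_le s t) = xis_tm s \<union> xis_tm t"
  by (auto simp: le_def less_def seq_le_def)

lemma xis_mem: "xis (mem \<sigma> s t) \<subseteq> xis_tm s \<union> xis_tm t"
  using xis_eq[of \<sigma> "lift s" "Const (Idx \<sigma>) \<cdot> lift t \<cdot> Bound 0"] by (auto simp: mem_def)

lemma xis_mem_Nil [simp]: "xis_tm s = {} \<Longrightarrow> xis_tm t = {} \<Longrightarrow> xis (mem \<sigma> s t) = {}"
  using xis_mem[of \<sigma> s t] by auto

lemma internal_order_fms [simp]: "internal (le s t)" "internal (less s t)"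
  by (simp_all add: le_def less_def)

lemma rel_le [simp]: "rel (le s t) = le s t"
  by (simp add: le_def)

section \<open>Models of the nonstandard theory\<close>

locale omega_model = base_model L M for L and M :: "'a interp" +
  fixes spec :: spec and k :: nat
  assumes L: "L = lang spec"
    and spec_k: "spec k = Some (Ty2, suslin_spec)"
    and valid_axiom: "A \<in> RCA0_Omega spec \<union> {STP} \<Longrightarrow> is_fm L A \<Longrightarrow> valid M A"
begin

lemma sat_axiom: "A \<in> RCA0_Omega spec \<Longrightarrow> is_fm L A \<Longrightarrow> good M e \<Longrightarrow> sat M e [] A"
  using valid_axiom by (auto simp: valid_def)

lemma std_app:
  assumes "Std M (\<sigma> \<rightarrow> \<tau>) f" "Std M \<sigma> a" "f \<in> Dom M (\<sigma> \<rightarrow> \<tau>)" "a \<in> Dom M \<sigma>"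
  shows "Std M \<tau> (f \<star> a)"
  using sat_axiom[OF RCA0_Omega.st_app[of \<sigma> \<tau>], of "e0((0, \<sigma> \<rightarrow> \<tau>) := f, (1, \<sigma>) := a)"] assms
  by (simp add: is_fm_def)

lemma std_closed:
  assumes "type_of [] t = Some \<sigma>" "xis_tm t \<subseteq> L" "fv_tm t = {}"
  shows "Std M \<sigma> (ev M e [] t)"
proof -
  have "sat M e0 [] (St \<sigma> t)"
    using assms L by (intro sat_axiom RCA0_Omega.st_closed) (auto simp: is_tm_def is_fm_def)
  then show ?thesis using ev_closed[OF assms(1,3), of M e "[]" e0 "[]"] by simp
qed

lemma std_below: "x \<sqsubseteq> y \<Longrightarrow> Std M Ty0 y \<Longrightarrow> x \<in> N \<Longrightarrow> y \<in> N \<Longrightarrow> Std M Ty0 x"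
  using sat_axiom[OF RCA0_Omega.st_below, of "e0(xv := x, yv := y)"] by (simp add: is_fm_def)

lemma std_ev:
  "good M e \<Longrightarrow> type_of [] t = Some \<sigma> \<Longrightarrow> xis_tm t \<subseteq> L \<Longrightarrow>
    (\<And>v. v \<in> fv_tm t \<Longrightarrow> Std M (snd v) (e v)) \<Longrightarrow> Std M \<sigma> (ev M e [] t)"
proof (induction t arbitrary: \<sigma>)
  case (App s t)
  then obtain \<tau> where \<tau>: "type_of [] s = Some (\<tau> \<rightarrow> \<sigma>)" "type_of [] t = Some \<tau>" by auto
  then have "ev M e [] s \<in> Dom M (\<tau> \<rightarrow> \<sigma>)" "ev M e [] t \<in> Dom M \<tau>"
    using App.prems by (auto intro!: ev_in_Dom)
  moreover have "Std M (\<tau> \<rightarrow> \<sigma>) (ev M e [] s)" by (rule App.IH(1)[OF _ \<tau>(1)]) (use App.prems in auto)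
  moreover have "Std M \<tau> (ev M e [] t)" by (rule App.IH(2)[OF _ \<tau>(2)]) (use App.prems in auto)
  ultimately show ?case using std_app by simp
next
  case (Const c)
  then show ?case using std_closed[of "Const c" \<sigma> e] by simp
qed auto

lemma std_E:
  "Std M Ty1 predE" "Std M Ty1 sgE" "Std M Ty1 lhE"
  "Std M (Ty0 \<rightarrow> Ty0 \<rightarrow> Ty0) monusE" "Std M (Ty0 \<rightarrow> Ty0 \<rightarrow> Ty0) plusE"
  "Std M (Ty0 \<rightarrow> Ty0 \<rightarrow> Ty0) pairE" "Std M (Ty1 \<rightarrow> Ty0 \<rightarrow> Ty0) barE"
  "Std M (Ty1 \<rightarrow> Ty0 \<rightarrow> Ty0) searchE" "Std M (Ty1 \<rightarrow> Ty0 \<rightarrow> Ty0) sumE"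
  "Std M (Ty1 \<rightarrow> Ty1 \<rightarrow> Ty1) pathE" "Std M (Ty1 \<rightarrow> Ty1) compE" "Std M (Ty1 \<rightarrow> Ty1) tailE"
  "Std M (Ty1 \<rightarrow> Ty0 \<rightarrow> Ty1) sliceE"
  unfolding E_defs searchE_def sumE_def pathE_def compE_def tailE_def sliceE_def
  by (rule std_closed; simp)+

lemma std_const:
  "Std M Ty0 Z" "Std M Ty1 (Cn M Succ)" "Std M (Seq \<sigma> \<rightarrow> Ty0) (Cn M (Len \<sigma>))"
  "Std M (Seq \<sigma> \<rightarrow> Ty0 \<rightarrow> \<sigma>) (Cn M (Idx \<sigma>))" "Std M (\<rho> \<rightarrow> \<tau> \<rightarrow> \<rho>) (Cn M (KC \<rho> \<tau>))"
  "Std M ((\<sigma> \<rightarrow> \<rho> \<rightarrow> \<tau>) \<rightarrow> (\<sigma> \<rightarrow> \<rho>) \<rightarrow> \<sigma> \<rightarrow> \<tau>) (Cn M (SC \<sigma> \<rho> \<tau>))"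
  using std_closed[of zero Ty0] std_closed[of "Const Succ" Ty1] std_closed[of "Const (Len \<sigma>)"]
    std_closed[of "Const (Idx \<sigma>)"] std_closed[of "Const (KC \<rho> \<tau>)"] std_closed[of "Const (SC \<sigma> \<rho> \<tau>)"]
  by auto

lemma std_S: "n \<in> N \<Longrightarrow> Std M Ty0 n \<Longrightarrow> Std M Ty0 (S n)"
  using std_app[OF std_const(2)] const_Dom(2) by blast

text \<open>The standard counterpart of \<open>rep\<close>, for explicit definitions from standard
  parameters. The equation holds at all arguments and not only at standard ones.\<close>

definition srep :: "ty \<Rightarrow> ty \<Rightarrow> ('a \<Rightarrow> 'a) \<Rightarrow> bool" where
  "srep \<sigma> \<tau> F \<longleftrightarrow> (\<exists>h\<in>Dom M (\<sigma> \<rightarrow> \<tau>). Std M (\<sigma> \<rightarrow> \<tau>) h \<and> (\<forall>x\<in>Dom M \<sigma>. h \<star> x = F x))"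

lemma srep_const: "c \<in> Dom M \<tau> \<Longrightarrow> Std M \<tau> c \<Longrightarrow> srep \<sigma> \<tau> (\<lambda>x. c)"
  unfolding srep_def using Ap_Dom[OF const_Dom(4)] K_eq std_app[OF std_const(5) _ const_Dom(4)] by blast

lemma srep_id: "srep \<sigma> \<sigma> (\<lambda>x. x)"
proof -
  let ?h = "ev M e0 [] (lam (0, \<sigma>) (Var (0, \<sigma>)))"
  have "?h \<in> Dom M (\<sigma> \<rightarrow> \<sigma>)" by (rule ev_in_Dom) auto
  moreover have "?h \<star> x = x" if "x \<in> Dom M \<sigma>" for x
    using app_lam[of e0 "Var (0, \<sigma>)" x "(0, \<sigma>)"] that by simp
  moreover have "Std M (\<sigma> \<rightarrow> \<sigma>) ?h" by (rule std_closed) auto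
  ultimately show ?thesis unfolding srep_def by blast
qed

lemma srep_app:
  assumes "srep \<sigma> (\<rho> \<rightarrow> \<tau>) F" "srep \<sigma> \<rho> G"
  shows "srep \<sigma> \<tau> (\<lambda>x. F x \<star> G x)"
proof -
  obtain f g where fg: "f \<in> Dom M (\<sigma> \<rightarrow> \<rho> \<rightarrow> \<tau>)" "g \<in> Dom M (\<sigma> \<rightarrow> \<rho>)"
    "Std M (\<sigma> \<rightarrow> \<rho> \<rightarrow> \<tau>) f" "Std M (\<sigma> \<rightarrow> \<rho>) g"
    "\<And>x. x \<in> Dom M \<sigma> \<Longrightarrow> f \<star> x = F x" "\<And>x. x \<in> Dom M \<sigma> \<Longrightarrow> g \<star> x = G x"
    using assms unfolding srep_def by blast
  let ?S = "Cn M (SC \<sigma> \<rho> \<tau>)"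
  have 1: "?S \<star> f \<in> Dom M ((\<sigma> \<rightarrow> \<rho>) \<rightarrow> \<sigma> \<rightarrow> \<tau>)" "Std M ((\<sigma> \<rightarrow> \<rho>) \<rightarrow> \<sigma> \<rightarrow> \<tau>) (?S \<star> f)"
    using Ap_Dom[OF const_Dom(5) fg(1)] std_app[OF std_const(6) fg(3) const_Dom(5) fg(1)] by auto
  have "?S \<star> f \<star> g \<in> Dom M (\<sigma> \<rightarrow> \<tau>)" "Std M (\<sigma> \<rightarrow> \<tau>) (?S \<star> f \<star> g)"
    using Ap_Dom[OF 1(1) fg(2)] std_app[OF 1(2) fg(4) 1(1) fg(2)] by auto
  moreover have "?S \<star> f \<star> g \<star> x = F x \<star> G x" if "x \<in> Dom M \<sigma>" for x
    using fg that by simp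
  ultimately show ?thesis unfolding srep_def by blast
qed

lemmas srep_intros = srep_const srep_id srep_app E_Dom search_Dom path_Dom const_Dom std_E std_const

lemma std_path: "f \<in> Dom M Ty1 \<Longrightarrow> g \<in> Dom M Ty1 \<Longrightarrow> Std M Ty1 f \<Longrightarrow> Std M Ty1 g \<Longrightarrow> Std M Ty1 (pathE \<star> f \<star> g)"
  using std_app[OF std_app[OF std_E(10)], of f g] path_Dom(1) Ap_Dom by blast

lemma std_comp: "f \<in> Dom M Ty1 \<Longrightarrow> Std M Ty1 f \<Longrightarrow> Std M Ty1 (compE \<star> f)"
  using std_app[OF std_E(11)] path_Dom by blast


section \<open>Standard paths\<close>

definition has_path :: "'a \<Rightarrow> bool" where
  "has_path f \<longleftrightarrow> (\<exists>g\<in>Dom M Ty1. \<forall>x\<in>N. f \<star> (barE \<star> g \<star> x) \<noteq> Z)"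

text \<open>This is what relativisation makes of having a path: zeros are excluded at standard
  lengths only.\<close>

definition has_st_path :: "'a \<Rightarrow> bool" where
  "has_st_path f \<longleftrightarrow> (\<exists>g\<in>Dom M Ty1. Std M Ty1 g \<and> (\<forall>x\<in>N. Std M Ty0 x \<longrightarrow> f \<star> (barE \<star> g \<star> x) \<noteq> Z))"

text \<open>The contrapositive of transfer for the universal statement that a standard
  \<open>h\<close> has no zero.\<close>

definition transfer :: bool where
  "transfer \<longleftrightarrow> (\<forall>h\<in>Dom M Ty1. Std M Ty1 h \<longrightarrow> (\<exists>x\<in>N. h \<star> x = Z) \<longrightarrow> (\<exists>x\<in>N. Std M Ty0 x \<and> h \<star> x = Z))"

lemma st_path_transfer:
  assumes "transfer" "has_st_path f" "f \<in> Dom M Ty1" "Std M Ty1 f"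
  shows "\<exists>g\<in>Dom M Ty1. Std M Ty1 g \<and> (\<forall>x\<in>N. f \<star> (barE \<star> g \<star> x) \<noteq> Z)"
proof -
  obtain g where g: "g \<in> Dom M Ty1" "Std M Ty1 g" "\<And>x. x \<in> N \<Longrightarrow> Std M Ty0 x \<Longrightarrow> f \<star> (barE \<star> g \<star> x) \<noteq> Z"
    using assms(2) unfolding has_st_path_def by blast
  have "\<forall>x\<in>N. f \<star> (barE \<star> g \<star> x) \<noteq> Z"
    using assms(1)[unfolded transfer_def, rule_format, of "pathE \<star> f \<star> g"] g assms(3,4) std_path by auto
  then show ?thesis using g by blast
qed

lemma STP_D:
  assumes "X \<in> Dom M Ty1" "\<And>x. x \<in> N \<Longrightarrow> X \<star> x \<sqsubseteq> S Z"
  shows "\<exists>Y\<in>Dom M Ty1. Std M Ty1 Y \<and> (\<forall>x\<in>N. Y \<star> x \<sqsubseteq> S Z) \<and>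
    (\<forall>x\<in>N. Std M Ty0 x \<longrightarrow> (X \<star> x = S Z \<longleftrightarrow> Y \<star> x = S Z))"
proof -
  have "is_fm L STP" by (simp add: is_fm_def STP_def is_set_def Let_def)
  then have "sat M e0 [] STP" using valid_axiom[of STP] by (auto simp: valid_def)
  then show ?thesis using assms by (fastforce simp: STP_def is_set_def Let_def)
qed

text \<open>Since \<open>m\<close> is infinite, all standard positions lie inside \<open>s\<close>,
  and since \<open>p\<close> is standard, the entries there are below standard numbers, hence
  standard. The graph of \<open>s\<close> is therefore known at all standard pairs that matter, and
  a standard set with the same standard members determines a standard function.\<close>

lemma standard_path:
  assumes "p \<in> Dom M Ty1" "Std M Ty1 p" "m \<in> N" "\<not> Std M Ty0 m" "s \<in> N" "seqle s (barE \<star> p \<star> m)"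
    and f: "\<And>x. x \<in> N \<Longrightarrow> x \<sqsubseteq> m \<Longrightarrow> f \<star> (initE \<star> s \<star> x) \<noteq> Z"
  shows "has_st_path f"
proof -
  have lh: "lhE \<star> s = m" and bound: "\<And>i. i \<in> N \<Longrightarrow> i \<sqsubset> m \<Longrightarrow> nthE \<star> s \<star> i \<sqsubseteq> p \<star> i"
    using assms(1,3,6) nth_bar[OF assms(1) _ assms(3)] by (auto simp: seqle_def)
  have below: "x \<sqsubset> m" if "x \<in> N" "Std M Ty0 x" for x
    using not_le[of m x] std_below[of m x] that assms(3,4) by blast
  \<comment> \<open>The graph of \<open>s\<close> as a binary function on pairs: the sum of the two
    cut-off differences vanishes exactly if the entry equals the second component.\<close>
  let ?F = "\<lambda>z. S Z \<ominus> ((nthE \<star> s \<star> (pfstE \<star> z) \<ominus> psndE \<star> z) \<oplus> (psndE \<star> z \<ominus> nthE \<star> s \<star> (pfstE \<star> z)))"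
  have "rep Ty0 Ty0 ?F" by (rule qf | fact)+
  then obtain X where X: "X \<in> Dom M Ty1" "\<And>z. z \<in> N \<Longrightarrow> X \<star> z = ?F z" unfolding rep_def by blast
  have "X \<star> z \<sqsubseteq> S Z" if "z \<in> N" for z
    unfolding X(2)[OF that] using that assms(5) by (intro monus_le) auto
  then obtain Y where Y: "Y \<in> Dom M Ty1" "Std M Ty1 Y" "\<And>x. x \<in> N \<Longrightarrow> Y \<star> x \<sqsubseteq> S Z"
    "\<And>x. x \<in> N \<Longrightarrow> Std M Ty0 x \<Longrightarrow> X \<star> x = S Z \<longleftrightarrow> Y \<star> x = S Z"
    using STP_D[OF X(1)] by blast
  have XY: "Y \<star> (pairE \<star> i \<star> j) = S Z \<longleftrightarrow> nthE \<star> s \<star> i = j"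
    if "i \<in> N" "j \<in> N" "Std M Ty0 i" "Std M Ty0 j" for i j
  proof -
    have N: "nthE \<star> s \<star> i \<in> N" using that assms(5) by simp
    have "Std M Ty0 (pairE \<star> i \<star> j)"
      using that std_app[OF std_app[OF std_E(6)], of i j] E_Dom app2_Dom by blast
    then have "Y \<star> (pairE \<star> i \<star> j) = S Z \<longleftrightarrow> X \<star> (pairE \<star> i \<star> j) = S Z" using Y(4) that by simp
    also have "\<dots> \<longleftrightarrow> S Z \<ominus> ((nthE \<star> s \<star> i \<ominus> j) \<oplus> (j \<ominus> nthE \<star> s \<star> i)) = S Z"
      using X(2) that by simp
    also have "\<dots> \<longleftrightarrow> (nthE \<star> s \<star> i \<ominus> j) \<oplus> (j \<ominus> nthE \<star> s \<star> i) = Z"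
    proof -
      have "a = Z \<longleftrightarrow> S Z \<ominus> a = S Z" if "a \<in> N" for a
        using that by (cases rule: N_cases) auto
      then show ?thesis using N that by simp
    qed
    also have "\<dots> \<longleftrightarrow> nthE \<star> s \<star> i = j"
      using N that le_antisym[of "nthE \<star> s \<star> i" j] by (auto simp: plus_eq_Z)
    finally show ?thesis .
  qed
  \<comment> \<open>Bounding the search by \<open>p\<close> defines the function from standard
    objects alone.\<close>
  have "srep Ty0 Ty0 (\<lambda>n. searchE \<star> (sliceE \<star> Y \<star> n) \<star> (p \<star> n))"
    by (rule srep_intros | fact)+
  then obtain g where g: "g \<in> Dom M Ty1" "Std M Ty1 g"
    "\<And>n. n \<in> N \<Longrightarrow> g \<star> n = searchE \<star> (sliceE \<star> Y \<star> n) \<star> (p \<star> n)"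
    unfolding srep_def by blast
  have g_eq: "g \<star> i = nthE \<star> s \<star> i" if i: "i \<in> N" "Std M Ty0 i" for i
  proof -
    let ?h = "sliceE \<star> Y \<star> i" and ?j = "nthE \<star> s \<star> i"
    have h: "?h \<in> Dom M Ty1" using Y i by simp
    have N: "?j \<in> N" "p \<star> i \<in> N" using i assms by simp_all
    have one: "a = S Z" if "a \<in> N" "a \<sqsubseteq> S Z" "S Z \<ominus> a = Z" for a
      using that le_antisym[of a "S Z"] by simp
    have std: "Std M Ty0 (p \<star> i)" using std_app assms(1,2) i by blast
    have j: "?j \<sqsubseteq> p \<star> i" using bound below i by blast
    then have "Std M Ty0 ?j" using std_below std N by blast
    then have "?h \<star> ?j = Z" using XY[of i ?j] i N Y by simp
    then have *: "?h \<star> (g \<star> i) = Z" using search_zero[OF h N(1) _ N(2)] j g(3) i by simp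
    \<comment> \<open>The value found is below a standard number as well, so its membership in
      \<open>Y\<close> goes back to the graph \<open>X\<close> and identifies it with the entry of
      \<open>s\<close>.\<close>
    have "g \<star> i \<sqsubseteq> p \<star> i" using search_le[OF h N(2)] g(3) i by simp
    then have "Std M Ty0 (g \<star> i)" using std_below[OF _ std app_N[OF g(1) i(1)] N(2)] by blast
    moreover have "Y \<star> (pairE \<star> i \<star> (g \<star> i)) = S Z" using * Y i g(1) by (intro one) auto
    ultimately show ?thesis using XY[OF i(1) app_N[OF g(1) i(1)] i(2)] by metis
  qed
  have "f \<star> (barE \<star> g \<star> x) \<noteq> Z" if x: "x \<in> N" "Std M Ty0 x" for x
  proof -
    have nth: "nthE \<star> s \<in> Dom M Ty1" using assms(5) by simp
    have "g \<star> i = nthE \<star> s \<star> i" if "i \<in> N" "i \<sqsubset> x" for i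
      using g_eq that std_below[of i x] lt_imp_le x by blast
    then have "barE \<star> g \<star> x = barE \<star> (nthE \<star> s) \<star> x"
      using bar_cong[OF g(1) nth x(1) _ x(1)] x by simp
    moreover have "x \<sqsubseteq> m" using below[OF x] lt_imp_le x assms(3) by blast
    ultimately show ?thesis using bar_nth[OF assms(5) x(1)] f[OF x(1)] lh by simp
  qed
  then show ?thesis using g unfolding has_st_path_def by blast
qed


section \<open>Herbrandised choice and monotone bounds\<close>

text \<open>\<open>HAC_int\<close> bounds the choice of paths by a sequence, and it accepts internal
  formulas only; this is why the premise asks for paths at all lengths instead of all standard
  ones.\<close>

lemma HAC_paths:
  assumes "\<And>f. f \<in> Dom M Ty1 \<Longrightarrow> Std M Ty1 f \<Longrightarrow> has_path f \<Longrightarrow>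
    \<exists>g\<in>Dom M Ty1. Std M Ty1 g \<and> (\<forall>x\<in>N. f \<star> (barE \<star> g \<star> x) \<noteq> Z)"
  shows "\<exists>\<Theta>\<in>Dom M (Ty1 \<rightarrow> Seq Ty1). Std M (Ty1 \<rightarrow> Seq Ty1) \<Theta> \<and>
    (\<forall>f\<in>Dom M Ty1. Std M Ty1 f \<longrightarrow> has_path f \<longrightarrow>
      (\<exists>i\<in>N. i \<sqsubset> Cn M (Len Ty1) \<star> (\<Theta> \<star> f) \<and>
        (\<forall>x\<in>N. f \<star> (barE \<star> (Cn M (Idx Ty1) \<star> (\<Theta> \<star> f) \<star> i) \<star> x) \<noteq> Z)))"
proof -
  define f g h where "f = (1::nat, Ty1)" and "g = (2::nat, Ty1)" and "h = (3::nat, Ty1)"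
  let ?P = "\<lambda>v. all xv (\<^bold>\<not> (Var f \<cdot> (bar_c \<cdot> Var v \<cdot> Var xv) \<approx> zero))"
  \<comment> \<open>The guard makes the formula satisfiable for every standard function. Where there
    is no path, any standard function will do, and \<open>predE\<close> is taken below.\<close>
  let ?A = "ex h (?P h) \<^bold>\<longrightarrow> ?P g"
  let ?F = "(4::nat, Ty1 \<rightarrow> Seq Ty1)"
  note defs = f_def g_def h_def
  have wf: "wf_fm [] ?A" by (simp add: defs)
  have A: "is_fm L ?A" using wf by (simp add: is_fm_def)
  let ?H = "all_st f (ex_st g ?A) \<^bold>\<longrightarrow> ex_st ?F (all_st f (ex g (mem Ty1 (Var g) (Var ?F \<cdot> Var f) \<^bold>\<and> ?A)))"
  have "?H \<in> RCA0_Omega spec"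
    by (rule RCA0_Omega.HAC_int) (use A L in \<open>auto simp: defs\<close>)
  moreover have "is_fm L ?H" using wf by (simp add: is_fm_def defs)
  ultimately have H: "sat M e0 [] ?H" by (intro sat_axiom) auto
  have "\<exists>b\<in>Dom M Ty1. Std M Ty1 b \<and> (has_path a \<longrightarrow> (\<forall>x\<in>N. a \<star> (barE \<star> b \<star> x) \<noteq> Z))"
    if "a \<in> Dom M Ty1" "Std M Ty1 a" for a
    using assms[OF that] E_Dom(1) std_E(1) by blast
  then have "sat M e0 [] (all_st f (ex_st g ?A))"
    using wf by (simp add: defs has_path_def)
  then obtain \<Theta> where \<Theta>: "\<Theta> \<in> Dom M (Ty1 \<rightarrow> Seq Ty1)" "Std M (Ty1 \<rightarrow> Seq Ty1) \<Theta>"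
    and "sat M (e0(?F := \<Theta>)) [] (all_st f (ex g (mem Ty1 (Var g) (Var ?F \<cdot> Var f) \<^bold>\<and> ?A)))"
    using H wf by (auto simp: defs)
  then have *: "\<exists>b\<in>Dom M Ty1. (\<exists>i\<in>N. i \<sqsubset> Cn M (Len Ty1) \<star> (\<Theta> \<star> a) \<and>
      equal M Ty1 b (Cn M (Idx Ty1) \<star> (\<Theta> \<star> a) \<star> i)) \<and>
      (has_path a \<longrightarrow> (\<forall>x\<in>N. a \<star> (barE \<star> b \<star> x) \<noteq> Z))"
    if "a \<in> Dom M Ty1" "Std M Ty1 a" for a
    using that by (simp add: defs has_path_def del: equal.simps) blast
  show ?thesis
  proof (rule bexI[of _ \<Theta>], intro conjI ballI HOL.impI)
    fix a assume a: "a \<in> Dom M Ty1" "Std M Ty1 a" "has_path a"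
    then obtain b i where b: "b \<in> Dom M Ty1" "i \<in> N" "i \<sqsubset> Cn M (Len Ty1) \<star> (\<Theta> \<star> a)"
      "equal M Ty1 b (Cn M (Idx Ty1) \<star> (\<Theta> \<star> a) \<star> i)" "\<forall>x\<in>N. a \<star> (barE \<star> b \<star> x) \<noteq> Z"
      using * by blast
    have "Cn M (Idx Ty1) \<star> (\<Theta> \<star> a) \<star> i \<in> Dom M Ty1"
      using \<Theta>(1) a(1) b(2) const_Dom(7) by (blast intro: Ap_Dom)
    then have "b = Cn M (Idx Ty1) \<star> (\<Theta> \<star> a) \<star> i" using b(1,4) equal_iff by blast
    then show "\<exists>i\<in>N. i \<sqsubset> Cn M (Len Ty1) \<star> (\<Theta> \<star> a) \<and>
        (\<forall>x\<in>N. a \<star> (barE \<star> (Cn M (Idx Ty1) \<star> (\<Theta> \<star> a) \<star> i) \<star> x) \<noteq> Z)"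
      using b by blast
  qed (use \<Theta> in auto)
qed

text \<open>The sum of the finitely many candidates provided by \<open>HAC_int\<close> bounds the right one.\<close>

lemma HAC_zeros:
  assumes "transfer"
  shows "\<exists>b\<in>Dom M Ty2. Std M Ty2 b \<and>
    (\<forall>h\<in>Dom M Ty1. Std M Ty1 h \<longrightarrow> (\<exists>x\<in>N. h \<star> x = Z) \<longrightarrow> (\<exists>x\<in>N. x \<sqsubseteq> b \<star> h \<and> h \<star> x = Z))"
proof -
  define h n where "h = (1::nat, Ty1)" and "n = (1::nat, Ty0)"
  let ?A = "ex xv (Var h \<cdot> Var xv \<approx> zero) \<^bold>\<longrightarrow> Var h \<cdot> Var n \<approx> zero"
  let ?F = "(4::nat, Ty1 \<rightarrow> Seq Ty0)"
  note defs = h_def n_def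
  have wf: "wf_fm [] ?A" by (simp add: defs)
  have A: "is_fm L ?A" using wf by (simp add: is_fm_def)
  let ?H = "all_st h (ex_st n ?A) \<^bold>\<longrightarrow> ex_st ?F (all_st h (ex n (mem Ty0 (Var n) (Var ?F \<cdot> Var h) \<^bold>\<and> ?A)))"
  have "?H \<in> RCA0_Omega spec"
    by (rule RCA0_Omega.HAC_int) (use A L in \<open>auto simp: defs\<close>)
  moreover have "is_fm L ?H" using wf by (simp add: is_fm_def defs)
  ultimately have H: "sat M e0 [] ?H" by (intro sat_axiom) auto
  have "\<exists>x\<in>N. Std M Ty0 x \<and> ((\<exists>x\<in>N. a \<star> x = Z) \<longrightarrow> a \<star> x = Z)" if "a \<in> Dom M Ty1" "Std M Ty1 a" for a
    using assms that std_const(1) Z_N unfolding transfer_def by blast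
  then have "sat M e0 [] (all_st h (ex_st n ?A))"
    using wf by (simp add: defs)
  then obtain \<Theta> where \<Theta>: "\<Theta> \<in> Dom M (Ty1 \<rightarrow> Seq Ty0)" "Std M (Ty1 \<rightarrow> Seq Ty0) \<Theta>"
    and "sat M (e0(?F := \<Theta>)) [] (all_st h (ex n (mem Ty0 (Var n) (Var ?F \<cdot> Var h) \<^bold>\<and> ?A)))"
    using H wf by (auto simp: defs)
  then have *: "\<exists>i\<in>N. i \<sqsubset> Cn M (Len Ty0) \<star> (\<Theta> \<star> a) \<and>
      ((\<exists>x\<in>N. a \<star> x = Z) \<longrightarrow> a \<star> (Cn M (Idx Ty0) \<star> (\<Theta> \<star> a) \<star> i) = Z)"
    if "a \<in> Dom M Ty1" "Std M Ty1 a" for a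
    using that by (simp add: defs) blast
  have "srep Ty1 Ty0 (\<lambda>a. sumE \<star> (Cn M (Idx Ty0) \<star> (\<Theta> \<star> a)) \<star> (Cn M (Len Ty0) \<star> (\<Theta> \<star> a)))"
    by (rule srep_intros | fact)+
  then obtain b where b: "b \<in> Dom M Ty2" "Std M Ty2 b"
    "\<And>a. a \<in> Dom M Ty1 \<Longrightarrow> b \<star> a = sumE \<star> (Cn M (Idx Ty0) \<star> (\<Theta> \<star> a)) \<star> (Cn M (Len Ty0) \<star> (\<Theta> \<star> a))"
    unfolding srep_def by blast
  show ?thesis
  proof (rule bexI[of _ b], intro conjI ballI HOL.impI)
    fix a assume a: "a \<in> Dom M Ty1" "Std M Ty1 a" "\<exists>x\<in>N. a \<star> x = Z"
    obtain i where i: "i \<in> N" "i \<sqsubset> Cn M (Len Ty0) \<star> (\<Theta> \<star> a)" "a \<star> (Cn M (Idx Ty0) \<star> (\<Theta> \<star> a) \<star> i) = Z"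
      using * a by blast
    have \<Theta>a: "\<Theta> \<star> a \<in> Dom M (Seq Ty0)" using \<Theta>(1) a(1) by (rule Ap_Dom)
    then have idx: "Cn M (Idx Ty0) \<star> (\<Theta> \<star> a) \<in> Dom M Ty1" and len: "Cn M (Len Ty0) \<star> (\<Theta> \<star> a) \<in> N"
      using const_Dom(6,7) by (blast intro: Ap_Dom)+
    have "Cn M (Idx Ty0) \<star> (\<Theta> \<star> a) \<star> i \<sqsubseteq> b \<star> a"
      using sum_ge[OF idx i(1) len] i(2) b(3)[OF a(1)] by simp
    then show "\<exists>x\<in>N. x \<sqsubseteq> b \<star> a \<and> a \<star> x = Z" using i idx app_N by blast
  qed (use b in auto)
qed

text \<open>Idealization for the relation \<open>z \<sqsubset> y\<close>: a finite sequence of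
  numbers is bounded by the successor of its sum, so some number exceeds all standard ones, and it
  cannot exceed itself.\<close>

lemma ex_nonstandard: "\<exists>m\<in>N. \<not> Std M Ty0 m"
proof -
  define z y x where "z = (0::nat, Ty0)" and "y = (1::nat, Ty0)" and "x = (0::nat, Seq Ty0)"
  note defs = z_def y_def x_def
  let ?A = "less (Var z) (Var y)"
  have wf: "wf_fm [] ?A" by (simp add: defs)
  have A: "is_fm L ?A" using wf by (simp add: is_fm_def)
  let ?I = "all_st x (ex y (all z (mem Ty0 (Var z) (Var x) \<^bold>\<longrightarrow> ?A))) \<^bold>\<longrightarrow> ex y (all_st z ?A)"
  have "?I \<in> RCA0_Omega spec"
    by (rule RCA0_Omega.idealization) (use A L in \<open>auto simp: defs less_def le_def\<close>)
  moreover have "is_fm L ?I" using wf by (simp add: is_fm_def defs)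
  ultimately have I: "sat M e0 [] ?I" by (intro sat_axiom) auto
  have "\<exists>u\<in>N. \<forall>i\<in>N. i \<sqsubset> Cn M (Len Ty0) \<star> s \<longrightarrow> Cn M (Idx Ty0) \<star> s \<star> i \<sqsubset> u" if s: "s \<in> Dom M (Seq Ty0)" for s
  proof -
    have idx: "Cn M (Idx Ty0) \<star> s \<in> Dom M Ty1" and len: "Cn M (Len Ty0) \<star> s \<in> N"
      using s const_Dom(6,7) by (blast intro: Ap_Dom)+
    then show ?thesis
      using sum_ge[OF idx _ len] by (intro bexI[of _ "S (sumE \<star> (Cn M (Idx Ty0) \<star> s) \<star> (Cn M (Len Ty0) \<star> s))"]) auto
  qed
  then have "sat M e0 [] (all_st x (ex y (all z (mem Ty0 (Var z) (Var x) \<^bold>\<longrightarrow> ?A))))"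
    using wf by (fastforce simp: defs)
  then obtain m where "m \<in> N" "\<forall>i\<in>N. Std M Ty0 i \<longrightarrow> i \<sqsubset> m"
    using I wf by (auto simp: defs)
  then show ?thesis using not_lt_self by blast
qed

section \<open>Semantic form of the two sides\<close>

definition "S2_st \<longleftrightarrow> (\<exists>F\<in>Dom M Ty2. Std M Ty2 F \<and>
  (\<forall>f\<in>Dom M Ty1. Std M Ty1 f \<longrightarrow> (F \<star> f = Z \<longleftrightarrow> has_st_path f)))"

definition "bounded_search p f m \<longleftrightarrow>
  (\<forall>s\<in>N. seqle s (barE \<star> p \<star> m) \<longrightarrow> (\<exists>x\<in>N. x \<sqsubseteq> m \<and> f \<star> (initE \<star> s \<star> x) = Z))"

definition "RB_sem \<longleftrightarrow> (\<exists>\<Phi>\<in>Dom M (Ty1 \<rightarrow> Ty1). Std M (Ty1 \<rightarrow> Ty1) \<Phi> \<and>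
  (\<forall>f\<in>Dom M Ty1. Std M Ty1 f \<longrightarrow> (\<forall>m\<in>N. \<not> Std M Ty0 m \<longrightarrow>
    (bounded_search (\<Phi> \<star> f) f m \<longleftrightarrow> \<not> has_path f))))"

lemma sat_S2: "sat M e [] (rel S2) \<longleftrightarrow> S2_st"
  by (simp add: S2_def suslin_def Let_def S2_st_def has_st_path_def)
    (intro bex_cong ball_cong conj_cong imp_cong refl, blast)

lemma sat_RB: "sat M e [] RB \<longleftrightarrow> RB_sem"
  by (simp add: RB_def Let_def RB_sem_def bounded_search_def has_path_def)
    (intro bex_cong ball_cong conj_cong imp_cong refl, blast)

lemma no_bounded_search:
  assumes "\<not> bounded_search p f m" "p \<in> Dom M Ty1" "Std M Ty1 p" "m \<in> N" "\<not> Std M Ty0 m"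
  shows "has_st_path f"
  using assms standard_path[of p m _ f] unfolding bounded_search_def by blast

text \<open>A sum dominates each of its terms. It runs over the index of the candidate while the
  argument stays fixed, so the index is abstracted inside the argument.\<close>

lemma std_path_bound:
  assumes "\<Theta> \<in> Dom M (Ty1 \<rightarrow> Seq Ty1)" "Std M (Ty1 \<rightarrow> Seq Ty1) \<Theta>"
  shows "\<exists>\<Psi>\<in>Dom M (Ty1 \<rightarrow> Ty1). Std M (Ty1 \<rightarrow> Ty1) \<Psi> \<and>
    (\<forall>f\<in>Dom M Ty1. \<forall>i\<in>N. i \<sqsubset> Cn M (Len Ty1) \<star> (\<Theta> \<star> f) \<longrightarrow>
      (\<forall>n\<in>N. Cn M (Idx Ty1) \<star> (\<Theta> \<star> f) \<star> i \<star> n \<sqsubseteq> \<Psi> \<star> f \<star> n))"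
proof -
  let ?\<theta> = "Var (4, Ty1 \<rightarrow> Seq Ty1) \<cdot> Var (1, Ty1)"
  let ?h = "lam yv (Const (Idx Ty1) \<cdot> ?\<theta> \<cdot> Var yv \<cdot> Var xv)"
  let ?t = "lam (1, Ty1) (lam xv (sum_c \<cdot> ?h \<cdot> (Const (Len Ty1) \<cdot> ?\<theta>)))"
  define e where "e = e0((4, Ty1 \<rightarrow> Seq Ty1) := \<Theta>)"
  have e: "good M e" "e (4, Ty1 \<rightarrow> Seq Ty1) = \<Theta>" using assms by (simp_all add: e_def)
  let ?\<Psi> = "ev M e [] ?t"
  have "?\<Psi> \<in> Dom M (Ty1 \<rightarrow> Ty1)" using e by (intro ev_in_Dom) (auto simp: type_of.simps(4))
  moreover have "Std M (Ty1 \<rightarrow> Ty1) ?\<Psi>"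
    using e assms by (intro std_ev) (auto simp: type_of.simps(4))
  moreover have "Cn M (Idx Ty1) \<star> (\<Theta> \<star> f) \<star> i \<star> n \<sqsubseteq> ?\<Psi> \<star> f \<star> n"
    if f: "f \<in> Dom M Ty1" and i: "i \<in> N" "i \<sqsubset> Cn M (Len Ty1) \<star> (\<Theta> \<star> f)" and n: "n \<in> N" for f i n
  proof -
    let ?e = "e((1, Ty1) := f, xv := n)"
    have len: "Cn M (Len Ty1) \<star> (\<Theta> \<star> f) \<in> N"
      using const_Dom(6) assms(1) f by (blast intro: Ap_Dom)
    have good: "good M ?e" using e f n by simp
    have h: "ev M ?e [] ?h \<in> Dom M Ty1" using good by (intro ev_in_Dom) (auto simp: type_of.simps(4))
    have "?\<Psi> \<star> f \<star> n = sumE \<star> ev M ?e [] ?h \<star> (Cn M (Len Ty1) \<star> (\<Theta> \<star> f))"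
      using e f n by (simp add: app_lam type_of.simps(4))
    moreover have "ev M ?e [] ?h \<star> i = Cn M (Idx Ty1) \<star> (\<Theta> \<star> f) \<star> i \<star> n"
      using e good i by (simp add: app_lam type_of.simps(4))
    ultimately show ?thesis using sum_ge[OF h i(1) len] i(2) by simp
  qed
  ultimately show ?thesis by blast
qed


section \<open>From the Suslin functional to the bound\<close>

lemma PF_TP_D:
  assumes "internal A" "is_fm L A" "fv A \<subseteq> {v}"
    and "\<And>a. a \<in> Dom M (snd v) \<Longrightarrow> Std M (snd v) a \<Longrightarrow> sat M (e0(v := a)) [] A"
  shows "a \<in> Dom M (snd v) \<Longrightarrow> sat M (e0(v := a)) [] A"
proof -
  have "sat M e0 [] (all_st v A \<^bold>\<longrightarrow> all v A)"
    using assms(1-3) L by (intro sat_axiom RCA0_Omega.PF_TP) (auto simp: is_fm_def)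
  then show "a \<in> Dom M (snd v) \<Longrightarrow> sat M (e0(v := a)) [] A"
    using assms(2,4) by (simp add: is_fm_def)
qed

abbreviation "\<Xi> \<equiv> Cn M (Xi k Ty2)"

lemma Xi_L: "(k, Ty2) \<in> L"
  using L spec_k by (simp add: lang_def)

lemma Xi_std:
  assumes "S2_st"
  shows "Std M Ty2 \<Xi>" "\<And>f. f \<in> Dom M Ty1 \<Longrightarrow> Std M Ty1 f \<Longrightarrow> \<Xi> \<star> f = Z \<longleftrightarrow> has_st_path f"
proof -
  let ?A = "St Ty2 (Const (Xi k Ty2)) \<^bold>\<and>
    all_st (0, Ty2) (rel suslin_spec \<^bold>\<longrightarrow> rel (eq Ty2 (Const (Xi k Ty2)) (Var (0, Ty2))))"
  have wf_spec: "wf_fm [] suslin_spec"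
    by (simp add: suslin_spec_def suslin_def Let_def)
  then have wf: "wf_fm [] ?A" by simp
  have "xis ?A \<subseteq> L" using Xi_L by (simp add: suslin_spec_def suslin_def Let_def)
  then have "sat M e0 [] ?A"
    using wf spec_k by (intro sat_axiom RCA0_Omega.standard_Xi) (auto simp: is_fm_def)
  then have std: "Std M Ty2 \<Xi>" and "sat M e0 [] (all_st (0, Ty2) (rel suslin_spec \<^bold>\<longrightarrow> rel (eq Ty2 (Const (Xi k Ty2)) (Var (0, Ty2)))))"
    by simp_all
  then have spec: "sat M (e0(Sv := F)) [] (rel suslin_spec) \<Longrightarrow> \<forall>f\<in>Dom M Ty1. Std M Ty1 f \<longrightarrow> \<Xi> \<star> f = F \<star> f"
    if "F \<in> Dom M Ty2" "Std M Ty2 F" for F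
    using that wf_spec by simp
  have suslin: "sat M (e0(Sv := F)) [] (rel suslin) \<longleftrightarrow> (\<forall>f\<in>Dom M Ty1. Std M Ty1 f \<longrightarrow> (F \<star> f = Z \<longleftrightarrow> has_st_path f))" for F
    by (simp add: suslin_def Let_def has_st_path_def) (intro ball_cong imp_cong refl, blast)
  have uniq: "\<And>F. F \<in> Dom M Ty2 \<Longrightarrow> Std M Ty2 F \<Longrightarrow>
      (\<forall>f\<in>Dom M Ty1. Std M Ty1 f \<longrightarrow> (F \<star> f = Z \<longleftrightarrow> has_st_path f)) \<Longrightarrow>
      (\<forall>f\<in>Dom M Ty1. Std M Ty1 f \<longrightarrow> F \<star> f \<sqsubseteq> S Z) \<Longrightarrow>
      (\<forall>f\<in>Dom M Ty1. Std M Ty1 f \<longrightarrow> \<Xi> \<star> f = F \<star> f)"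
    using spec suslin by (simp add: suslin_spec_def Let_def)
  obtain F where F: "F \<in> Dom M Ty2" "Std M Ty2 F"
    "\<And>f. f \<in> Dom M Ty1 \<Longrightarrow> Std M Ty1 f \<Longrightarrow> F \<star> f = Z \<longleftrightarrow> has_st_path f"
    using assms unfolding S2_st_def by blast
  \<comment> \<open>The functional from \<open>S2_st\<close> may take any nonzero values, whereas
    the specification of \<open>\<Xi>\<close> demands 1; the sign function normalises them.\<close>
  have "srep Ty1 Ty0 (\<lambda>f. sgE \<star> (F \<star> f))" by (rule srep_intros | fact)+
  then obtain G where G: "G \<in> Dom M Ty2" "Std M Ty2 G" "\<And>f. f \<in> Dom M Ty1 \<Longrightarrow> G \<star> f = sgE \<star> (F \<star> f)"
    unfolding srep_def by blast
  have sg: "sgE \<star> a = Z \<longleftrightarrow> a = Z" "sgE \<star> a \<sqsubseteq> S Z" if "a \<in> N" for a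
    using that sg_nonzero[OF that] by (cases "a = Z"; simp)+
  have FN: "F \<star> f \<in> N" if "f \<in> Dom M Ty1" for f using F(1) that by (rule Ap_Dom)
  have GF: "G \<star> f = Z \<longleftrightarrow> has_st_path f" "G \<star> f \<sqsubseteq> S Z" if "f \<in> Dom M Ty1" "Std M Ty1 f" for f
    using G(3) F(3) sg[OF FN] that by auto
  have "\<forall>f\<in>Dom M Ty1. Std M Ty1 f \<longrightarrow> \<Xi> \<star> f = G \<star> f"
    by (rule uniq[OF G(1,2)]) (use GF in auto)
  then show "\<And>f. f \<in> Dom M Ty1 \<Longrightarrow> Std M Ty1 f \<Longrightarrow> \<Xi> \<star> f = Z \<longleftrightarrow> has_st_path f"
    using GF by simp
  show "Std M Ty2 \<Xi>" by (fact std)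
qed

lemma has_st_path_comp:
  assumes "h \<in> Dom M Ty1"
  shows "has_st_path (compE \<star> h) \<longleftrightarrow> (\<forall>x\<in>N. Std M Ty0 x \<longrightarrow> h \<star> x \<noteq> Z)"
proof
  assume "\<forall>x\<in>N. Std M Ty0 x \<longrightarrow> h \<star> x \<noteq> Z"
  then show "has_st_path (compE \<star> h)"
    \<comment> \<open>Any standard function serves as the path, here \<open>predE\<close>, because
      \<open>compE \<star> h\<close> sees nothing but lengths.\<close>
    unfolding has_st_path_def using assms E_Dom(1) std_E(1) by (intro bexI[of _ predE]) auto
qed (use assms in \<open>auto simp: has_st_path_def\<close>)

text \<open>\<open>PF_TP\<close> allows a single variable, so a number and a function, and below a pair of functions,
  are packed into one object.\<close>

lemma transfer_Xi:
  assumes "S2_st"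
  shows "transfer"
  unfolding transfer_def
proof (intro ballI HOL.impI)
  fix h assume h: "h \<in> Dom M Ty1" "Std M Ty1 h" "\<exists>x\<in>N. h \<star> x = Z"
  then obtain x where x: "x \<in> N" "h \<star> x = Z" by blast
  \<comment> \<open>Read \<open>w\<close> as the number \<open>w \<star> Z\<close> together with the
    function \<open>tailE \<star> w\<close>: a zero of the function at this number makes
    \<open>\<Xi>\<close> deny a path. For standard \<open>w\<close> the zero is standard and
    \<open>Xi_std\<close> applies; \<open>PF_TP\<close> then admits nonstandard zeros.\<close>
  let ?A = "tail_c \<cdot> Var gv \<cdot> (Var gv \<cdot> zero) \<approx> zero \<^bold>\<longrightarrow>
    \<^bold>\<not> (Const (Xi k Ty2) \<cdot> (comp_c \<cdot> (tail_c \<cdot> Var gv)) \<approx> zero)"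
  have sat_A: "sat M (e0(gv := w)) [] ?A \<longleftrightarrow> (tailE \<star> w \<star> (w \<star> Z) = Z \<longrightarrow> \<Xi> \<star> (compE \<star> (tailE \<star> w)) \<noteq> Z)" for w
    by simp
  have "sat M (e0(gv := w)) [] ?A" if w: "w \<in> Dom M Ty1" for w
  proof (rule PF_TP_D)
    show "is_fm L ?A" using Xi_L by (simp add: is_fm_def)
  next
    fix w assume w: "w \<in> Dom M (snd gv)" "Std M (snd gv) w"
    then have "Std M Ty1 (tailE \<star> w)" "Std M Ty0 (w \<star> Z)"
      using std_app[OF std_E(12)] path_Dom(3) std_app[of Ty0 Ty0 w Z] std_const(1) by auto
    then have "\<Xi> \<star> (compE \<star> (tailE \<star> w)) \<noteq> Z" if "tailE \<star> w \<star> (w \<star> Z) = Z"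
      using that w Xi_std(2)[OF assms, of "compE \<star> (tailE \<star> w)"] std_comp has_st_path_comp[of "tailE \<star> w"]
      by (auto simp del: tail_eq)
    then show "sat M (e0(gv := w)) [] ?A" unfolding sat_A by blast
  qed (use w in auto)
  \<comment> \<open>The value \<open>x\<close> followed by \<open>h\<close>. As \<open>x\<close> may
    be nonstandard, so may \<open>w\<close>, which is where transfer does its work.\<close>
  moreover have "rep Ty0 Ty0 (\<lambda>n. condE \<star> n \<star> x \<star> (h \<star> (predE \<star> n)))" by (rule qf | fact)+
  then obtain w where w: "w \<in> Dom M Ty1" "\<And>n. n \<in> N \<Longrightarrow> w \<star> n = condE \<star> n \<star> x \<star> (h \<star> (predE \<star> n))"
    unfolding rep_def by blast
  have "tailE \<star> w = h"
    by (rule fun_eqI[of _ Ty0 Ty0]) (use w h x in auto)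
  moreover have "w \<star> Z = x" using w h x by simp
  ultimately have "\<Xi> \<star> (compE \<star> h) \<noteq> Z" using sat_A w(1) x by metis
  then show "\<exists>x\<in>N. Std M Ty0 x \<and> h \<star> x = Z"
    using Xi_std(2)[OF assms, of "compE \<star> h"] h std_comp has_st_path_comp by auto
qed

text \<open>For a standard pair of a function and a path through it, the path is a standard one and
  \<open>Xi_std\<close> applies. The formula expressing this is internal with \<open>\<Xi>\<close>
  as its only special constant, so it transfers; for standard \<open>f\<close>, the value of
  \<open>\<Xi>\<close> then yields a standard path from an arbitrary one.\<close>

lemma has_path_Xi:
  assumes "S2_st" "f \<in> Dom M Ty1" "has_path f"
  shows "\<Xi> \<star> f = Z"
proof -
  obtain g where g: "g \<in> Dom M Ty1" "\<And>x. x \<in> N \<Longrightarrow> f \<star> (barE \<star> g \<star> x) \<noteq> Z"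
    using assms(3) unfolding has_path_def by blast
  define v where "v = (0::nat, Ty0 \<rightarrow> Ty1)"
  let ?A = "all xv (\<^bold>\<not> (Var v \<cdot> zero \<cdot> (bar_c \<cdot> (Var v \<cdot> one) \<cdot> Var xv) \<approx> zero)) \<^bold>\<longrightarrow>
    Const (Xi k Ty2) \<cdot> (Var v \<cdot> zero) \<approx> zero"
  have sat_A: "sat M (e0(v := w)) [] ?A \<longleftrightarrow>
    ((\<forall>x\<in>N. w \<star> Z \<star> (barE \<star> (w \<star> S Z) \<star> x) \<noteq> Z) \<longrightarrow> \<Xi> \<star> (w \<star> Z) = Z)" for w
    by (simp add: v_def)
  have *: "sat M (e0(v := w)) [] ?A" if w: "w \<in> Dom M (Ty0 \<rightarrow> Ty1)" for w
  proof (rule PF_TP_D)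
    show "is_fm L ?A" using Xi_L by (simp add: is_fm_def v_def)
  next
    fix w assume w: "w \<in> Dom M (snd v)" "Std M (snd v) w"
    then have wi: "w \<star> Z \<in> Dom M Ty1" "w \<star> S Z \<in> Dom M Ty1" "Std M Ty1 (w \<star> Z)" "Std M Ty1 (w \<star> S Z)"
      using Ap_Dom[of w Ty0 Ty1] std_app[of Ty0 Ty1 w] std_const(1) std_S by (auto simp: v_def)
    then have "has_st_path (w \<star> Z)" if "\<forall>x\<in>N. w \<star> Z \<star> (barE \<star> (w \<star> S Z) \<star> x) \<noteq> Z"
      using that unfolding has_st_path_def by blast
    then show "sat M (e0(v := w)) [] ?A" unfolding sat_A using Xi_std(2)[OF assms(1)] wi by blast
  qed (use w in \<open>auto simp: v_def\<close>)
  \<comment> \<open>The pair is the function from numbers that returns \<open>f\<close> at 0 and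
    \<open>g\<close> at every other argument.\<close>
  let ?t = "lam xv (lam yv (cond_c \<cdot> Var xv \<cdot> (Var (1, Ty1) \<cdot> Var yv) \<cdot> (Var (2, Ty1) \<cdot> Var yv)))"
  define e where "e = e0((1, Ty1) := f, (2, Ty1) := g)"
  have e: "good M e" "e (1, Ty1) = f" "e (2, Ty1) = g" using assms(2) g by (simp_all add: e_def)
  define w where "w = ev M e [] ?t"
  have w: "w \<in> Dom M (Ty0 \<rightarrow> Ty1)" using e unfolding w_def by (intro ev_in_Dom) (auto simp: type_of.simps(4))
  have w_eq: "w \<star> n \<star> m = condE \<star> n \<star> (f \<star> m) \<star> (g \<star> m)" if "n \<in> N" "m \<in> N" for n m
    using e that unfolding w_def by (simp add: app_lam type_of.simps(4))
  have "w \<star> Z = f" "w \<star> S Z = g"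
    by (rule fun_eqI[of _ Ty0 Ty0]; use w Ap_Dom[OF w] assms(2) g w_eq in simp)+
  then show ?thesis using *[OF w] sat_A[of w] g(2) by simp
qed

theorem RB_if_S2:
  assumes "S2_st"
  shows "RB_sem"
proof -
  note tr = transfer_Xi[OF assms]
  have "\<exists>g\<in>Dom M Ty1. Std M Ty1 g \<and> (\<forall>x\<in>N. f \<star> (barE \<star> g \<star> x) \<noteq> Z)"
    if "f \<in> Dom M Ty1" "Std M Ty1 f" "has_path f" for f
    using that st_path_transfer[OF tr] has_path_Xi[OF assms] Xi_std(2)[OF assms] by blast
  then obtain \<Theta> where \<Theta>: "\<Theta> \<in> Dom M (Ty1 \<rightarrow> Seq Ty1)" "Std M (Ty1 \<rightarrow> Seq Ty1) \<Theta>"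
    "\<And>f. f \<in> Dom M Ty1 \<Longrightarrow> Std M Ty1 f \<Longrightarrow> has_path f \<Longrightarrow>
      \<exists>i\<in>N. i \<sqsubset> Cn M (Len Ty1) \<star> (\<Theta> \<star> f) \<and>
        (\<forall>x\<in>N. f \<star> (barE \<star> (Cn M (Idx Ty1) \<star> (\<Theta> \<star> f) \<star> i) \<star> x) \<noteq> Z)"
    using HAC_paths by blast
  obtain \<Psi> where \<Psi>: "\<Psi> \<in> Dom M (Ty1 \<rightarrow> Ty1)" "Std M (Ty1 \<rightarrow> Ty1) \<Psi>"
    "\<And>f i n. f \<in> Dom M Ty1 \<Longrightarrow> i \<in> N \<Longrightarrow> i \<sqsubset> Cn M (Len Ty1) \<star> (\<Theta> \<star> f) \<Longrightarrow> n \<in> N \<Longrightarrow>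
      Cn M (Idx Ty1) \<star> (\<Theta> \<star> f) \<star> i \<star> n \<sqsubseteq> \<Psi> \<star> f \<star> n"
    using std_path_bound[OF \<Theta>(1,2)] by blast
  show ?thesis
    unfolding RB_sem_def
  proof (intro bexI[of _ \<Psi>] conjI ballI HOL.impI)
    fix f m assume f: "f \<in> Dom M Ty1" "Std M Ty1 f" and m: "m \<in> N" "\<not> Std M Ty0 m"
    have p: "\<Psi> \<star> f \<in> Dom M Ty1" "Std M Ty1 (\<Psi> \<star> f)" using \<Psi> f Ap_Dom std_app by blast+
    show "bounded_search (\<Psi> \<star> f) f m \<longleftrightarrow> \<not> has_path f"
    proof
      \<comment> \<open>By contraposition: a failed search yields a standard function that avoids
        zeros at standard lengths, and transfer extends this to all lengths.\<close>
      assume "\<not> has_path f"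
      moreover have "has_path f" if "has_st_path f"
        using st_path_transfer[OF tr that f] unfolding has_path_def by blast
      ultimately show "bounded_search (\<Psi> \<star> f) f m" using no_bounded_search p m by blast
    next
      assume b: "bounded_search (\<Psi> \<star> f) f m"
      show "\<not> has_path f"
      proof
        assume "has_path f"
        then obtain i where i: "i \<in> N" "i \<sqsubset> Cn M (Len Ty1) \<star> (\<Theta> \<star> f)"
          "\<And>x. x \<in> N \<Longrightarrow> f \<star> (barE \<star> (Cn M (Idx Ty1) \<star> (\<Theta> \<star> f) \<star> i) \<star> x) \<noteq> Z"
          using \<Theta>(3) f by blast
        let ?g = "Cn M (Idx Ty1) \<star> (\<Theta> \<star> f) \<star> i"
        have g: "?g \<in> Dom M Ty1" using const_Dom(7) \<Theta>(1) f(1) i(1) by (blast intro: Ap_Dom)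
        \<comment> \<open>The right candidate stays below the bound, so its initial segment is among
          the sequences that the bounded search covers.\<close>
        have "nthE \<star> (barE \<star> ?g \<star> m) \<star> n \<sqsubseteq> nthE \<star> (barE \<star> (\<Psi> \<star> f) \<star> m) \<star> n" if "n \<in> N" "n \<sqsubset> m" for n
          using nth_bar[OF g that(1) m(1) that(2)] nth_bar[OF p(1) that(1) m(1) that(2)] \<Psi>(3)[OF f(1) i(1,2) that(1)]
          by simp
        then have "seqle (barE \<star> ?g \<star> m) (barE \<star> (\<Psi> \<star> f) \<star> m)"
          using g p m by (simp add: seqle_def)
        then obtain x where "x \<in> N" "x \<sqsubseteq> m" "f \<star> (initE \<star> (barE \<star> ?g \<star> m) \<star> x) = Z"
          using b g m unfolding bounded_search_def by auto
        then show False using i(3) init_bar[OF g _ m(1)] by simp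
      qed
    qed
  qed (use \<Psi> in auto)
qed


section \<open>From the bound to the Suslin functional\<close>

lemma not_has_path_comp:
  assumes "h \<in> Dom M Ty1" "x \<in> N" "h \<star> x = Z"
  shows "\<not> has_path (compE \<star> h)"
  using assms by (auto simp: has_path_def)

lemma transfer_RB:
  assumes "RB_sem"
  shows "transfer"
  unfolding transfer_def
proof (intro ballI HOL.impI)
  fix h assume h: "h \<in> Dom M Ty1" "Std M Ty1 h" "\<exists>x\<in>N. h \<star> x = Z"
  obtain \<Phi> where \<Phi>: "\<Phi> \<in> Dom M (Ty1 \<rightarrow> Ty1)" "\<And>f m. f \<in> Dom M Ty1 \<Longrightarrow> Std M Ty1 f \<Longrightarrow> m \<in> N \<Longrightarrow> \<not> Std M Ty0 m \<Longrightarrow>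
      (bounded_search (\<Phi> \<star> f) f m \<longleftrightarrow> \<not> has_path f)"
    using assms unfolding RB_sem_def by blast
  let ?f = "compE \<star> h"
  have f: "?f \<in> Dom M Ty1" "Std M Ty1 ?f" using h std_comp by auto
  have p: "\<Phi> \<star> ?f \<in> Dom M Ty1" using \<Phi>(1) f(1) by (rule Ap_Dom)
  obtain x0 where x0: "x0 \<in> N" "h \<star> x0 = Z" using h by blast
  \<comment> \<open>The tree ignores entries, so the initial segment of the bound itself can be fed
    to the bounded search; the length at which it succeeds is a zero of \<open>h\<close>.\<close>
  have small: "\<exists>x\<in>N. x \<sqsubseteq> m \<and> h \<star> x = Z" if m: "m \<in> N" "\<not> Std M Ty0 m" for m
  proof -
    let ?s = "barE \<star> (\<Phi> \<star> ?f) \<star> m"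
    have "bounded_search (\<Phi> \<star> ?f) ?f m" using \<Phi>(2)[OF f m] not_has_path_comp[OF h(1) x0] by blast
    moreover have "seqle ?s ?s" "?s \<in> N" using p m by (auto simp: seqle_def)
    ultimately obtain x where x: "x \<in> N" "x \<sqsubseteq> m" "?f \<star> (initE \<star> ?s \<star> x) = Z"
      unfolding bounded_search_def by blast
    then have "h \<star> x = Z" using init_bar[OF p x(1) m(1) x(2)] p h by simp
    then show ?thesis using x by blast
  qed
  \<comment> \<open>Searching up to a known zero, standard or not, gives the least zero.\<close>
  let ?w = "searchE \<star> h \<star> x0"
  have w: "?w \<in> N" "h \<star> ?w = Z" using search_zero[OF h(1) x0 x0(1)] x0 h by auto
  have "Std M Ty0 ?w"
    using w(1)
  proof (cases rule: N_cases)
    \<comment> \<open>If the predecessor \<open>v\<close> of the least zero were infinite,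
      \<open>small\<close> would give a zero at or below \<open>v\<close>. So \<open>v\<close> is
      standard, and with it the least zero.\<close>
    case (2 v)
    have "Std M Ty0 v"
    proof (rule ccontr)
      assume "\<not> Std M Ty0 v"
      then obtain x where "x \<in> N" "x \<sqsubseteq> v" "h \<star> x = Z" using small 2 by blast
      then show False using search_least[OF h(1) _ x0(1)] 2 by auto
    qed
    then show ?thesis using 2 std_S by simp
  qed (simp add: std_const)
  then show "\<exists>x\<in>N. Std M Ty0 x \<and> h \<star> x = Z" using w by blast
qed

text \<open>Once the least zero, if there is any, is bounded by a standard functional, it is enough
  to look at the value where the search up to this bound ends.\<close>

lemma zero_decider:
  assumes "transfer"
  shows "\<exists>E\<in>Dom M Ty2. Std M Ty2 E \<and> (\<forall>h\<in>Dom M Ty1. Std M Ty1 h \<longrightarrow> (E \<star> h = Z \<longleftrightarrow> (\<exists>x\<in>N. h \<star> x = Z)))"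
proof -
  obtain b where b: "b \<in> Dom M Ty2" "Std M Ty2 b" "\<And>h. h \<in> Dom M Ty1 \<Longrightarrow> Std M Ty1 h \<Longrightarrow> \<exists>x\<in>N. h \<star> x = Z \<Longrightarrow>
      \<exists>x\<in>N. x \<sqsubseteq> b \<star> h \<and> h \<star> x = Z"
    using HAC_zeros[OF assms] by blast
  have "srep Ty1 Ty0 (\<lambda>h. h \<star> (searchE \<star> h \<star> (b \<star> h)))" by (rule srep_intros | fact)+
  then obtain E where E: "E \<in> Dom M Ty2" "Std M Ty2 E" "\<And>h. h \<in> Dom M Ty1 \<Longrightarrow> E \<star> h = h \<star> (searchE \<star> h \<star> (b \<star> h))"
    unfolding srep_def by blast
  have "E \<star> h = Z \<longleftrightarrow> (\<exists>x\<in>N. h \<star> x = Z)" if h: "h \<in> Dom M Ty1" "Std M Ty1 h" for h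
  proof -
    have bh: "b \<star> h \<in> N" using b(1) h(1) by (rule Ap_Dom)
    then have "searchE \<star> h \<star> (b \<star> h) \<in> N" using h by simp
    then show ?thesis using E(3)[OF h(1)] b(3)[OF h] search_zero[OF h(1) _ _ bh] by metis
  qed
  then show ?thesis using E by blast
qed

theorem S2_if_RB:
  assumes "RB_sem"
  shows "S2_st"
proof -
  note tr = transfer_RB[OF assms]
  obtain \<Phi> where \<Phi>: "\<Phi> \<in> Dom M (Ty1 \<rightarrow> Ty1)" "Std M (Ty1 \<rightarrow> Ty1) \<Phi>"
    "\<And>f m. f \<in> Dom M Ty1 \<Longrightarrow> Std M Ty1 f \<Longrightarrow> m \<in> N \<Longrightarrow> \<not> Std M Ty0 m \<Longrightarrow>
      (bounded_search (\<Phi> \<star> f) f m \<longleftrightarrow> \<not> has_path f)"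
    using assms unfolding RB_sem_def by blast
  obtain m where m: "m \<in> N" "\<not> Std M Ty0 m" using ex_nonstandard by blast
  have "\<exists>g\<in>Dom M Ty1. Std M Ty1 g \<and> (\<forall>x\<in>N. f \<star> (barE \<star> g \<star> x) \<noteq> Z)"
    if f: "f \<in> Dom M Ty1" "Std M Ty1 f" and "has_path f" for f
  proof -
    \<comment> \<open>The path may be nonstandard. \<open>RB\<close> turns its mere existence into
      failure of the search at the infinite \<open>m\<close>, and a failing sequence is bounded by a
      standard function.\<close>
    have "\<not> bounded_search (\<Phi> \<star> f) f m" using \<Phi>(3)[OF f m] that by blast
    moreover have "\<Phi> \<star> f \<in> Dom M Ty1" "Std M Ty1 (\<Phi> \<star> f)" using \<Phi>(1,2) f Ap_Dom std_app by blast+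
    ultimately have "has_st_path f" using no_bounded_search m by blast
    then show ?thesis using st_path_transfer[OF tr] f by blast
  qed
  then obtain \<Theta> where \<Theta>: "\<Theta> \<in> Dom M (Ty1 \<rightarrow> Seq Ty1)" "Std M (Ty1 \<rightarrow> Seq Ty1) \<Theta>"
    "\<And>f. f \<in> Dom M Ty1 \<Longrightarrow> Std M Ty1 f \<Longrightarrow> has_path f \<Longrightarrow>
      \<exists>i\<in>N. i \<sqsubset> Cn M (Len Ty1) \<star> (\<Theta> \<star> f) \<and>
        (\<forall>x\<in>N. f \<star> (barE \<star> (Cn M (Idx Ty1) \<star> (\<Theta> \<star> f) \<star> i) \<star> x) \<noteq> Z)"
    using HAC_paths by blast
  obtain E where E: "E \<in> Dom M Ty2" "Std M Ty2 E"
    "\<And>h. h \<in> Dom M Ty1 \<Longrightarrow> Std M Ty1 h \<Longrightarrow> E \<star> h = Z \<longleftrightarrow> (\<exists>x\<in>N. h \<star> x = Z)"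
    using zero_decider[OF tr] by blast
  let ?\<theta> = "Var (4, Ty1 \<rightarrow> Seq Ty1) \<cdot> Var (1, Ty1)"
  \<comment> \<open>Zeros mark good candidates: \<open>E\<close> is nonzero exactly if the candidate
    never meets a zero of \<open>f\<close>, and subtraction from 1 reverses this so that
    \<open>searchE\<close> can look for it.\<close>
  let ?t = "lam (1, Ty1) (lam xv (monus_c \<cdot> one \<cdot>
    (Var (3, Ty2) \<cdot> (path_c \<cdot> Var (1, Ty1) \<cdot> (Const (Idx Ty1) \<cdot> ?\<theta> \<cdot> Var xv)))))"
  define e where "e = e0((4, Ty1 \<rightarrow> Seq Ty1) := \<Theta>, (3, Ty2) := E)"
  have e: "good M e" "e (4, Ty1 \<rightarrow> Seq Ty1) = \<Theta>" "e (3, Ty2) = E" using \<Theta> E by (simp_all add: e_def)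
  define K where "K = ev M e [] ?t"
  have K: "K \<in> Dom M (Ty1 \<rightarrow> Ty1)" using e unfolding K_def by (intro ev_in_Dom) (auto simp: type_of.simps(4))
  have K_std: "Std M (Ty1 \<rightarrow> Ty1) K"
    using e \<Theta> E unfolding K_def by (intro std_ev) (auto simp: type_of.simps(4))
  have K_eq: "K \<star> f \<star> i = S Z \<ominus> E \<star> (pathE \<star> f \<star> (Cn M (Idx Ty1) \<star> (\<Theta> \<star> f) \<star> i))"
    if "f \<in> Dom M Ty1" "i \<in> N" for f i
    using e that unfolding K_def by (simp add: app_lam type_of.simps(4))
  have "srep Ty1 Ty0 (\<lambda>f. K \<star> f \<star> (searchE \<star> (K \<star> f) \<star> (Cn M (Len Ty1) \<star> (\<Theta> \<star> f))))"
    by (rule srep_intros | fact)+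
  then obtain F where F: "F \<in> Dom M Ty2" "Std M Ty2 F"
    "\<And>f. f \<in> Dom M Ty1 \<Longrightarrow> F \<star> f = K \<star> f \<star> (searchE \<star> (K \<star> f) \<star> (Cn M (Len Ty1) \<star> (\<Theta> \<star> f)))"
    unfolding srep_def by blast
  have "F \<star> f = Z \<longleftrightarrow> has_st_path f" if f: "f \<in> Dom M Ty1" "Std M Ty1 f" for f
  proof -
    let ?g = "\<lambda>i. Cn M (Idx Ty1) \<star> (\<Theta> \<star> f) \<star> i" and ?l = "Cn M (Len Ty1) \<star> (\<Theta> \<star> f)"
    have \<Theta>f: "\<Theta> \<star> f \<in> Dom M (Seq Ty1)" "Std M (Seq Ty1) (\<Theta> \<star> f)" using \<Theta> f Ap_Dom std_app by blast+
    then have l: "?l \<in> N" "Std M Ty0 ?l" using const_Dom(6) std_const(3) Ap_Dom std_app by blast+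
    have idx: "Cn M (Idx Ty1) \<star> (\<Theta> \<star> f) \<in> Dom M (Ty0 \<rightarrow> Ty1)" "Std M (Ty0 \<rightarrow> Ty1) (Cn M (Idx Ty1) \<star> (\<Theta> \<star> f))"
      using \<Theta>f const_Dom(7) std_const(4) Ap_Dom std_app by blast+
    have Kf: "K \<star> f \<in> Dom M Ty1" using K f(1) by (rule Ap_Dom)
    \<comment> \<open>The index \<open>?l\<close> itself is included although it lies beyond the
      last candidate, because an unsuccessful search ends there. The projection at that index is
      still a standard function, so the test remains correct for it.\<close>
    have g: "?g i \<in> Dom M Ty1" "Std M Ty1 (?g i)" if "i \<in> N" "i \<sqsubseteq> ?l" for i
      using that idx l std_below Ap_Dom std_app by blast+
    have K_zero: "K \<star> f \<star> i = Z \<longleftrightarrow> (\<forall>x\<in>N. f \<star> (barE \<star> ?g i \<star> x) \<noteq> Z)" if i: "i \<in> N" "i \<sqsubseteq> ?l" for i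
    proof -
      let ?h = "pathE \<star> f \<star> ?g i"
      have h: "?h \<in> Dom M Ty1" "Std M Ty1 ?h" using f g[OF i] std_path by auto
      have "S Z \<ominus> a = Z \<longleftrightarrow> a \<noteq> Z" if "a \<in> N" for a using that by (cases rule: N_cases) auto
      moreover have "E \<star> ?h \<in> N" using E(1) h(1) by (rule Ap_Dom)
      ultimately have "K \<star> f \<star> i = Z \<longleftrightarrow> E \<star> ?h \<noteq> Z" using K_eq[OF f(1) i(1)] by simp
      then show ?thesis using E(3)[OF h] f g[OF i] by simp
    qed
    let ?i = "searchE \<star> (K \<star> f) \<star> ?l"
    have i: "?i \<in> N" "?i \<sqsubseteq> ?l" using Kf l search_le by auto
    show ?thesis
    proof
      assume "F \<star> f = Z"
      then have "\<forall>x\<in>N. f \<star> (barE \<star> ?g ?i \<star> x) \<noteq> Z" using K_zero[OF i] F(3)[OF f(1)] by simp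
      then show "has_st_path f" using g[OF i] unfolding has_st_path_def by blast
    next
      assume "has_st_path f"
      then have "has_path f" using st_path_transfer[OF tr _ f] unfolding has_path_def by blast
      then obtain j where j: "j \<in> N" "j \<sqsubset> ?l" "\<forall>x\<in>N. f \<star> (barE \<star> ?g j \<star> x) \<noteq> Z"
        using \<Theta>(3) f by blast
      then have "j \<sqsubseteq> ?l" using lt_imp_le l by blast
      then have "K \<star> f \<star> ?i = Z" using search_zero[OF Kf j(1) _ l(1)] K_zero[of j] j by simp
      then show "F \<star> f = Z" using F(3)[OF f(1)] by simp
    qed
  qed
  then show ?thesis using F unfolding S2_st_def by blast
qed

end

theorem theorem7p3:
  fixes spec :: spec and k :: nat
  assumes "admissible spec"
    and "spec k = Some (Ty2, suslin_spec)"
  shows "provable (lang spec) (RCA0_Omega spec \<union> {STP}) (rel S2 \<^bold>\<longleftrightarrow> RB)"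
proof (rule completeness)
  show "RCA0_omega (lang spec) \<subseteq> RCA0_Omega spec \<union> {STP}"
    by (auto intro: RCA0_Omega.RCA0_omega)
next
  show "(eq \<sigma> (Var (0, \<sigma>)) (Var (1, \<sigma>)) \<^bold>\<longrightarrow> St \<sigma> (Var (0, \<sigma>)) \<^bold>\<longrightarrow> St \<sigma> (Var (1, \<sigma>))) \<in> RCA0_Omega spec \<union> {STP}" for \<sigma>
    using RCA0_Omega.st_eq by blast
next
  show "is_fm (lang spec) (rel S2 \<^bold>\<longleftrightarrow> RB)"
    by (simp add: is_fm_def S2_def suslin_def RB_def Let_def)
next
  fix M :: "tm set interp"
  assume M: "extensional (lang spec) M"
    and valid: "\<And>A. A \<in> RCA0_Omega spec \<union> {STP} \<Longrightarrow> is_fm (lang spec) A \<Longrightarrow> valid M A"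
  have "base_model (lang spec) M"
    by (intro base_model.intro base_model_axioms.intro M) (auto intro: valid RCA0_Omega.RCA0_omega)
  then have "omega_model (lang spec) M spec k"
    by (intro omega_model.intro omega_model_axioms.intro) (use assms valid in auto)
  then interpret omega_model "lang spec" M spec k .
  show "valid M (rel S2 \<^bold>\<longleftrightarrow> RB)"
    unfolding valid_def using RB_if_S2 S2_if_RB by (simp add: sat_S2 sat_RB del: rel.simps)
qed

end
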